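(* Let $m\geq 2$ be an integer and let $\Gamma=\Gamma(1/4)$. Then there exist rational numbers $q_{1,m},q_{2,m},q_{3,m},q_{4,m},q_{5,m}\in\mathbb{Q}$ such that $$\int_{0}^{\infty} \frac{x^{4m-3}\, dx}{[\cosh(2x)-\cos(2x)]\,[\cosh x-\cos x]} = q_{1,m}\frac{\Gamma^{8m-8}}{\pi^{2m-2}} + q_{2,m}\frac{\Gamma^{8m-6}}{\sqrt{2}\,\pi^{2m-3/2}} + q_{3,m}\frac{\Gamma^{8m-4}}{\pi^{2m-1}} + q_{4,m}\frac{\Gamma^{8m-2}}{\sqrt{2}\,\pi^{2m+1/2}} + q_{5,m}\frac{\Gamma^{8m}}{\pi^{2m+2}}.$$
   Context: Here $\Gamma(1/4)$ is the value at $1/4$ of Euler's Gamma function $\Gamma(z)=\int_0^\infty e^{-t}t^{z-1}\,dt$; the symbol $\Gamma$ without argument abbreviates this number. *)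

theory Defs
  imports "HOL-Analysis.Analysis"
begin

end

theory Submission
  imports Defs "HOL-Complex_Analysis.Complex_Analysis"
begin

text \<open>
  Write \<open>p = 4 m - 3\<close> and \<open>\<phi>(v) = 1 / (sinh v sinh (2 v)) = (cosh v / sinh\<^sup>2 v - 1 / cosh v) / 2\<close>. The integrand is
  multiplied by \<open>- 1\<close> together with \<open>dz\<close> under \<open>z \<mapsto> \<i> z\<close>, so integrating over the boundary of a square in the first
  quadrant expresses twice the integral by residues on the diagonal, that is, by the alternating sums of
  \<open>(v\<^sup>p \<phi>)'\<close> at the multiples of \<open>\<pi>\<close> and of \<open>v\<^sup>p \<phi>\<close> at the odd multiples of \<open>\<pi> / 2\<close>.

  These sums are moments of the sequences \<open>1 / cosh (N \<pi> / 2)\<close>, \<open>1 / sinh (N \<pi> / 2)\<close> and of their first two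
  derivatives. Under convolution the sequences without derivatives satisfy the differential equations of the
  Jacobi functions \<open>cn\<close>, \<open>sn\<close>, \<open>dn\<close>, and the derivatives are polynomials in these and in a zeta function
  \<open>Z\<close>; all this follows from the addition theorems of \<open>tanh\<close> and \<open>coth\<close> by telescoping. Hence the generating
  functions of the moments have Taylor coefficients that are rational multiples of monomials in \<open>\<lambda>\<close> and \<open>1 / \<pi>\<close>. 
  A second contour integral gives \<open>sn = dn\<close> at the quarter period, so that the curve is lemniscatic and
  \<open>\<lambda>\<close> is a Beta integral; the symmetry \<open>sl (\<i> x) = \<i> sl x\<close> of the lemniscate sine kills all but five monomials.
\<close>

section \<open>Moments of rapidly decreasing sequences\<close>

text \<open>The residues carry the signs \<open>cos (N * pi / 2)\<close> and
  \<open>sin (N * pi / 2)\<close>, so each sum of residues is a Taylor coefficient of a Jacobi or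
  zeta function at the quarter period. Formal power series at this one point avoid complex elliptic
  functions; the functions on the real line serve only to find the size \<open>lam\<close> and the
  constant \<open>kA\<close>. Powers of \<open>1 / pi\<close> enter through the zeta function:
  \<open>Z\<close> has the linear part \<open>- kA * X\<close>, and \<open>kA = 1 / pi\<close> is a
  form of Legendre's relation. Put \<open>P = pi * lam\<close> and \<open>k = 4 * m - 4\<close>.
  Counting weights leaves six candidates: \<open>P^k\<close>, \<open>P^(k+1)\<close>,
  \<open>P^(k+2)\<close>, \<open>P^(k+3) / pi\<close>, \<open>P^(k+4) / pi^2\<close> and
  \<open>P^(k+2) / pi\<close>. The last one could come only from the moments of \<open>sZ1\<close>
  and \<open>sZ2\<close>; as 4 divides \<open>k\<close>, the rotation symmetry removes exactly this
  one. The denominator of the integrand vanishes to order four at the origin, so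
  \<open>m >= 2\<close>, that is \<open>p >= 5\<close>, makes the corner of the square
  harmless.\<close>

lemma has_sum_Times_mult:
  fixes f :: "'a \<Rightarrow> complex" and g :: "'b \<Rightarrow> complex"
  assumes f: "(\<lambda>x. norm (f x)) summable_on UNIV" and g: "(\<lambda>x. norm (g x)) summable_on UNIV"
  shows "((\<lambda>(j,l). f j * g l) has_sum (infsum f UNIV * infsum g UNIV)) UNIV" (is ?g1)
    and "(\<lambda>p. norm (case p of (j,l) \<Rightarrow> f j * g l)) summable_on UNIV" (is ?g2)
proof -
  have *: "(\<lambda>p. norm (case p of (j,l) \<Rightarrow> f j * g l)) summable_on (Sigma UNIV (\<lambda>_. UNIV))"
    unfolding Infinite_Sum.abs_summable_on_Sigma_iff
  proof (intro conjI ballI)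
    show "(\<lambda>y. norm (case (x, y) of (j, l) \<Rightarrow> f j * g l)) summable_on UNIV" for x
      using g by (auto simp: norm_mult intro: summable_on_cmult_right)
    have "(\<lambda>x. norm (f x) * (\<Sum>\<^sub>\<infinity>y. norm (g y))) summable_on UNIV"
      using f by (intro summable_on_cmult_left)
    then show "(\<lambda>x. norm (\<Sum>\<^sub>\<infinity>y. norm (case (x, y) of (j, l) \<Rightarrow> f j * g l))) summable_on UNIV"
      by (simp add: norm_mult infsum_cmult_right' abs_mult infsum_nonneg)
  qed
  then show ?g2 by simp
  have "((\<lambda>(j,l). f j * g l) has_sum (infsum f UNIV * infsum g UNIV)) (Sigma UNIV (\<lambda>_. UNIV))"
  proof (rule has_sum_SigmaI)
    show "((\<lambda>y. case (x, y) of (j, l) \<Rightarrow> f j * g l) has_sum (f x * infsum g UNIV)) UNIV" for x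
      using Infinite_Sum.abs_summable_summable[OF g] by (auto intro!: has_sum_cmult_right)
    show "((\<lambda>x. f x * infsum g UNIV) has_sum (infsum f UNIV * infsum g UNIV)) UNIV"
      using Infinite_Sum.abs_summable_summable[OF f] by (auto intro!: has_sum_cmult_left)
    show "(\<lambda>(j, l). f j * g l) summable_on UNIV \<times> UNIV"
      using * by (rule Infinite_Sum.abs_summable_summable)
  qed
  then show ?g1 by simp
qed

lemma has_sum_sum:
  fixes f :: "'i \<Rightarrow> 'a \<Rightarrow> complex"
  assumes "finite I" "\<And>i. i \<in> I \<Longrightarrow> (f i has_sum s i) A"
  shows "((\<lambda>x. \<Sum>i\<in>I. f i x) has_sum (\<Sum>i\<in>I. s i)) A"
  using assms
proof (induction I rule: finite_induct)
  case (insert i I)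
  then have "((\<lambda>x. f i x + (\<Sum>i\<in>I. f i x)) has_sum (s i + (\<Sum>i\<in>I. s i))) A"
    by (intro has_sum_add) simp_all
  with insert show ?case by simp
qed simp

text \<open>Decay is measured against powers only. This is all that the moments need, and it
  survives multiplication by the index, which acts as differentiation.\<close>

definition rapid :: "(int \<Rightarrow> real) \<Rightarrow> bool" where
  "rapid a \<longleftrightarrow> (\<forall>n. (\<lambda>N. \<bar>a N\<bar> * \<bar>real_of_int N\<bar> ^ n) summable_on UNIV)"

text \<open>Since \<open>cis (N * x)\<close> is a character in \<open>N\<close>, the generating function \<open>mgf x\<close> below turns convolutions into products.\<close>

definition mterm :: "real \<Rightarrow> (int \<Rightarrow> real) \<Rightarrow> nat \<Rightarrow> int \<Rightarrow> complex" where
  "mterm x a n N = complex_of_real (a N * of_int N ^ n) * cis (of_int N * x)"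

definition moment :: "real \<Rightarrow> (int \<Rightarrow> real) \<Rightarrow> nat \<Rightarrow> complex" where
  "moment x a n = (\<Sum>\<^sub>\<infinity>N. mterm x a n N)"

text \<open>Formally this is the sum of \<open>a N * cis (N * x) * exp (N * X)\<close>, the Fourier
  series of \<open>a\<close> at the complex point \<open>x - \<i> X\<close>. The division by
  \<open>fact n\<close> makes the factor \<open>N\<close> act as the derivative in
  \<open>X\<close>.\<close>

definition mgf :: "real \<Rightarrow> (int \<Rightarrow> real) \<Rightarrow> complex fps" where
  "mgf x a = Abs_fps (\<lambda>n. moment x a n / fact n)"

lemma mterm_abs_summable: "rapid a \<Longrightarrow> (\<lambda>N. norm (mterm x a n N)) summable_on UNIV"
  by (simp add: rapid_def mterm_def norm_mult abs_mult norm_power)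

lemma moment_has_sum: "rapid a \<Longrightarrow> (mterm x a n has_sum moment x a n) UNIV"
  unfolding moment_def by (rule has_sum_infsum[OF Infinite_Sum.abs_summable_summable[OF mterm_abs_summable]])

lemma summable_on_int_exp: "(\<lambda>N. exp (- \<bar>real_of_int N\<bar> / 2)) summable_on UNIV"
proof -
  have nat: "(\<lambda>n. exp (- real n / 2)) summable_on UNIV"
  proof (rule norm_summable_imp_summable_on)
    have "(\<lambda>n. exp (- real n / 2)) = (\<lambda>n. exp (- 1 / 2 :: real) ^ n)"
      by (auto simp: fun_eq_iff exp_of_nat_mult[symmetric])
    moreover have "summable (\<lambda>n. exp (- 1 / 2 :: real) ^ n)"
      by (rule summable_geometric) simp
    ultimately show "summable (\<lambda>n. norm (exp (- real n / 2)))" by simp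
  qed
  have 1: "(\<lambda>N. exp (- \<bar>real_of_int N\<bar> / 2)) summable_on {0..}"
    using nat by (subst summable_on_reindex_bij_witness[where T=UNIV and i=int and j=nat
        and h="\<lambda>n. exp (- real n / 2)"]) auto
  have 2: "(\<lambda>N. exp (- \<bar>real_of_int N\<bar> / 2)) summable_on {..0}"
    using nat by (subst summable_on_reindex_bij_witness[where T=UNIV and i="\<lambda>n. - int n"
        and j="\<lambda>N. nat (-N)" and h="\<lambda>n. exp (- real n / 2)"]) auto
  have "(\<lambda>N. exp (- \<bar>real_of_int N\<bar> / 2)) summable_on ({0..} \<union> {..0})"
    by (rule summable_on_union[OF 1 2])
  also have "({0..} \<union> {..0}) = (UNIV::int set)" by auto
  finally show ?thesis .
qed

text \<open>Half of the exponential rate absorbs the polynomial weight, because \<open>t ^ n\<close>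
  is at most \<open>fact n * 2 ^ n * exp (t / 2)\<close>; the other half keeps the sum
  finite.\<close>

lemma rapidI:
  assumes "\<And>N. \<bar>a N\<bar> \<le> C * exp (- \<bar>real_of_int N\<bar>)"
  shows "rapid a"
  unfolding rapid_def
proof
  fix n
  have C: "C \<ge> 0" using assms[of 0] by simp
  have "(\<lambda>N. norm (\<bar>a N\<bar> * \<bar>real_of_int N\<bar> ^ n)) summable_on UNIV"
  proof (rule Infinite_Sum.abs_summable_on_comparison_test')
    show "(\<lambda>N. (C * (fact n * 2 ^ n)) * exp (- \<bar>real_of_int N\<bar> / 2)) summable_on UNIV"
      by (intro summable_on_cmult_right summable_on_int_exp)
    fix N :: int
    define t where "t = \<bar>real_of_int N\<bar>"
    have t: "t \<ge> 0" by (simp add: t_def)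
    have "(t/2)^n / fact n \<le> exp (t/2)"
    proof -
      have "(\<Sum>k\<in>{n}. (t/2)^k /\<^sub>R fact k) \<le> (\<Sum>k. (t/2)^k /\<^sub>R fact k)"
        using t by (intro sum_le_suminf summable_exp_generic) auto
      then show ?thesis by (simp add: exp_def field_simps)
    qed
    then have le: "t^n \<le> fact n * 2^n * exp (t/2)"
      by (simp add: field_simps power_divide)
    have "\<bar>a N\<bar> * t^n \<le> (C * exp (-t)) * (fact n * 2^n * exp (t/2))"
      using le assms[of N] t C by (intro mult_mono) (auto simp: t_def)
    also have "\<dots> = C * (fact n * 2 ^ n) * exp (- t / 2)"
    proof -
      have "exp (-t) * exp (t/2) = exp (-t/2)" by (simp flip: exp_add)
      then show ?thesis by (simp add: mult_ac)
    qed
    finally show "norm (\<bar>a N\<bar> * \<bar>real_of_int N\<bar> ^ n) \<le> C * (fact n * 2 ^ n) * exp (- \<bar>real_of_int N\<bar> / 2)"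
      by (simp add: t_def abs_mult power_abs)
  qed
  then show "(\<lambda>N. \<bar>a N\<bar> * \<bar>real_of_int N\<bar> ^ n) summable_on UNIV" by simp
qed

lemma rapid_times_index:
  assumes "rapid a" shows "rapid (\<lambda>N. of_int N * a N)"
  unfolding rapid_def
proof
  fix n
  have "(\<lambda>N. \<bar>a N\<bar> * \<bar>real_of_int N\<bar> ^ Suc n) summable_on UNIV"
    using assms unfolding rapid_def by blast
  then show "(\<lambda>N. \<bar>of_int N * a N\<bar> * \<bar>real_of_int N\<bar> ^ n) summable_on UNIV"
    by (simp add: abs_mult mult_ac)
qed

lemma rapid_lincomb:
  assumes "rapid a" "rapid b" shows "rapid (\<lambda>N. r * a N + s * b N)"
  unfolding rapid_def
proof
  fix n
  have "(\<lambda>N. norm ((r * a N + s * b N) * real_of_int N ^ n)) summable_on UNIV"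
  proof (rule Infinite_Sum.abs_summable_on_comparison_test')
    show "(\<lambda>N. \<bar>r\<bar> * (\<bar>a N\<bar> * \<bar>real_of_int N\<bar> ^ n) + \<bar>s\<bar> * (\<bar>b N\<bar> * \<bar>real_of_int N\<bar> ^ n)) summable_on UNIV"
      using assms unfolding rapid_def by (intro summable_on_add summable_on_cmult_right) auto
    show "norm ((r * a N + s * b N) * real_of_int N ^ n) \<le>
        \<bar>r\<bar> * (\<bar>a N\<bar> * \<bar>real_of_int N\<bar> ^ n) + \<bar>s\<bar> * (\<bar>b N\<bar> * \<bar>real_of_int N\<bar> ^ n)" for N
    proof -
      have "\<bar>r * a N + s * b N\<bar> * \<bar>real_of_int N\<bar>^n \<le> (\<bar>r * a N\<bar> + \<bar>s * b N\<bar>) * \<bar>real_of_int N\<bar>^n"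
        by (intro mult_right_mono) auto
      then show ?thesis by (simp add: abs_mult power_abs) (simp add: algebra_simps)
    qed
  qed
  then show "(\<lambda>N. \<bar>r * a N + s * b N\<bar> * \<bar>real_of_int N\<bar> ^ n) summable_on UNIV"
    by (simp add: abs_mult power_abs)
qed

definition delta0 :: "int \<Rightarrow> real" where "delta0 N = (if N = 0 then 1 else 0)"

lemma rapid_delta0: "rapid delta0"
  by (rule rapidI[of _ 1]) (simp add: delta0_def)

lemma moment_delta0: "moment x delta0 n = (if n = 0 then 1 else 0)"
proof -
  have "moment x delta0 n = (\<Sum>\<^sub>\<infinity>N\<in>{0}. mterm x delta0 n N)"
    unfolding moment_def by (rule infsum_cong_neutral) (auto simp: mterm_def delta0_def)
  then show ?thesis by (simp add: mterm_def delta0_def)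
qed

lemma mgf_delta0: "mgf x delta0 = 1"
  by (rule fps_ext) (simp add: mgf_def moment_delta0)

lemma mgf_lincomb:
  assumes "rapid a" "rapid b"
  shows "mgf x (\<lambda>N. r * a N + s * b N) = fps_const (of_real r) * mgf x a + fps_const (of_real s) * mgf x b"
proof (rule fps_ext)
  fix n
  have "(mterm x (\<lambda>N. r * a N + s * b N) n has_sum of_real r * moment x a n + of_real s * moment x b n) UNIV"
  proof -
    have "((\<lambda>N. of_real r * mterm x a n N + of_real s * mterm x b n N) has_sum
      of_real r * moment x a n + of_real s * moment x b n) UNIV"
      by (intro has_sum_add has_sum_cmult_right moment_has_sum assms)
    then show ?thesis by (simp add: mterm_def[abs_def] algebra_simps)
  qed
  then have "moment x (\<lambda>N. r * a N + s * b N) n = of_real r * moment x a n + of_real s * moment x b n"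
    unfolding moment_def by (rule infsumI)
  then show "fps_nth (mgf x (\<lambda>N. r * a N + s * b N)) n =
      fps_nth (fps_const (of_real r) * mgf x a + fps_const (of_real s) * mgf x b) n"
    by (simp add: mgf_def add_divide_distrib)
qed

lemma moment_times_index: "moment x (\<lambda>N. of_int N * a N) n = moment x a (Suc n)"
  unfolding moment_def by (rule infsum_cong) (simp add: mterm_def)

lemma mgf_times_index: "mgf x (\<lambda>N. of_int N * a N) = fps_deriv (mgf x a)"
  by (rule fps_ext) (simp add: mgf_def moment_times_index del: of_nat_Suc)

text \<open>Absolute convergence permits summation along \<open>j + l = N\<close>, and the binomial
  expansion of \<open>(j + l) ^ n\<close> is the Cauchy product of exponential generating
  functions.\<close>

lemma mgf_conv:
  assumes a: "rapid a" and b: "rapid b"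
    and c: "\<And>N. ((\<lambda>j. a j * b (N - j)) has_sum c N) UNIV"
  shows "mgf x c = mgf x a * mgf x b"
proof (rule fps_ext)
  fix n
  define S where "S = (\<Sum>i\<le>n. of_nat (n choose i) * (moment x a i * moment x b (n - i)))"
  define F where "F = (\<lambda>(j,l). \<Sum>i\<le>n. of_nat (n choose i) * (mterm x a i j * mterm x b (n - i) l))"
  have "((\<lambda>p. \<Sum>i\<le>n. of_nat (n choose i) * (case p of (j,l) \<Rightarrow> mterm x a i j * mterm x b (n - i) l))
      has_sum S) UNIV"
    unfolding S_def using has_sum_Times_mult(1)[OF mterm_abs_summable[OF a] mterm_abs_summable[OF b]]
    by (intro has_sum_sum has_sum_cmult_right finite_atMost) (auto simp: moment_def)
  then have F: "(F has_sum S) UNIV" by (simp add: F_def case_prod_unfold)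
  have F_eq: "F (j,l) = of_real (a j * b l * of_int (j + l) ^ n) * cis (of_int (j + l) * x)" for j l
  proof -
    have "F (j,l) = (\<Sum>i\<le>n. of_nat (n choose i) * of_int j ^ i * of_int l ^ (n - i)) *
           (of_real (a j * b l) * cis (of_int (j + l) * x))"
    proof -
      have cis: "cis (of_int (j + l) * x) = cis (of_int j * x) * cis (of_int l * x)"
        by (simp add: cis_mult distrib_right)
      show ?thesis
        unfolding F_def sum_distrib_right cis by (simp add: mterm_def mult_ac)
    qed
    also have "(\<Sum>i\<le>n. of_nat (n choose i) * of_int j ^ i * of_int l ^ (n - i)) = (of_int (j + l) ^ n :: complex)"
      unfolding of_int_add by (rule binomial_ring[symmetric])
    finally show ?thesis by (simp add: mult_ac)
  qed
  have "((\<lambda>(N,j). F (j, N - j)) has_sum S) (Sigma UNIV (\<lambda>_. UNIV))"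
  proof -
    have "((\<lambda>(N,j). F (j, N - j)) has_sum S) (Sigma UNIV (\<lambda>_. UNIV)) = (F has_sum S) UNIV"
      by (rule has_sum_reindex_bij_witness[where i="\<lambda>p. (fst p + snd p, fst p)"
            and j="\<lambda>p. (snd p, fst p - snd p)"]) (simp_all add: case_prod_unfold)
    with F show ?thesis by blast
  qed
  then have "((\<lambda>N. of_real (c N * of_int N ^ n) * cis (of_int N * x)) has_sum S) UNIV"
  proof (rule has_sum_Sigma')
    fix N
    have "((\<lambda>j. of_real (a j * b (N - j)) * (of_int N ^ n * cis (of_int N * x))) has_sum
         (of_real (c N * of_int N ^ n) * cis (of_int N * x))) UNIV"
      using has_sum_cmult_left[OF has_sum_of_real[OF c[of N]], of "of_int N ^ n * cis (of_int N * x)"]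
      by (simp add: mult.assoc)
    then show "((\<lambda>y. case (N, y) of (N, j) \<Rightarrow> F (j, N - j)) has_sum
         of_real (c N * real_of_int N ^ n) * cis (real_of_int N * x)) UNIV"
    proof (rule has_sum_cong[THEN iffD1, rotated])
      fix j
      have "j + (N - j) = N" by simp
      then show "of_real (a j * b (N - j)) * (of_int N ^ n * cis (of_int N * x)) =
          (case (N, j) of (N, j) \<Rightarrow> F (j, N - j))"
        by (simp only: prod.case F_eq) simp
    qed
  qed
  then have "moment x c n = S"
    unfolding moment_def mterm_def by (rule infsumI)
  moreover have "S / fact n = (\<Sum>i=0..n. moment x a i / fact i * (moment x b (n - i) / fact (n - i)))"
    unfolding S_def sum_divide_distrib
    by (rule sum.cong) (auto simp: binomial_fact field_simps)
  ultimately show "fps_nth (mgf x c) n = fps_nth (mgf x a * mgf x b) n"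
    by (simp add: mgf_def fps_mult_nth)
qed

section \<open>Convolution identities for hyperbolic sequences\<close>

lemma has_sum_single:
  fixes v :: real
  shows "((\<lambda>j. if j = k then v else 0) has_sum v) (UNIV :: int set)"
  by (rule has_sum_finite_neutralI[where B="{k}"]) auto

text \<open>Outside \<open>[0, N]\<close> the two signs cancel. Inside, they count the indices of
  one parity in \<open>[0, N)\<close> and again in \<open>(0, N]\<close>; these two intervals
  together contain exactly \<open>N\<close> indices of each parity, whatever the parity of
  \<open>N\<close>.\<close>

lemma sgn_parity_has_sum_nonneg:
  assumes "N \<ge> 0"
  shows "((\<lambda>j. if even j = p then sgn (real_of_int j) + sgn (real_of_int (N - j)) else 0)
    has_sum real_of_int N) UNIV"
proof (rule has_sum_finite_neutralI[where B="{0..N}"])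
  have "(\<Sum>j\<in>{0..<int n}. if even j = p then 1 else 0) + (\<Sum>j\<in>{0<..int n}. if even j = p then 1 else 0)
        = real n" for n
  proof (induction n)
    case (Suc n)
    have *: "{0..<int (Suc n)} = insert (int n) {0..<int n}" "{0<..int (Suc n)} = insert (int n + 1) {0<..int n}"
      by auto
    show ?case unfolding * using Suc.IH by auto
  qed simp
  from this[of "nat N"] assms
  have eq: "(\<Sum>j\<in>{0..<N}. if even j = p then 1 else 0) + (\<Sum>j\<in>{0<..N}. if even j = p then 1 else 0)
        = real_of_int N" by simp
  have "(\<Sum>j\<in>{0..N}. if even j = p then sgn (real_of_int j) + sgn (real_of_int (N - j)) else 0) =
        (\<Sum>j\<in>{0..N}. (if j < N then if even j = p then 1 else 0 else 0)
                   + (if 0 < j then if even j = p then 1 else 0 else 0))"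
    by (rule sum.cong) (auto simp: sgn_if)
  also have "\<dots> = (\<Sum>j\<in>{0..N}. if j < N then if even j = p then 1 else 0 else 0)
                 + (\<Sum>j\<in>{0..N}. if 0 < j then if even j = p then 1 else 0 else 0)"
    by (rule sum.distrib)
  also have "(\<Sum>j\<in>{0..N}. if j < N then if even j = p then 1 else 0 else (0::real))
           = (\<Sum>j\<in>{0..<N}. if even j = p then 1 else 0)"
    by (rule sum.mono_neutral_cong_right) auto
  also have "(\<Sum>j\<in>{0..N}. if 0 < j then if even j = p then 1 else 0 else (0::real))
           = (\<Sum>j\<in>{0<..N}. if even j = p then 1 else 0)"
    by (rule sum.mono_neutral_cong_right) auto
  finally show "real_of_int N = (\<Sum>j\<in>{0..N}. if even j = p
      then sgn (real_of_int j) + sgn (real_of_int (N - j)) else 0)" using eq by simp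
qed (use assms in \<open>auto simp: sgn_if\<close>)

lemma sgn_parity_has_sum:
  "((\<lambda>j. if even j = p then sgn (real_of_int j) + sgn (real_of_int (N - j)) else 0)
    has_sum real_of_int N) UNIV"
proof (cases "N \<ge> 0")
  case False
  have "((\<lambda>j. - (if even j = p then sgn (real_of_int j) + sgn (real_of_int (- N - j)) else 0))
    has_sum - real_of_int (- N)) UNIV"
    using False by (intro has_sum_uminusI sgn_parity_has_sum_nonneg) auto
  also have "?this \<longleftrightarrow> ?thesis"
    by (rule has_sum_reindex_bij_witness[where i=uminus and j=uminus]) (auto simp: sgn_if)
  finally show ?thesis .
qed (rule sgn_parity_has_sum_nonneg)

lemma odd_fun_parity_has_sum:
  fixes u :: "int \<Rightarrow> real"
  assumes "u summable_on UNIV" and odd: "\<And>j. u (- j) = - u j"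
  shows "((\<lambda>j. if even j = p then u j else 0) has_sum 0) UNIV"
proof -
  have "(\<lambda>j. norm (if even j = p then u j else 0)) summable_on UNIV"
  proof (rule Infinite_Sum.abs_summable_on_comparison_test')
    show "(\<lambda>j. \<bar>u j\<bar>) summable_on UNIV"
      using assms(1) summable_on_iff_abs_summable_on_real[of u UNIV] by simp
  qed auto
  then have "(\<lambda>j. if even j = p then u j else 0) summable_on UNIV"
    by (rule Infinite_Sum.abs_summable_summable)
  then obtain s where s: "((\<lambda>j. if even j = p then u j else 0) has_sum s) UNIV"
    unfolding summable_on_def by blast
  have "((\<lambda>j. - (if even j = p then u j else 0)) has_sum - s) UNIV"
    using s by (rule has_sum_uminusI)
  also have "?this \<longleftrightarrow> ((\<lambda>j. if even j = p then u j else 0) has_sum - s) UNIV"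
    by (rule has_sum_reindex_bij_witness[where i=uminus and j=uminus]) (auto simp: odd)
  finally have "s = - s" using s has_sum_unique by blast
  with s show ?thesis by simp
qed

lemma odd_pair_has_sum:
  fixes f g :: "int \<Rightarrow> real"
  assumes f: "(\<lambda>j. f j - sgn (of_int j)) summable_on UNIV" and fo: "\<And>j. f (- j) = - f j"
    and g: "(\<lambda>j. g j - sgn (of_int j)) summable_on UNIV" and go: "\<And>j. g (- j) = - g j"
  shows "((\<lambda>j. if even j = p then f j + g (N - j) else 0) has_sum real_of_int N) UNIV"
proof -
  \<comment> \<open>The odd functions \<open>f - sgn\<close> and \<open>g - sgn\<close> sum to \<open>0\<close>, so that only the \<open>sgn\<close> terms contribute.\<close>
  have 1: "((\<lambda>j. if even j = p then f j - sgn (of_int j) else 0) has_sum 0) UNIV"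
    by (rule odd_fun_parity_has_sum[OF f]) (simp add: fo sgn_if)
  \<comment> \<open>Replacing \<open>j\<close> by \<open>N - j\<close> keeps the parity for even
    \<open>N\<close> and changes it for odd \<open>N\<close>; the class is chosen so that it becomes
    \<open>p\<close> after this reflection.\<close>
  have "((\<lambda>j. if even j = (even N = p) then g j - sgn (of_int j) else 0) has_sum 0) UNIV"
    by (rule odd_fun_parity_has_sum[OF g]) (simp add: go sgn_if)
  also have "?this \<longleftrightarrow> ((\<lambda>j. if even j = p then g (N - j) - sgn (of_int (N - j)) else 0) has_sum 0) UNIV"
    by (rule has_sum_reindex_bij_witness[where i="\<lambda>j. N - j" and j="\<lambda>j. N - j"]) auto
  finally have 2: "((\<lambda>j. if even j = p then g (N - j) - sgn (of_int (N - j)) else 0) has_sum 0) UNIV" .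
  have "((\<lambda>j. (if even j = p then f j - sgn (of_int j) else 0) +
    (if even j = p then g (N - j) - sgn (of_int (N - j)) else 0) +
    (if even j = p then sgn (of_int j) + sgn (of_int (N - j)) else 0)) has_sum (0 + 0 + real_of_int N)) UNIV"
    by (intro has_sum_add 1 2 sgn_parity_has_sum)
  also have "(\<lambda>j. (if even j = p then f j - sgn (of_int j) else 0) +
    (if even j = p then g (N - j) - sgn (of_int (N - j)) else 0) +
    (if even j = p then sgn (of_int j) + sgn (of_int (N - j)) else 0)) =
    (\<lambda>j. if even j = p then f j + g (N - j) else 0)"
    by auto
  finally show ?thesis by simp
qed

text \<open>One integer index covers both kinds of poles: even \<open>N\<close> gives the multiples
  of \<open>pi\<close>, odd \<open>N\<close> the odd multiples of \<open>pi / 2\<close>.\<close>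

definition tt :: "int \<Rightarrow> real" where "tt N = of_int N * (pi / 2)"

lemma tt_simps: "tt 0 = 0" "tt (- N) = - tt N" "tt N = 0 \<longleftrightarrow> N = 0"
  by (simp_all add: tt_def)

lemma tt_split: "tt j + tt (N - j) = tt N"
proof -
  have "tt j + tt (N - j) = (of_int j + of_int (N - j)) * (pi / 2)"
    unfolding tt_def by (rule distrib_right[symmetric])
  then show ?thesis by (simp add: tt_def)
qed

lemma abs_tt_ge: "\<bar>tt N\<bar> \<ge> \<bar>of_int N\<bar>"
proof -
  have "\<bar>of_int N\<bar> * 1 \<le> \<bar>real_of_int N\<bar> * (pi / 2)"
    using pi_ge_two by (intro mult_left_mono) auto
  then show ?thesis by (simp add: tt_def abs_mult)
qed

lemma inverse_cosh_bound: "1 / cosh x \<le> 2 * exp (- \<bar>x::real\<bar>)"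
proof -
  have "exp \<bar>x\<bar> \<le> 2 * cosh x" by (auto simp: cosh_field_def abs_if)
  then have "1 \<le> 2 * cosh x * exp (- \<bar>x\<bar>)"
    by (simp add: exp_minus field_simps)
  then show ?thesis by (simp add: field_simps)
qed

lemma inverse_sinh_bound:
  assumes "\<bar>x::real\<bar> \<ge> 1" shows "1 / \<bar>sinh x\<bar> \<le> 4 * exp (- \<bar>x\<bar>)"
proof -
  define y where "y = \<bar>x\<bar>"
  have y: "y \<ge> 1" using assms by (simp add: y_def)
  have "exp (2 * y) \<ge> 1 + 2 * y" by (rule exp_ge_add_one_self)
  then have "exp (2 * y) \<ge> 2" using y by linarith
  then have "exp y * exp y \<ge> 2" by (simp flip: exp_add)
  then have "exp (- y) \<le> exp y / 2" by (simp add: exp_minus field_simps)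
  then have "exp y \<le> 4 * sinh y" by (simp add: sinh_field_def)
  moreover have "sinh y > 0" using y by simp
  ultimately have "1 / sinh y \<le> 4 * exp (- y)"
    by (simp add: exp_minus field_simps)
  moreover have "sinh y = \<bar>sinh x\<bar>" by (simp add: y_def)
  ultimately show ?thesis by (simp only: y_def)
qed

lemma sech_tt_bound: "1 / cosh (tt N) \<le> 2 * exp (- \<bar>of_int N\<bar>)"
  by (rule order_trans[OF inverse_cosh_bound]) (use abs_tt_ge[of N] in simp)

lemma csch_tt_bound: "1 / \<bar>sinh (tt N)\<bar> \<le> 4 * exp (- \<bar>of_int N\<bar>)"
proof (cases "N = 0")
  case False
  then have "\<bar>real_of_int N\<bar> \<ge> 1" by linarith
  then have "\<bar>tt N\<bar> \<ge> 1" using abs_tt_ge[of N] by linarith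
  then show ?thesis
    by (intro order_trans[OF inverse_sinh_bound]) (use abs_tt_ge[of N] in simp_all)
qed (simp add: tt_simps)

text \<open>Division by zero gives \<open>coth 0 = 0 = sgn 0\<close>. Thus \<open>coth\<close> is
  odd everywhere and \<open>coth (tt j)\<close> may be summed over all \<open>j\<close>, including
  0.\<close>

definition coth :: "real \<Rightarrow> real" where "coth x = cosh x / sinh x"

lemma coth_0 [simp]: "coth 0 = 0" by (simp add: coth_def)

lemma tanh_odd_pair: "(\<lambda>j. tanh (tt j) - sgn (of_int j)) summable_on UNIV" (is ?g1)
  and coth_odd_pair: "(\<lambda>j. coth (tt j) - sgn (of_int j)) summable_on UNIV" (is ?g2)
proof -
  have t: "\<bar>tanh (tt j) - sgn (of_int j)\<bar> \<le> 2 * exp (- \<bar>real_of_int j\<bar> / 2)" for j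
  proof -
    have "\<bar>tanh x - sgn x\<bar> \<le> 1 / cosh x" if "x \<noteq> 0" for x :: real
    proof (cases "x > 0")
      case True
      have "tanh x - 1 = - (exp (- x) / cosh x)"
        by (simp add: tanh_def field_simps) (simp add: sinh_field_def cosh_field_def field_simps)
      then show ?thesis using True cosh_real_nonneg[of x] by (simp add: divide_le_cancel not_less)
    next
      case False
      have "tanh x + 1 = (exp x / cosh x)"
        by (simp add: tanh_def field_simps) (simp add: sinh_field_def cosh_field_def field_simps)
      then show ?thesis using False that cosh_real_nonneg[of x] by (simp add: divide_le_cancel not_less)
    qed
    from this[of "tt j"] sech_tt_bound[of j]
    have "j \<noteq> 0 \<Longrightarrow> \<bar>tanh (tt j) - sgn (of_int j)\<bar> \<le> 2 * exp (- \<bar>of_int j\<bar>)"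
      by (auto simp: tt_simps tt_def sgn_mult)
    then show ?thesis by (cases "j = 0") (auto simp: tt_simps intro: order_trans)
  qed
  have c: "\<bar>coth (tt j) - sgn (of_int j)\<bar> \<le> 4 * exp (- \<bar>real_of_int j\<bar> / 2)" for j
  proof -
    have "\<bar>coth x - sgn x\<bar> \<le> 1 / \<bar>sinh x\<bar>" if "x \<noteq> 0" for x :: real
    proof (cases "x > 0")
      case True
      then have "sinh x > 0" by simp
      moreover from this have "coth x - 1 = exp (- x) / sinh x"
        by (simp add: coth_def field_simps) (simp add: sinh_field_def cosh_field_def field_simps)
      ultimately show ?thesis using True by (simp add: divide_le_cancel)
    next
      case False
      then have *: "sinh x < 0" using that by simp
      moreover from this have "coth x + 1 = exp x / sinh x"
        by (simp add: coth_def field_simps) (simp add: sinh_field_def cosh_field_def field_simps)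
      ultimately show ?thesis using False that by (simp add: abs_divide divide_le_cancel)
    qed
    from this[of "tt j"] csch_tt_bound[of j]
    have "j \<noteq> 0 \<Longrightarrow> \<bar>coth (tt j) - sgn (of_int j)\<bar> \<le> 4 * exp (- \<bar>of_int j\<bar>)"
      by (auto simp: tt_simps tt_def sgn_mult)
    then show ?thesis by (cases "j = 0") (auto simp: tt_simps intro: order_trans)
  qed
  have "(\<lambda>j. norm (tanh (tt j) - sgn (of_int j))) summable_on UNIV"
    by (rule Infinite_Sum.abs_summable_on_comparison_test'[OF summable_on_cmult_right[OF summable_on_int_exp, of 2]])
       (use t in auto)
  then show ?g1
    by (rule Infinite_Sum.abs_summable_summable)
  have "(\<lambda>j. norm (coth (tt j) - sgn (of_int j))) summable_on UNIV"
    by (rule Infinite_Sum.abs_summable_on_comparison_test'[OF summable_on_cmult_right[OF summable_on_int_exp, of 4]])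
       (use c in auto)
  then show ?g2
    by (rule Infinite_Sum.abs_summable_summable)
qed

lemma tanh_tanh_has_sum:
    "((\<lambda>j. if even j = p then tanh (tt j) + tanh (tt (N - j)) else 0) has_sum real_of_int N) UNIV" (is ?g1)
  and coth_tanh_has_sum:
    "((\<lambda>j. if even j = p then coth (tt j) + tanh (tt (N - j)) else 0) has_sum real_of_int N) UNIV" (is ?g2)
  and coth_coth_has_sum:
    "((\<lambda>j. if even j = p then coth (tt j) + coth (tt (N - j)) else 0) has_sum real_of_int N) UNIV" (is ?g3)
proof -
  have t: "tanh (tt (- j)) = - tanh (tt j)" for j by (simp add: tt_simps)
  have c: "coth (tt (- j)) = - coth (tt j)" for j by (simp add: tt_simps coth_def)
  show ?g1
    by (rule odd_pair_has_sum[OF tanh_odd_pair t tanh_odd_pair t])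
  show ?g2
    by (rule odd_pair_has_sum[OF coth_odd_pair c tanh_odd_pair t])
  show ?g3
    by (rule odd_pair_has_sum[OF coth_odd_pair c coth_odd_pair c])
qed

text \<open>Up to the sign \<open>\<i> ^ N\<close>, which enters through \<open>moment (pi / 2)\<close>, and up to factors \<open>\<i>\<close>, the sequences \<open>sA\<close>, \<open>sB\<close>,
  \<open>sD\<close>, \<open>sZ\<close> are the Fourier coefficients of \<open>cn\<close>, \<open>sn\<close>, \<open>dn\<close> and the zeta function for the nome \<open>exp (- pi)\<close>. A digit
  counts the derivatives with respect to \<open>tt N\<close>; the sign of a first derivative is reversed. At \<open>N = 0\<close> the
  sequences \<open>sZ\<close>, \<open>sZ1\<close> and \<open>sZ2\<close> vanish because \<open>1 / 0 = 0\<close>.\<close>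

definition sA :: "int \<Rightarrow> real" where "sA N = (if odd N then 1 / cosh (tt N) else 0)"
definition sB :: "int \<Rightarrow> real" where "sB N = (if odd N then 1 / sinh (tt N) else 0)"
definition sD :: "int \<Rightarrow> real" where "sD N = (if even N then 1 / cosh (tt N) else 0)"
definition sZ :: "int \<Rightarrow> real" where "sZ N = (if even N then 1 / sinh (tt N) else 0)"
definition sB1 :: "int \<Rightarrow> real" where "sB1 N = (if odd N then cosh (tt N) / sinh (tt N) ^ 2 else 0)"
definition sD1 :: "int \<Rightarrow> real" where "sD1 N = (if even N then sinh (tt N) / cosh (tt N) ^ 2 else 0)"
definition sZ1 :: "int \<Rightarrow> real" where "sZ1 N = (if even N then cosh (tt N) / sinh (tt N) ^ 2 else 0)"
definition sD2 :: "int \<Rightarrow> real" where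
  "sD2 N = (if even N then 1 / cosh (tt N) - 2 / cosh (tt N) ^ 3 else 0)"
definition sZ2 :: "int \<Rightarrow> real" where
  "sZ2 N = (if even N then 1 / sinh (tt N) + 2 / sinh (tt N) ^ 3 else 0)"
text \<open>By Parseval these are the mean values of the squares of the Fourier series of
  \<open>sA\<close> and \<open>sD\<close>. The sequence \<open>N * sZ N\<close> vanishes at 0 and
  cannot carry them, so they appear as constants next to the derivative of the zeta
  function.\<close>

definition kA :: real where "kA = (\<Sum>\<^sub>\<infinity>N. sA N ^ 2)"
definition kD :: real where "kD = (\<Sum>\<^sub>\<infinity>N. sD N ^ 2)"

lemma cosh_tt_ge_1: "cosh (tt N) \<ge> 1" by (rule cosh_real_ge_1)

lemma rapid_sA: "rapid sA" and rapid_sD: "rapid sD" and rapid_sB: "rapid sB" and rapid_sZ: "rapid sZ"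
proof -
  have pos: "cosh (tt N) > 0" for N by simp
  show "rapid sA"
    by (rule rapidI[of _ 2]) (use sech_tt_bound pos in \<open>simp add: sA_def abs_divide\<close>)
  show "rapid sD"
    by (rule rapidI[of _ 2]) (use sech_tt_bound pos in \<open>simp add: sD_def abs_divide\<close>)
  show "rapid sB"
    by (rule rapidI[of _ 4]) (use csch_tt_bound in \<open>simp add: sB_def abs_divide\<close>)
  show "rapid sZ"
    by (rule rapidI[of _ 4]) (use csch_tt_bound in \<open>simp add: sZ_def abs_divide\<close>)
qed

lemma abs_coth_tt_le: "\<bar>coth (tt N)\<bar> \<le> 5"
proof (cases "N = 0")
  case False
  have 1: "\<bar>cosh x\<bar> \<le> 1 + \<bar>sinh x\<bar>" for x :: real
  proof -
    have "(1 + \<bar>sinh x\<bar>) ^ 2 = 1 + sinh x ^ 2 + 2 * \<bar>sinh x\<bar>"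
      by (simp add: power2_sum)
    then have "cosh x ^ 2 \<le> (1 + \<bar>sinh x\<bar>) ^ 2"
      by (simp add: cosh_square_eq)
    then show ?thesis using abs_le_square_iff[of "cosh x" "1 + \<bar>sinh x\<bar>"] by simp
  qed
  have "1 / \<bar>sinh (tt N)\<bar> \<le> 4 * 1"
    by (rule order_trans[OF csch_tt_bound], rule mult_left_mono) auto
  moreover have "\<bar>coth (tt N)\<bar> \<le> (1 + \<bar>sinh (tt N)\<bar>) / \<bar>sinh (tt N)\<bar>"
    unfolding coth_def abs_divide by (intro divide_right_mono 1) auto
  moreover have "(1 + \<bar>sinh (tt N)\<bar>) / \<bar>sinh (tt N)\<bar> = 1 / \<bar>sinh (tt N)\<bar> + 1"
    using False by (simp add: add_divide_distrib tt_simps)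
  ultimately show ?thesis by linarith
qed (simp add: tt_simps)

lemma rapid_sD1: "rapid sD1" and rapid_sB1: "rapid sB1" and rapid_sZ1: "rapid sZ1"
  and rapid_sD2: "rapid sD2" and rapid_sZ2: "rapid sZ2"
proof -
  have c: "\<bar>cosh (tt N) / sinh (tt N) ^ 2\<bar> \<le> 20 * exp (- \<bar>of_int N\<bar>)" for N
  proof -
    have "\<bar>cosh (tt N) / sinh (tt N) ^ 2\<bar> = \<bar>coth (tt N)\<bar> * (1 / \<bar>sinh (tt N)\<bar>)"
      by (simp add: coth_def abs_divide abs_mult power2_eq_square)
    also have "\<dots> \<le> 5 * (4 * exp (- \<bar>of_int N\<bar>))"
      by (intro mult_mono abs_coth_tt_le csch_tt_bound) auto
    finally show ?thesis by simp
  qed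
  have d: "\<bar>sinh (tt N) / cosh (tt N) ^ 2\<bar> \<le> 2 * exp (- \<bar>of_int N\<bar>)" for N
  proof -
    have "\<bar>sinh (tt N) / cosh (tt N) ^ 2\<bar> = \<bar>tanh (tt N)\<bar> * (1 / \<bar>cosh (tt N)\<bar>)"
      by (simp add: tanh_def abs_divide abs_mult power2_eq_square)
    also have "\<dots> \<le> 1 * (2 * exp (- \<bar>of_int N\<bar>))"
      using sech_tt_bound[of N] tanh_real_bounds[of "tt N"] by (intro mult_mono) auto
    finally show ?thesis by simp
  qed
  have c3: "\<bar>1 / sinh (tt N) ^ 3\<bar> \<le> 64 * exp (- \<bar>of_int N\<bar>)" for N
  proof -
    have le: "1 / \<bar>sinh (tt N)\<bar> \<le> 4"
      using order_trans[OF csch_tt_bound, of N 4] by simp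
    have "\<bar>1 / sinh (tt N) ^ 3\<bar> = 1 / \<bar>sinh (tt N)\<bar> * (1 / \<bar>sinh (tt N)\<bar> * (1 / \<bar>sinh (tt N)\<bar>))"
      by (simp add: abs_divide abs_mult power3_eq_cube)
    also have "\<dots> \<le> 4 * (4 * (4 * exp (- \<bar>of_int N\<bar>)))"
      by (intro mult_mono le csch_tt_bound) auto
    finally show ?thesis by simp
  qed
  have d3: "\<bar>1 / cosh (tt N) ^ 3\<bar> \<le> 2 * exp (- \<bar>of_int N\<bar>)" for N
  proof -
    have "\<bar>1 / cosh (tt N) ^ 3\<bar> \<le> 1 / cosh (tt N)"
      using cosh_tt_ge_1[of N] by (simp add: field_simps power3_eq_cube mult_ge1_I)
    then show ?thesis using sech_tt_bound[of N] by linarith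
  qed
  show "rapid sD1" by (rule rapidI[of _ 2]) (use d in \<open>simp add: sD1_def\<close>)
  show "rapid sB1" by (rule rapidI[of _ 20]) (use c in \<open>simp add: sB1_def\<close>)
  show "rapid sZ1" by (rule rapidI[of _ 20]) (use c in \<open>simp add: sZ1_def\<close>)
  show "rapid sD2"
  proof (rule rapidI)
    show "\<bar>sD2 N\<bar> \<le> 6 * exp (- \<bar>of_int N\<bar>)" for N
    proof -
      have "\<bar>1 / cosh (tt N)\<bar> \<le> 2 * exp (- \<bar>of_int N\<bar>)" using sech_tt_bound[of N] by simp
      then have "\<bar>1 / cosh (tt N) - 2 * (1 / cosh (tt N) ^ 3)\<bar> \<le> 6 * exp (- \<bar>of_int N\<bar>)"
        using d3[of N] unfolding abs_le_iff by linarith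
      then show ?thesis by (simp add: sD2_def)
    qed
  qed
  show "rapid sZ2"
  proof (rule rapidI)
    show "\<bar>sZ2 N\<bar> \<le> 132 * exp (- \<bar>of_int N\<bar>)" for N
    proof -
      have "\<bar>1 / sinh (tt N)\<bar> \<le> 4 * exp (- \<bar>of_int N\<bar>)" using csch_tt_bound[of N] by simp
      then have "\<bar>1 / sinh (tt N) + 2 * (1 / sinh (tt N) ^ 3)\<bar> \<le> 132 * exp (- \<bar>of_int N\<bar>)"
        using c3[of N] unfolding abs_le_iff by linarith
      then show ?thesis by (simp add: sZ2_def)
    qed
  qed
qed

text \<open>In a convolution \<open>a + b = tt N\<close> is fixed. The product then becomes a
  constant times a function of \<open>a\<close> plus a function of \<open>b\<close>, which is what
  the preceding sums evaluate. The next two lemmas have the same purpose.\<close>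

lemma sech_sech:
  fixes a b :: real assumes "a + b \<noteq> 0"
  shows "1 / cosh a * (1 / cosh b) = (tanh a + tanh b) / sinh (a + b)"
proof -
  have "tanh a + tanh b = sinh (a + b) * (1 / cosh a * (1 / cosh b))"
    using cosh_real_nonzero[of a] cosh_real_nonzero[of b]
    by (simp add: tanh_def sinh_add field_simps)
  then show ?thesis using assms by simp
qed

lemma csch_sech:
  fixes a b :: real assumes "a \<noteq> 0"
  shows "1 / sinh a * (1 / cosh b) = (coth a + tanh b) / cosh (a + b)"
proof -
  have "coth a + tanh b = cosh (a + b) * (1 / sinh a * (1 / cosh b))"
    using assms cosh_real_nonzero[of b] by (simp add: coth_def tanh_def cosh_add field_simps)
  then show ?thesis using cosh_real_nonzero[of "a + b"] by simp
qed

lemma csch_csch: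
  fixes a b :: real assumes "a \<noteq> 0" "b \<noteq> 0" "a + b \<noteq> 0"
  shows "1 / sinh a * (1 / sinh b) = (coth a + coth b) / sinh (a + b)"
proof -
  have "coth a + coth b = sinh (a + b) * (1 / sinh a * (1 / sinh b))"
    using assms by (simp add: coth_def sinh_add field_simps)
  then show ?thesis using assms by simp
qed

lemma parity_cmult_has_sum:
  fixes c :: real
  assumes "((\<lambda>j. if even j = p then f j else 0) has_sum s) UNIV"
  shows "((\<lambda>j. if even j = p then c * f j else 0) has_sum c * s) UNIV"
  using has_sum_cmult_right[OF assms, of c] by (simp add: if_distrib cong: if_cong)

lemma summable_sq: "rapid a \<Longrightarrow> (\<lambda>j. a j ^ 2) summable_on UNIV"
proof -
  assume a: "rapid a"
  have s: "(\<lambda>j. \<bar>a j\<bar>) summable_on UNIV" using a unfolding rapid_def by (metis (mono_tags, lifting) mult.right_neutral power_0 summable_on_cong)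
  define M where "M = (\<Sum>\<^sub>\<infinity>j. \<bar>a j\<bar>)"
  have le: "\<bar>a j\<bar> \<le> M" for j
    using finite_sum_le_infsum[OF s, of "{j}"] by (simp add: M_def)
  have "(\<lambda>j. norm (a j ^ 2)) summable_on UNIV"
  proof (rule Infinite_Sum.abs_summable_on_comparison_test')
    show "(\<lambda>j. M * \<bar>a j\<bar>) summable_on UNIV" using s by (rule summable_on_cmult_right)
    show "norm (a j ^ 2) \<le> M * \<bar>a j\<bar>" for j
      using mult_right_mono[OF le, of "\<bar>a j\<bar>" j] by (simp add: power2_eq_square abs_mult)
  qed
  then show ?thesis by simp
qed

lemma kA_has_sum: "((\<lambda>j. sA j ^ 2) has_sum kA) UNIV"
  and kD_has_sum: "((\<lambda>j. sD j ^ 2) has_sum kD) UNIV"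
  unfolding kA_def kD_def by (intro has_sum_infsum summable_sq rapid_sA rapid_sD)+

text \<open>At \<open>j = 0\<close> (and \<open>j = N\<close>), where the product of the coefficients is \<open>0\<close> because \<open>1 / 0 = 0\<close>, the summands are
  completed by the value for which the sum telescopes.\<close>

definition sech_sech_term :: "bool \<Rightarrow> int \<Rightarrow> int \<Rightarrow> real" where
  "sech_sech_term p N j = (if even j = p then 1 / cosh (tt j) * (1 / cosh (tt (N - j))) else 0)"

definition csch_sech_term :: "bool \<Rightarrow> int \<Rightarrow> int \<Rightarrow> real" where
  "csch_sech_term p N j = (if even j = p then (if j = 0 then tanh (tt N) / cosh (tt N)
      else 1 / sinh (tt j) * (1 / cosh (tt (N - j)))) else 0)"

definition csch_csch_term :: "int \<Rightarrow> int \<Rightarrow> real" where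
  "csch_csch_term N j = (if even j = True then (if j = 0 \<or> j = N then coth (tt N) / sinh (tt N)
      else 1 / sinh (tt j) * (1 / sinh (tt (N - j)))) else 0)"

lemma sech_sech_has_sum:
  assumes "N \<noteq> 0"
  shows "(sech_sech_term p N has_sum (of_int N / sinh (tt N))) UNIV"
proof -
  have eq: "1 / cosh (tt j) * (1 / cosh (tt (N - j))) =
      1 / sinh (tt N) * (tanh (tt j) + tanh (tt (N - j)))" for j
    using sech_sech[of "tt j" "tt (N - j)"] assms by (simp add: tt_split tt_simps)
  show ?thesis unfolding sech_sech_term_def[abs_def] eq
    using parity_cmult_has_sum[OF tanh_tanh_has_sum, of p "1 / sinh (tt N)" N] by simp
qed

text \<open>At \<open>N = 0\<close> the addition theorem would divide by \<open>sinh 0\<close>;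
  there the sum is the sum of squares \<open>kD\<close>, and \<open>of_int N * sZ N\<close>
  contributes 0. For odd \<open>N\<close> the supports do not meet.\<close>

lemma sDsD: "((\<lambda>j. sD j * sD (N - j)) has_sum (of_int N * sZ N + kD * delta0 N)) UNIV"
proof (cases "N = 0")
  case True
  have "sD j * sD (0 - j) = sD j ^ 2" for j by (simp add: sD_def tt_simps power2_eq_square)
  then show ?thesis using kD_has_sum True by (simp add: delta0_def)
next
  case False
  show ?thesis
  proof (cases "even N")
    case True
    then have "sD j * sD (N - j) =
       sech_sech_term True N j" for j
      by (simp add: sech_sech_term_def sD_def)
    then show ?thesis
      using sech_sech_has_sum[OF False, of True] True False by (simp add: sZ_def delta0_def)
  next
    case odd: False
    then have eq: "sD j * sD (N - j) = 0" for j by (simp add: sD_def)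
    show ?thesis unfolding eq using odd False by (simp add: sZ_def delta0_def)
  qed
qed

lemma sAsA: "((\<lambda>j. sA j * sA (N - j)) has_sum (of_int N * sZ N + kA * delta0 N)) UNIV"
proof (cases "N = 0")
  case True
  have "sA j * sA (0 - j) = sA j ^ 2" for j by (simp add: sA_def tt_simps power2_eq_square)
  then show ?thesis using kA_has_sum True by (simp add: delta0_def)
next
  case False
  show ?thesis
  proof (cases "even N")
    case True
    then have "sA j * sA (N - j) =
       sech_sech_term False N j" for j
      by (simp add: sech_sech_term_def sA_def)
    then show ?thesis
      using sech_sech_has_sum[OF False, of False] True False by (simp add: sZ_def delta0_def)
  next
    case odd: False
    then have eq: "sA j * sA (N - j) = 0" for j by (simp add: sA_def)
    show ?thesis unfolding eq using odd False by (simp add: sZ_def delta0_def)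
  qed
qed

lemma sAsD: "((\<lambda>j. sA j * sD (N - j)) has_sum of_int N * sB N) UNIV"
proof (cases "even N")
  case True
  then have eq: "sA j * sD (N - j) = 0" for j by (simp add: sA_def sD_def)
  show ?thesis unfolding eq using True by (simp add: sB_def)
next
  case False
  then have "sA j * sD (N - j) =
       sech_sech_term False N j" for j
    by (simp add: sech_sech_term_def sA_def sD_def)
  then show ?thesis
    using sech_sech_has_sum[of N False] False by (cases "N = 0") (simp_all add: sB_def)
qed

lemma csch_sech_has_sum:
  shows "(csch_sech_term p N has_sum (of_int N / cosh (tt N))) UNIV"
proof -
  have eq: "(if j = 0 then tanh (tt N) / cosh (tt N) else 1 / sinh (tt j) * (1 / cosh (tt (N - j)))) =
      1 / cosh (tt N) * (coth (tt j) + tanh (tt (N - j)))" for j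
    using csch_sech[of "tt j" "tt (N - j)"] by (simp add: tt_split tt_simps)
  show ?thesis unfolding csch_sech_term_def[abs_def] eq
    using parity_cmult_has_sum[OF coth_tanh_has_sum, of p "1 / cosh (tt N)" N] by simp
qed

lemma sBsA: "((\<lambda>j. sB j * sA (N - j)) has_sum of_int N * sD N) UNIV"
proof (cases "even N")
  case False
  then have eq: "sB j * sA (N - j) = 0" for j by (simp add: sA_def sB_def)
  show ?thesis unfolding eq using False by (simp add: sD_def)
next
  case True
  then have "sB j * sA (N - j) = csch_sech_term False N j" for j
    by (auto simp: sech_sech_term_def csch_sech_term_def sA_def sB_def)
  then show ?thesis
    using csch_sech_has_sum[of False N] True by (simp add: sD_def)
qed

lemma sBsD: "((\<lambda>j. sB j * sD (N - j)) has_sum of_int N * sA N) UNIV"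
proof (cases "even N")
  case True
  then have eq: "sB j * sD (N - j) = 0" for j by (simp add: sD_def sB_def)
  show ?thesis unfolding eq using True by (simp add: sA_def)
next
  case False
  then have "sB j * sD (N - j) = csch_sech_term False N j" for j
    by (auto simp: csch_sech_term_def sD_def sB_def)
  then show ?thesis
    using csch_sech_has_sum[of False N] False by (simp add: sA_def)
qed

text \<open>The telescoping sum includes a completed summand at \<open>j = 0\<close>, whereas
  \<open>sZ 0 = 0\<close>. Subtracting this one summand is what produces the derivative sequence
  \<open>sD1\<close>.\<close>

lemma sZsD: "((\<lambda>j. sZ j * sD (N - j)) has_sum (of_int N * sD N - sD1 N)) UNIV"
proof (cases "even N")
  case False
  then have eq: "sZ j * sD (N - j) = 0" for j by (simp add: sD_def sZ_def)
  show ?thesis unfolding eq using False by (simp add: sD_def sD1_def)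
next
  case True
  have eq: "sZ j * sD (N - j) = csch_sech_term True N j +
      (if j = 0 then - (tanh (tt N) / cosh (tt N)) else 0)" for j
    using True by (simp add: csch_sech_term_def sD_def sZ_def tt_simps)
  show ?thesis unfolding eq
    using has_sum_add[OF csch_sech_has_sum[of True N] has_sum_single[of 0 "- (tanh (tt N) / cosh (tt N))"]] True
    by (simp add: sD_def sD1_def tanh_def power2_eq_square)
qed

lemma csch_csch_has_sum:
  assumes "N \<noteq> 0"
  shows "(csch_csch_term N has_sum (of_int N / sinh (tt N))) UNIV"
proof -
  have eq: "(if j = 0 \<or> j = N then coth (tt N) / sinh (tt N) else 1 / sinh (tt j) * (1 / sinh (tt (N - j)))) =
      1 / sinh (tt N) * (coth (tt j) + coth (tt (N - j)))" for j
    using csch_csch[of "tt j" "tt (N - j)"] assms by (auto simp: tt_split tt_simps)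
  show ?thesis unfolding csch_csch_term_def[abs_def] eq
    using parity_cmult_has_sum[OF coth_coth_has_sum, of True "1 / sinh (tt N)" N] by simp
qed

lemma sZsB: "((\<lambda>j. sZ j * sB (N - j)) has_sum (of_int N * sB N - sB1 N)) UNIV"
proof (cases "even N")
  case True
  then have eq: "sZ j * sB (N - j) = 0" for j by (simp add: sB_def sZ_def)
  show ?thesis unfolding eq using True by (simp add: sB_def sB1_def)
next
  case False
  then have N: "N \<noteq> 0" by auto
  have eq: "sZ j * sB (N - j) = csch_csch_term N j +
      (if j = 0 then - (coth (tt N) / sinh (tt N)) else 0)" for j
    using False by (auto simp: csch_csch_term_def sB_def sZ_def tt_simps)
  show ?thesis unfolding eq
    using has_sum_add[OF csch_csch_has_sum[OF N]
        has_sum_single[of 0 "- (coth (tt N) / sinh (tt N))"]] False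
    by (simp add: sB_def sB1_def coth_def power2_eq_square)
qed

text \<open>Now two completed summands have to be removed, at \<open>j = 0\<close> and at
  \<open>j = N\<close>, hence the factor 2. The sum of squares has a minus sign because
  \<open>sZ\<close> is odd.\<close>

lemma sZsZ: "((\<lambda>j. sZ j * sZ (N - j)) has_sum
    (of_int N * sZ N - 2 * sZ1 N - (\<Sum>\<^sub>\<infinity>j. sZ j ^ 2) * delta0 N)) UNIV"
proof (cases "N = 0")
  case True
  have eq: "sZ j * sZ (0 - j) = - (sZ j ^ 2)" for j by (simp add: sZ_def tt_simps power2_eq_square)
  show ?thesis unfolding True eq
    using has_sum_uminusI[OF has_sum_infsum[OF summable_sq[OF rapid_sZ]]]
    by (simp add: delta0_def sZ1_def tt_simps)
next
  case N: False
  show ?thesis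
  proof (cases "even N")
    case False
    then have eq: "sZ j * sZ (N - j) = 0" for j by (simp add: sZ_def)
    show ?thesis unfolding eq using False N by (simp add: sZ_def sZ1_def delta0_def)
  next
    case True
    have eq: "sZ j * sZ (N - j) = csch_csch_term N j +
        (if j = 0 then - (coth (tt N) / sinh (tt N)) else 0) +
        (if j = N then - (coth (tt N) / sinh (tt N)) else 0)" for j
      using True N by (auto simp: csch_csch_term_def sZ_def tt_simps)
    show ?thesis unfolding eq
      using has_sum_add[OF has_sum_add[OF csch_csch_has_sum[OF N]
          has_sum_single[of 0 "- (coth (tt N) / sinh (tt N))"]]
          has_sum_single[of N "- (coth (tt N) / sinh (tt N))"]] True N
      by (simp add: sZ_def sZ1_def coth_def power2_eq_square delta0_def)
  qed
qed

lemma sD_shift_has_sum: "((\<lambda>j. sD (N - j) ^ 2) has_sum kD) UNIV"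
  using kD_has_sum
  by (subst has_sum_reindex_bij_witness[where i="\<lambda>j. N - j" and j="\<lambda>j. N - j"
        and T=UNIV and h="\<lambda>j. sD j ^ 2" and s'=kD]) auto

text \<open>Up to sign, the derivative of \<open>csch_sech\<close> with respect to
  \<open>b\<close>.\<close>

lemma csch_sech':
  fixes a b :: real assumes "a \<noteq> 0"
  shows "1 / sinh a * (sinh b / cosh b ^ 2) =
    sinh (a + b) / cosh (a + b) ^ 2 * (coth a + tanh b) - 1 / cosh (a + b) * (1 / cosh b) ^ 2"
proof -
  have nz: "cosh (a + b) \<noteq> 0" "cosh b \<noteq> 0" by simp_all
  have "cosh (a + b) * (1 / sinh a * (sinh b / cosh b ^ 2)) =
     sinh (a + b) * (1 / sinh a * (1 / cosh b)) - (1 / cosh b) ^ 2"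
  proof -
    have "cosh (a + b) * sinh b = sinh (a + b) * cosh b - sinh a"
      using sinh_diff[of "a + b" b] by simp
    then show ?thesis using assms nz by (simp add: field_simps power2_eq_square)
  qed
  also have "\<dots> = sinh (a + b) * ((coth a + tanh b) / cosh (a + b)) - (1 / cosh b) ^ 2"
    by (simp only: csch_sech[OF assms])
  finally have "1 / sinh a * (sinh b / cosh b ^ 2) =
      (sinh (a + b) * ((coth a + tanh b) / cosh (a + b)) - (1 / cosh b) ^ 2) / cosh (a + b)"
    using nz(1) by (metis nonzero_mult_div_cancel_left)
  then show ?thesis by (simp add: diff_divide_distrib power2_eq_square)
qed

lemma sZsD1: "((\<lambda>j. sZ j * sD1 (N - j)) has_sum (of_int N * sD1 N - sD2 N - kD * sD N)) UNIV"
proof (cases "even N")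
  case False
  then have eq: "sZ j * sD1 (N - j) = 0" for j by (simp add: sD1_def sZ_def)
  show ?thesis unfolding eq using False by (simp add: sD_def sD1_def sD2_def)
next
  case True
  \<comment> \<open>The general formula assigns a value also to \<open>j = 0\<close> (with
    \<open>coth 0 = 0\<close>), but \<open>sZ 0 = 0\<close>. The correction \<open>w\<close> cancels
    that value, and it turns out to be \<open>- sD2 N\<close>.\<close>
  define w where "w = - (sinh (tt N) / cosh (tt N) ^ 2 * tanh (tt N)) + 1 / cosh (tt N) * sD N ^ 2"
  have eq: "sZ j * sD1 (N - j) =
      sinh (tt N) / cosh (tt N) ^ 2 * (if even j = True then coth (tt j) + tanh (tt (N - j)) else 0) +
      (- 1 / cosh (tt N)) * sD (N - j) ^ 2 + (if j = 0 then w else 0)" for j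
  proof (cases "j = 0")
    case True
    then show ?thesis by (simp add: sZ_def tt_simps w_def)
  next
    case False
    have "tt j \<noteq> 0" using False by (simp add: tt_simps)
    from csch_sech'[OF this, of "tt (N - j)"] False True
    show ?thesis by (simp add: sZ_def sD1_def sD_def tt_split)
  qed
  have "w = - (1 / cosh (tt N) - 2 / cosh (tt N) ^ 3)"
    using True cosh_real_nonzero[of "tt N"] unfolding w_def
    by (simp add: sD_def tanh_def field_simps sinh_square_eq power2_eq_square power3_eq_cube)
       (simp add: sinh_square_eq[unfolded power2_eq_square] algebra_simps)
  then have val: "of_int N * sD1 N - sD2 N - kD * sD N =
      sinh (tt N) / cosh (tt N) ^ 2 * of_int N + (- 1 / cosh (tt N)) * kD + w"
    using True by (simp add: sD_def sD1_def sD2_def)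
  show ?thesis unfolding eq val
    by (intro has_sum_add has_sum_cmult_right coth_tanh_has_sum sD_shift_has_sum has_sum_single)
qed

text \<open>The second derivative of \<open>sech_sech\<close> with respect to
  \<open>b\<close>.\<close>

lemma sech_sech'':
  fixes a b :: real assumes "a + b \<noteq> 0"
  shows "1 / cosh a * (1 / cosh b - 2 / cosh b ^ 3) =
    (2 * cosh (a + b) ^ 2 / sinh (a + b) ^ 3 - 1 / sinh (a + b)) * (tanh a + tanh b)
    - 2 * cosh (a + b) / sinh (a + b) ^ 2 * (1 / cosh b) ^ 2 - 2 / sinh (a + b) * (tanh b / cosh b ^ 2)"
proof -
  define S C s c where "S = sinh (a + b)" and "C = cosh (a + b)" and "s = sinh b" and "c = cosh b"
  have nz: "S \<noteq> 0" "c \<noteq> 0" "cosh a \<noteq> 0" using assms by (simp_all add: S_def c_def)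
  have ca: "cosh a = C * c - S * s" using cosh_diff[of "a + b" b] by (simp add: S_def C_def s_def c_def)
  have C2: "C ^ 2 = 1 + S ^ 2" by (simp add: C_def S_def cosh_square_eq)
  have c2: "c ^ 2 = 1 + s ^ 2" by (simp add: c_def s_def cosh_square_eq)
  define h where "h = cosh a"
  have h: "h = C * c - S * s" "h \<noteq> 0" using ca nz by (auto simp: h_def)
  have t: "tanh a + tanh b = S / (h * c)"
    using sech_sech[OF assms] nz by (simp add: S_def c_def h_def field_simps)
  have "1 / h * (1 / c - 2 / c ^ 3) =
    (2 * C ^ 2 / S ^ 3 - 1 / S) * (S / (h * c)) - 2 * C / S ^ 2 * (1 / c) ^ 2 - 2 / S * (s / c / c ^ 2)"
  proof -
    \<comment> \<open>With \<open>cosh a\<close> written as \<open>cosh ((a + b) - b)\<close>,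
      clearing denominators leaves a polynomial identity modulo
      \<open>cosh^2 = 1 + sinh^2\<close>.\<close>
    have "S ^ 2 * (c ^ 2 - 2) = (2 * C ^ 2 - S ^ 2) * c ^ 2 - 2 * C * c * h - 2 * S * s * h"
      unfolding h(1) using C2 c2 by algebra
    then have "(S ^ 2 * (c ^ 2 - 2)) / (S ^ 2 * h * c ^ 3) =
        ((2 * C ^ 2 - S ^ 2) * c ^ 2 - 2 * C * c * h - 2 * S * s * h) / (S ^ 2 * h * c ^ 3)" by simp
    then show ?thesis using nz h(2)
      by (simp add: diff_divide_distrib right_diff_distrib left_diff_distrib power2_eq_square power3_eq_cube)
  qed
  then show ?thesis unfolding t by (simp add: h_def c_def C_def S_def s_def tanh_def)
qed

lemma summable_mult:
  assumes "rapid a" "rapid b" shows "(\<lambda>j. a j * b j) summable_on UNIV"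
proof -
  have "(\<lambda>j. 1/2 * (1 * a j + 1 * b j) ^ 2 + ((-1/2) * a j ^ 2 + (-1/2) * b j ^ 2)) summable_on UNIV"
    using assms by (intro summable_on_cmult_right summable_on_add summable_sq rapid_lincomb)
  moreover have "1/2 * (1 * a j + 1 * b j) ^ 2 + ((-1/2) * a j ^ 2 + (-1/2) * b j ^ 2) = a j * b j" for j
    by (simp add: power2_sum add_divide_distrib)
  ultimately show ?thesis by simp
qed

lemma sech2_tanh_has_sum: "((\<lambda>j. if even j = True then tanh (tt j) / cosh (tt j) ^ 2 else 0) has_sum 0) UNIV"
proof -
  have "(\<lambda>j. sD j * sD1 j) summable_on UNIV" by (intro summable_mult rapid_sD rapid_sD1)
  then have "((\<lambda>j. if even j = True then sD j * sD1 j else 0) has_sum 0) UNIV"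
    by (rule odd_fun_parity_has_sum) (simp add: sD_def sD1_def tt_simps)
  moreover have "(if even j = True then sD j * sD1 j else 0) =
      (if even j = True then tanh (tt j) / cosh (tt j) ^ 2 else 0)" for j
    by (simp add: sD_def sD1_def tanh_def power2_eq_square)
  ultimately show ?thesis by simp
qed

lemma sech2_tanh_shift_has_sum: "even N \<Longrightarrow>
  ((\<lambda>j. if even j = True then tanh (tt (N - j)) / cosh (tt (N - j)) ^ 2 else 0) has_sum 0) UNIV"
  using sech2_tanh_has_sum
  by (subst has_sum_reindex_bij_witness[where i="\<lambda>j. N - j" and j="\<lambda>j. N - j"
        and T=UNIV and h="\<lambda>j. if even j = True then tanh (tt j) / cosh (tt j) ^ 2 else 0" and s'=0]) auto

text \<open>Gives access to \<open>sZ2\<close>, which comes from the double poles of the integrand.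
  It appears only with a factor \<open>N\<close>, so only the derivative of its generating function
  becomes known; this suffices, since only moments of positive order are needed. The sum of
  \<open>tanh / cosh^2\<close> drops out by oddness, and that of \<open>1 / cosh^2\<close> is
  \<open>kD\<close>.\<close>

lemma sDsD2: "((\<lambda>j. sD j * sD2 (N - j)) has_sum
    (of_int N * sZ2 N - 2 * kD * sZ1 N + (\<Sum>\<^sub>\<infinity>j. sD j * sD2 j) * delta0 N)) UNIV"
proof (cases "N = 0")
  case True
  have eq: "sD j * sD2 (0 - j) = sD j * sD2 j" for j by (simp add: sD2_def tt_simps)
  show ?thesis unfolding True eq
    using has_sum_infsum[OF summable_mult[OF rapid_sD rapid_sD2]] by (simp add: delta0_def sZ1_def tt_simps)
next
  case N: False
  show ?thesis
  proof (cases "even N")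
    case False
    then have eq: "sD j * sD2 (N - j) = 0" for j by (simp add: sD_def sD2_def)
    show ?thesis unfolding eq using False N by (simp add: sZ1_def sZ2_def delta0_def)
  next
    case True
    have eq: "sD j * sD2 (N - j) = (2 * cosh (tt N) ^ 2 / sinh (tt N) ^ 3 - 1 / sinh (tt N)) *
          (if even j = True then tanh (tt j) + tanh (tt (N - j)) else 0) +
        (- 2 * cosh (tt N) / sinh (tt N) ^ 2) * sD (N - j) ^ 2 +
        (- 2 / sinh (tt N)) * (if even j = True then tanh (tt (N - j)) / cosh (tt (N - j)) ^ 2 else 0)" for j
      using sech_sech''[of "tt j" "tt (N - j)"] True N
      by (simp add: sD_def sD2_def tt_split tt_simps)
    have *: "2 * cosh (tt N) ^ 2 / sinh (tt N) ^ 3 - 1 / sinh (tt N) = sZ2 N"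
      using True N by (simp add: sZ2_def cosh_square_eq add_divide_distrib distrib_left)
         (simp add: tt_simps power2_eq_square power3_eq_cube)
    show ?thesis unfolding eq *
      using has_sum_add[OF has_sum_add[OF has_sum_cmult_right[OF tanh_tanh_has_sum[of True N], of "sZ2 N"]
          has_sum_cmult_right[OF sD_shift_has_sum, of "- 2 * cosh (tt N) / sinh (tt N) ^ 2" N]]
          has_sum_cmult_right[OF sech2_tanh_shift_has_sum[OF True], of "- 2 / sinh (tt N)"]] True N
      by (simp add: sZ1_def delta0_def mult_ac)
  qed
qed

lemmas rapid_seqs = rapid_sA rapid_sB rapid_sD rapid_sZ rapid_sB1 rapid_sD1 rapid_sZ1 rapid_sD2 rapid_sZ2
  rapid_delta0

lemma mgf_diff: "rapid a \<Longrightarrow> rapid b \<Longrightarrow> mgf x (\<lambda>N. a N - b N) = mgf x a - mgf x b"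
  using mgf_lincomb[of a b x 1 "-1"] by (simp flip: fps_const_neg)

lemma mgf_add_const: "rapid a \<Longrightarrow> mgf x (\<lambda>N. a N + r * delta0 N) = mgf x a + fps_const (of_real r)"
  using mgf_lincomb[of a delta0 x 1 r] by (simp add: rapid_delta0 mgf_delta0)

text \<open>The first five relations are the differential equations of the Jacobi functions and of
  the zeta function; the others express the derived sequences. Two additive constants stay
  unspecified, because only coefficients of positive degree are extracted later.\<close>

lemma mgf_relations:
  fixes x defines "A \<equiv> mgf x sA" and "B \<equiv> mgf x sB" and "D \<equiv> mgf x sD" and "Z \<equiv> mgf x sZ"
  shows "D * D = fps_deriv Z + fps_const (of_real kD)" "A * A = fps_deriv Z + fps_const (of_real kA)"
    "fps_deriv B = A * D" "fps_deriv D = B * A" "fps_deriv A = B * D"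
    "mgf x sD1 = fps_deriv D - Z * D" "mgf x sB1 = fps_deriv B - Z * B"
    "\<exists>c. mgf x sZ1 = fps_const (1/2) * (fps_deriv Z - Z * Z) + fps_const c" (is ?g1)
    "mgf x sD2 = fps_deriv (mgf x sD1) - fps_const (of_real kD) * D - Z * mgf x sD1" (is ?g2)
    "\<exists>c. fps_deriv (mgf x sZ2) = D * mgf x sD2 + fps_const (2 * of_real kD) * mgf x sZ1 + fps_const c" (is ?g3)
proof -
  note r = rapid_seqs rapid_times_index
  show "D * D = fps_deriv Z + fps_const (of_real kD)"
    unfolding D_def Z_def mgf_conv[OF rapid_sD rapid_sD sDsD, symmetric]
    by (subst mgf_add_const) (simp_all add: r mgf_times_index)
  show "A * A = fps_deriv Z + fps_const (of_real kA)"
    unfolding A_def Z_def mgf_conv[OF rapid_sA rapid_sA sAsA, symmetric]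
    by (subst mgf_add_const) (simp_all add: r mgf_times_index)
  show "fps_deriv B = A * D" "fps_deriv D = B * A" "fps_deriv A = B * D"
    unfolding D_def B_def A_def mgf_conv[OF rapid_sA rapid_sD sAsD, symmetric]
      mgf_conv[OF rapid_sB rapid_sA sBsA, symmetric] mgf_conv[OF rapid_sB rapid_sD sBsD, symmetric]
    by (simp_all add: mgf_times_index)
  have "Z * D = fps_deriv D - mgf x sD1"
    unfolding D_def Z_def mgf_conv[OF rapid_sZ rapid_sD sZsD, symmetric]
    by (subst mgf_diff) (simp_all add: r mgf_times_index)
  then show "mgf x sD1 = fps_deriv D - Z * D" by simp
  have "Z * B = fps_deriv B - mgf x sB1"
    unfolding B_def Z_def mgf_conv[OF rapid_sZ rapid_sB sZsB, symmetric]
    by (subst mgf_diff) (simp_all add: r mgf_times_index)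
  then show "mgf x sB1 = fps_deriv B - Z * B" by simp
  define c where "c = (\<Sum>\<^sub>\<infinity>j. sZ j ^ 2)"
  have "Z * Z = mgf x (\<lambda>N. 1 * (1 * (of_int N * sZ N) + (-2) * sZ1 N) + (- c) * delta0 N)"
    unfolding Z_def mgf_conv[OF rapid_sZ rapid_sZ sZsZ, symmetric] c_def by simp
  also have "\<dots> = fps_deriv Z - fps_const 2 * mgf x sZ1 - fps_const (of_real c)"
    by (subst mgf_lincomb, (intro r rapid_lincomb)+, subst mgf_lincomb, (intro r rapid_lincomb)+)
       (simp add: mgf_times_index mgf_delta0 Z_def flip: fps_const_neg)
  finally have ZZ: "fps_const 2 * mgf x sZ1 = fps_deriv Z - Z * Z - fps_const (of_real c)" by simp
  have "mgf x sZ1 = fps_const (1/2) * (fps_const 2 * mgf x sZ1)"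
    by (simp add: mult.assoc[symmetric])
  also have "\<dots> = fps_const (1/2) * (fps_deriv Z - Z * Z) + fps_const (- of_real c / 2)"
    unfolding ZZ by (simp add: right_diff_distrib flip: fps_const_neg)
  finally show ?g1 by blast
  have "Z * mgf x sD1 = mgf x (\<lambda>N. 1 * (1 * (of_int N * sD1 N) + (-1) * sD2 N) + (- kD) * sD N)"
    unfolding Z_def mgf_conv[OF rapid_sZ rapid_sD1 sZsD1, symmetric] by simp
  also have "\<dots> = fps_deriv (mgf x sD1) - mgf x sD2 - fps_const (of_real kD) * D"
    by (subst mgf_lincomb, (intro r rapid_lincomb)+, subst mgf_lincomb, (intro r rapid_lincomb)+)
       (simp add: mgf_times_index D_def flip: fps_const_neg)
  finally show ?g2
    by simp
  define d where "d = (\<Sum>\<^sub>\<infinity>j. sD j * sD2 j)"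
  have "D * mgf x sD2 = mgf x (\<lambda>N. 1 * (1 * (of_int N * sZ2 N) + (-2 * kD) * sZ1 N) + d * delta0 N)"
    unfolding D_def mgf_conv[OF rapid_sD rapid_sD2 sDsD2, symmetric] d_def by simp
  also have "\<dots> = fps_deriv (mgf x sZ2) - fps_const (2 * of_real kD) * mgf x sZ1 + fps_const (of_real d)"
    by (subst mgf_lincomb, (intro r rapid_lincomb)+, subst mgf_lincomb, (intro r rapid_lincomb)+)
       (simp add: mgf_times_index mgf_delta0 flip: fps_const_neg)
  finally have "fps_deriv (mgf x sZ2) = D * mgf x sD2 + fps_const (2 * of_real kD) * mgf x sZ1 + fps_const (- of_real d)"
    by (simp flip: fps_const_neg)
  then show ?g3
    by blast
qed

section \<open>The Jacobi functions on the real line\<close>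

definition cos_series :: "(int \<Rightarrow> real) \<Rightarrow> real \<Rightarrow> real" where
  "cos_series a x = (\<Sum>\<^sub>\<infinity>N. a N * cos (of_int N * x))"

definition sin_series :: "(int \<Rightarrow> real) \<Rightarrow> real \<Rightarrow> real" where
  "sin_series a x = (\<Sum>\<^sub>\<infinity>N. a N * sin (of_int N * x))"

lemma rapid_imp_summable_abs: "rapid a \<Longrightarrow> (\<lambda>N. \<bar>a N\<bar>) summable_on UNIV"
  unfolding rapid_def by (drule spec[of _ 0]) simp

lemma rapid_times_bounded_summable:
  assumes "rapid a" "\<And>N. \<bar>u N\<bar> \<le> 1" shows "(\<lambda>N. a N * u N) summable_on UNIV"
proof -
  have "(\<lambda>N. norm (a N * u N)) summable_on UNIV"
    by (rule Infinite_Sum.abs_summable_on_comparison_test'[OF rapid_imp_summable_abs[OF assms(1)]])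
       (use assms(2) in \<open>simp add: abs_mult mult_left_le\<close>)
  then show ?thesis by (rule Infinite_Sum.abs_summable_summable)
qed

lemma cos_series_has_sum: "rapid a \<Longrightarrow> ((\<lambda>N. a N * cos (of_int N * x)) has_sum cos_series a x) UNIV"
  unfolding cos_series_def by (intro has_sum_infsum rapid_times_bounded_summable) auto

lemma sin_series_has_sum: "rapid a \<Longrightarrow> ((\<lambda>N. a N * sin (of_int N * x)) has_sum sin_series a x) UNIV"
  unfolding sin_series_def by (intro has_sum_infsum rapid_times_bounded_summable) auto

lemma moment_0_eq:
  assumes "rapid a" shows "moment x a 0 = Complex (cos_series a x) (sin_series a x)"
proof -
  have "((\<lambda>N. of_real (a N * cos (of_int N * x)) + \<i> * of_real (a N * sin (of_int N * x))) has_sum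
     (of_real (cos_series a x) + \<i> * of_real (sin_series a x))) UNIV"
    by (intro has_sum_add has_sum_cmult_right has_sum_of_real cos_series_has_sum sin_series_has_sum assms)
  also have "(\<lambda>N. of_real (a N * cos (of_int N * x)) + \<i> * of_real (a N * sin (of_int N * x))) = mterm x a 0"
    by (auto simp: mterm_def cis_conv_exp fun_eq_iff complex_eq_iff exp_of_real Re_exp Im_exp)
  finally have "moment x a 0 = of_real (cos_series a x) + \<i> * of_real (sin_series a x)"
    unfolding moment_def by (rule infsumI)
  then show ?thesis by (simp add: complex_eq_iff)
qed

lemma has_sum_int_imp_sums:
  "(f has_sum s) (UNIV :: int set) \<Longrightarrow> (\<lambda>n. f (int_decode n)) sums s"
  by (rule has_sum_imp_sums) (subst has_sum_reindex_bij_betw[OF bij_int_decode])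

lemma rapid_summable_int_decode: "rapid a \<Longrightarrow> summable (\<lambda>n. \<bar>a (int_decode n)\<bar>)"
  using has_sum_int_imp_sums[OF has_sum_infsum[OF rapid_imp_summable_abs]] sums_summable by blast

text \<open>Enumerating the integers by \<open>int_decode\<close> turns the sum into an ordinary
  series. Multiplication by the index keeps a sequence rapid, which supplies the majorant for
  differentiating term by term.\<close>

lemma cos_series_deriv:
  assumes "rapid a"
  shows "(cos_series a has_real_derivative - sin_series (\<lambda>N. of_int N * a N) x) (at x)"
proof -
  let ?a = "\<lambda>n. a (int_decode n)" and ?N = "\<lambda>n. real_of_int (int_decode n)"
  have eq: "cos_series a = (\<lambda>x. \<Sum>n. ?a n * cos (?N n * x))"
    using sums_unique[OF has_sum_int_imp_sums[OF cos_series_has_sum[OF assms]]] by (simp add: fun_eq_iff)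
  note r = rapid_times_index[OF assms]
  have eq': "- sin_series (\<lambda>N. of_int N * a N) x = (\<Sum>n. - (?N n * ?a n * sin (?N n * x)))"
    using sums_minus[OF has_sum_int_imp_sums[OF sin_series_has_sum[OF r, of x]]] sums_unique by blast
  show ?thesis unfolding eq eq'
  proof (rule has_field_derivative_series'(2)[where S=UNIV and ?x0.0 = 0])
    show "((\<lambda>x. ?a n * cos (?N n * x)) has_field_derivative - (?N n * ?a n * sin (?N n * x))) (at x within UNIV)" for n x
      by (auto intro!: derivative_eq_intros)
    show "uniformly_convergent_on UNIV (\<lambda>n x. \<Sum>i<n. - (?N i * ?a i * sin (?N i * x)))"
      by (rule Weierstrass_m_test'[OF _ rapid_summable_int_decode[OF r]]) (simp add: abs_mult mult_left_le)
    show "summable (\<lambda>n. ?a n * cos (?N n * 0))"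
      using rapid_summable_int_decode[OF assms] by (auto intro: summable_rabs_cancel)
  qed auto
qed

lemma sin_series_deriv:
  assumes "rapid a"
  shows "(sin_series a has_real_derivative cos_series (\<lambda>N. of_int N * a N) x) (at x)"
proof -
  let ?a = "\<lambda>n. a (int_decode n)" and ?N = "\<lambda>n. real_of_int (int_decode n)"
  have eq: "sin_series a = (\<lambda>x. \<Sum>n. ?a n * sin (?N n * x))"
    using sums_unique[OF has_sum_int_imp_sums[OF sin_series_has_sum[OF assms]]] by (simp add: fun_eq_iff)
  note r = rapid_times_index[OF assms]
  have eq': "cos_series (\<lambda>N. of_int N * a N) x = (\<Sum>n. ?N n * ?a n * cos (?N n * x))"
    using has_sum_int_imp_sums[OF cos_series_has_sum[OF r, of x]] sums_unique by blast
  show ?thesis unfolding eq eq'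
  proof (rule has_field_derivative_series'(2)[where S=UNIV and ?x0.0 = 0])
    show "((\<lambda>x. ?a n * sin (?N n * x)) has_field_derivative (?N n * ?a n * cos (?N n * x))) (at x within UNIV)" for n x
      by (auto intro!: derivative_eq_intros)
    show "uniformly_convergent_on UNIV (\<lambda>n x. \<Sum>i<n. (?N i * ?a i * cos (?N i * x)))"
      by (rule Weierstrass_m_test'[OF _ rapid_summable_int_decode[OF r]]) (simp add: abs_mult mult_left_le)
  qed auto
qed

lemma odd_int_sum_zero:
  fixes f :: "int \<Rightarrow> real"
  assumes "\<And>N. f (- N) = - f N" shows "(\<Sum>\<^sub>\<infinity>N. f N) = 0"
proof -
  have "(\<Sum>\<^sub>\<infinity>N. f N) = (\<Sum>\<^sub>\<infinity>N. - f N)"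
    by (rule infsum_reindex_bij_witness[where i=uminus and j=uminus]) (auto simp: assms)
  then show ?thesis by (simp add: infsum_uminus)
qed

lemma sin_series_even: "(\<And>N. a (- N) = a N) \<Longrightarrow> sin_series a x = 0"
  unfolding sin_series_def by (rule odd_int_sum_zero) simp

lemma cos_series_odd: "(\<And>N. a (- N) = - a N) \<Longrightarrow> cos_series a x = 0"
  unfolding cos_series_def by (rule odd_int_sum_zero) simp

definition "fa = cos_series sA"
definition "fb = sin_series sB"
definition "fd = cos_series sD"
definition "fz = sin_series sZ"

lemma moments_0:
  "moment x sA 0 = of_real (fa x)" "moment x sB 0 = \<i> * of_real (fb x)"
  "moment x sD 0 = of_real (fd x)" "moment x sZ 0 = \<i> * of_real (fz x)"
  by (simp_all add: moment_0_eq rapid_seqs complex_eq_iff fa_def fb_def fd_def fz_def sin_series_even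
      cos_series_odd sA_def sB_def sD_def sZ_def tt_simps)

lemma cos_series_add: "rapid a \<Longrightarrow> rapid b \<Longrightarrow> cos_series (\<lambda>N. a N + b N) x = cos_series a x + cos_series b x"
  using has_sum_add[OF cos_series_has_sum[of a x] cos_series_has_sum[of b x]]
  by (simp add: cos_series_def infsumI distrib_right)

lemma mgf_nth_0: "fps_nth (mgf x a) 0 = moment x a 0" and mgf_nth_1: "fps_nth (fps_deriv (mgf x a)) 0 = moment x (\<lambda>N. of_int N * a N) 0"
  by (simp_all add: mgf_def moment_times_index)

text \<open>The formal relations hold at every base point \<open>x\<close>, so their constant
  coefficients are identities between functions of \<open>x\<close>. The factors \<open>\<i>\<close>
  in the moments of the odd sequences \<open>sB\<close> and \<open>sZ\<close> account for the
  signs.\<close>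

lemma Jacobi_derivs:
  "(fa has_real_derivative - (fb x * fd x)) (at x)" (is ?g1)
  "(fb has_real_derivative fa x * fd x) (at x)"
  "(fd has_real_derivative - (fb x * fa x)) (at x)" (is ?g2)
  "(fz has_real_derivative (fa x ^ 2 - kA)) (at x)" (is ?g3)
  and fd_sq: "fd x ^ 2 = fa x ^ 2 + (kD - kA)"
proof -
  note M = mgf_relations[of x]
  note r = rapid_seqs[THEN rapid_times_index]
  have "moment x (\<lambda>N. of_int N * sA N) 0 = moment x sB 0 * moment x sD 0"
    using arg_cong[OF M(5), of "\<lambda>F. fps_nth F 0"] by (simp add: mgf_nth_0 mgf_nth_1 del: fps_deriv_nth)
  then have "sin_series (\<lambda>N. of_int N * sA N) x = fb x * fd x"
    by (simp add: moments_0 moment_0_eq r complex_eq_iff)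
  with cos_series_deriv[OF rapid_sA, of x] show ?g1
    unfolding fa_def by simp
  have "moment x (\<lambda>N. of_int N * sB N) 0 = moment x sA 0 * moment x sD 0"
    using arg_cong[OF M(3), of "\<lambda>F. fps_nth F 0"] by (simp add: mgf_nth_0 mgf_nth_1 del: fps_deriv_nth)
  then have "cos_series (\<lambda>N. of_int N * sB N) x = fa x * fd x"
    by (simp add: moments_0 moment_0_eq r complex_eq_iff)
  with sin_series_deriv[OF rapid_sB, of x] show "(fb has_real_derivative fa x * fd x) (at x)"
    unfolding fb_def by simp
  have "moment x (\<lambda>N. of_int N * sD N) 0 = moment x sB 0 * moment x sA 0"
    using arg_cong[OF M(4), of "\<lambda>F. fps_nth F 0"] by (simp add: mgf_nth_0 mgf_nth_1 del: fps_deriv_nth)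
  then have "sin_series (\<lambda>N. of_int N * sD N) x = fb x * fa x"
    by (simp add: moments_0 moment_0_eq r complex_eq_iff)
  with cos_series_deriv[OF rapid_sD, of x] show ?g2
    unfolding fd_def by simp
  have AA: "moment x sA 0 * moment x sA 0 = moment x (\<lambda>N. of_int N * sZ N) 0 + of_real kA"
    using arg_cong[OF M(2), of "\<lambda>F. fps_nth F 0"] by (simp add: mgf_nth_0 mgf_nth_1 del: fps_deriv_nth)
  then have "cos_series (\<lambda>N. of_int N * sZ N) x = fa x ^ 2 - kA"
    by (simp add: moments_0 moment_0_eq r complex_eq_iff power2_eq_square)
  with sin_series_deriv[OF rapid_sZ, of x] show ?g3
    unfolding fz_def by simp
  have "moment x sD 0 * moment x sD 0 = moment x (\<lambda>N. of_int N * sZ N) 0 + of_real kD"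
    using arg_cong[OF M(1), of "\<lambda>F. fps_nth F 0"] by (simp add: mgf_nth_0 mgf_nth_1 del: fps_deriv_nth)
  with AA have "moment x sD 0 * moment x sD 0 = moment x sA 0 * moment x sA 0 + of_real (kD - kA)" by simp
  then show "fd x ^ 2 = fa x ^ 2 + (kD - kA)"
    by (simp add: moments_0 complex_eq_iff power2_eq_square)
qed

lemma cos_odd_half_pi:
  assumes "odd N" shows "cos (of_int N * (pi / 2)) = 0"
proof -
  obtain b where "N = 2 * b + 1" using assms by (rule oddE)
  then have eq: "of_int N * (pi / 2) = pi * of_int b + pi / 2" by (simp add: algebra_simps add_divide_distrib)
  show ?thesis unfolding eq by (simp add: cos_add)
qed

lemma sin_even_half_pi: "even N \<Longrightarrow> sin (of_int N * (pi / 2)) = 0"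
  by (auto elim!: evenE simp: mult.commute[of _ pi])

lemma boundary_values: "fa (pi / 2) = 0" "fz (pi / 2) = 0" "fz 0 = 0" "fb 0 = 0"
proof -
  have "(\<Sum>\<^sub>\<infinity>N. sA N * cos (of_int N * (pi / 2))) = (\<Sum>\<^sub>\<infinity>N\<in>(UNIV::int set). 0)"
    by (rule infsum_cong) (use cos_odd_half_pi in \<open>auto simp: sA_def\<close>)
  then show "fa (pi / 2) = 0" by (simp add: fa_def cos_series_def)
  have "(\<Sum>\<^sub>\<infinity>N. sZ N * sin (of_int N * (pi / 2))) = (\<Sum>\<^sub>\<infinity>N\<in>(UNIV::int set). 0)"
    by (rule infsum_cong) (use sin_even_half_pi in \<open>auto simp: sZ_def\<close>)
  then show "fz (pi / 2) = 0" by (simp add: fz_def sin_series_def)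
qed (simp_all add: fz_def fb_def sin_series_def)

text \<open>The scale of the whole problem: \<open>fb (pi / 2)\<close> and \<open>fa 0\<close> will
  turn out to have this same value.\<close>

definition "lam = fd (pi / 2)"

lemma fa_0_pos: "fa 0 > 0"
proof -
  have "sum (\<lambda>N. sA N * cos (of_int N * 0)) {1} \<le> fa 0"
    unfolding fa_def
    by (rule finite_sum_le_has_sum[OF cos_series_has_sum[OF rapid_sA]]) (auto simp: sA_def)
  moreover have "sA 1 > 0" by (simp add: sA_def)
  ultimately show ?thesis by simp
qed

lemma fd_0_pos: "fd 0 > 0"
proof -
  have "sum (\<lambda>N. sD N * cos (of_int N * 0)) {0} \<le> fd 0"
    unfolding fd_def
    by (rule finite_sum_le_has_sum[OF cos_series_has_sum[OF rapid_sD]]) (auto simp: sD_def)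
  moreover have "sD 0 > 0" by (simp add: sD_def)
  ultimately show ?thesis by simp
qed

text \<open>The amplitude: its derivative is \<^term>\<open>fd\<close>, whose mean value is 1.\<close>

definition sT :: "int \<Rightarrow> real" where "sT N = sD N / of_int N"

definition amp :: "real \<Rightarrow> real" where "amp x = x + sin_series sT x"

lemma rapid_sT: "rapid sT"
proof (rule rapidI)
  show "\<bar>sT N\<bar> \<le> 2 * exp (- \<bar>of_int N\<bar>)" for N
  proof -
    have "\<bar>sT N\<bar> \<le> \<bar>sD N\<bar>"
    proof (cases "N = 0")
      case False
      then have "\<bar>real_of_int N\<bar> \<ge> 1" by linarith
      then show ?thesis using mult_right_mono[of 1 "\<bar>real_of_int N\<bar>" "\<bar>sD N\<bar>"]
        by (simp add: sT_def abs_divide divide_le_eq mult.commute)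
    qed (simp add: sT_def)
    also have "\<dots> \<le> 2 * exp (- \<bar>of_int N\<bar>)" using sech_tt_bound[of N] by (simp add: sD_def)
    finally show ?thesis .
  qed
qed

lemma amp_deriv: "(amp has_real_derivative fd x) (at x)"
proof -
  \<comment> \<open>Division by zero makes \<open>sT 0 = 0\<close>, so the mean value
    \<open>sD 0 = 1\<close> has to be restored by \<open>delta0\<close>. It corresponds to the term
    \<open>x\<close> in \<open>amp\<close>.\<close>
  have eq: "sD = (\<lambda>N. of_int N * sT N + delta0 N)"
    by (auto simp: fun_eq_iff sT_def delta0_def sD_def tt_simps)
  have "cos_series delta0 x = (\<Sum>\<^sub>\<infinity>N\<in>{0}. delta0 N * cos (of_int N * x))"
    unfolding cos_series_def by (rule infsum_cong_neutral) (auto simp: delta0_def)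
  then have "fd x = cos_series (\<lambda>N. of_int N * sT N) x + 1"
    unfolding fd_def by (subst eq, subst cos_series_add)
      (auto intro: rapid_times_index rapid_sT rapid_delta0 simp: delta0_def)
  then show ?thesis unfolding amp_def[abs_def]
    by (auto intro!: derivative_eq_intros sin_series_deriv rapid_sT)
qed

lemma amp_0: "amp 0 = 0" by (simp add: amp_def sin_series_def)

lemma amp_half_pi: "amp (pi / 2) = pi / 2"
proof -
  have "(\<Sum>\<^sub>\<infinity>N. sT N * sin (of_int N * (pi / 2))) = (\<Sum>\<^sub>\<infinity>N\<in>(UNIV::int set). 0)"
    by (rule infsum_cong) (use sin_even_half_pi in \<open>auto simp: sT_def sD_def\<close>)
  then show ?thesis by (simp add: amp_def sin_series_def)
qed

lemma Gamma_quarter: "Gamma (1/4 :: real) * Gamma (3/4) = pi * sqrt 2"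
proof -
  have "complex_of_real (Gamma (1/4) * Gamma (3/4)) = Gamma (of_real (1/4)) * Gamma (1 - of_real (1/4))"
    by (simp flip: Gamma_complex_of_real of_real_diff add: Gamma_complex_of_real[of "3/4", symmetric])
  also have "\<dots> = of_real pi / sin (of_real pi * of_real (1/4))"
    by (rule Gamma_reflection_complex)
  also have "\<dots> = of_real (pi / sin (pi / 4))"
    by (simp flip: sin_of_real)
  finally have "Gamma (1/4) * Gamma (3/4) = pi / sin (pi / 4)" by (simp only: of_real_eq_iff)
  also have "\<dots> = pi * (2 / sqrt 2)" by (simp add: sin_45)
  finally show ?thesis by (simp only: real_div_sqrt)
qed

section \<open>The lemniscatic modulus\<close>

lemma cmod_sin_sq: "cmod (sin z) ^ 2 = sin (Re z) ^ 2 + sinh (Im z) ^ 2" (is ?g1)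
  and cmod_cos_sq: "cmod (cos z) ^ 2 = cos (Re z) ^ 2 + sinh (Im z) ^ 2" (is ?g2)
proof -
  have c: "cosh (Im z) ^ 2 = sinh (Im z) ^ 2 + 1" by (rule cosh_square_eq)
  have "Re (sin z) = sin (Re z) * cosh (Im z)" "Im (sin z) = cos (Re z) * sinh (Im z)"
    by (simp_all add: Re_sin Im_sin cosh_field_def sinh_field_def)
  then have "cmod (sin z) ^ 2 = sin (Re z) ^ 2 * cosh (Im z) ^ 2 + cos (Re z) ^ 2 * sinh (Im z) ^ 2"
    by (simp add: cmod_power2 power_mult_distrib)
  then show ?g1
    unfolding c by (simp add: cos_squared_eq algebra_simps)
  have "Re (cos z) = cos (Re z) * cosh (Im z)" "Im (cos z) = - (sin (Re z) * sinh (Im z))"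
    by (simp_all add: Re_cos Im_cos cosh_field_def sinh_field_def field_simps)
  then have "cmod (cos z) ^ 2 = cos (Re z) ^ 2 * cosh (Im z) ^ 2 + sin (Re z) ^ 2 * sinh (Im z) ^ 2"
    by (simp add: cmod_power2 power_mult_distrib)
  then show ?g2
    unfolding c by (simp add: sin_squared_eq algebra_simps)
qed

lemma cmod_cosh_sq: "cmod (cosh z) ^ 2 = cos (Im z) ^ 2 + sinh (Re z) ^ 2"
  using cmod_cos_sq[of "\<i> * z"] by (simp add: cosh_conv_cos)

lemma cmod_sinh_sq: "cmod (sinh z) ^ 2 = sin (Im z) ^ 2 + sinh (Re z) ^ 2"
  using cmod_sin_sq[of "\<i> * z"] by (simp add: sinh_conv_sin norm_mult)

lemma rectpath_integral_bound:
  assumes f: "continuous_on (path_image (rectpath a b)) f"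
    and B: "B \<ge> 0" "\<And>z. z \<in> path_image (rectpath a b) \<Longrightarrow> cmod (f z) \<le> B"
    and "Re a \<le> Re b" "Im a \<le> Im b"
  shows "cmod (contour_integral (rectpath a b) f) \<le> B * (2 * (Re b - Re a) + 2 * (Im b - Im a))"
proof -
  define a2 a4 where "a2 = Complex (Re b) (Im a)" and "a4 = Complex (Re a) (Im b)"
  have rp: "rectpath a b = linepath a a2 +++ linepath a2 b +++ linepath b a4 +++ linepath a4 a"
    by (simp add: rectpath_def Let_def a2_def a4_def)
  have im: "path_image (rectpath a b) = closed_segment a a2 \<union> closed_segment a2 b \<union> closed_segment b a4 \<union> closed_segment a4 a"
    unfolding rp by (simp add: path_image_join Un_assoc)
  have int: "f contour_integrable_on linepath u v" if "closed_segment u v \<subseteq> path_image (rectpath a b)" for u v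
    by (rule contour_integrable_continuous_linepath) (rule continuous_on_subset[OF f that])
  have bd: "cmod (contour_integral (linepath u v) f) \<le> B * cmod (v - u)"
    if "closed_segment u v \<subseteq> path_image (rectpath a b)" for u v
    by (rule contour_integral_bound_linepath[OF int[OF that] B(1)]) (use B(2) that in auto)
  have sub: "closed_segment a a2 \<subseteq> path_image (rectpath a b)" "closed_segment a2 b \<subseteq> path_image (rectpath a b)"
    "closed_segment b a4 \<subseteq> path_image (rectpath a b)" "closed_segment a4 a \<subseteq> path_image (rectpath a b)"
    unfolding im by auto
  have "contour_integral (rectpath a b) f = contour_integral (linepath a a2) f + (contour_integral (linepath a2 b) f
      + (contour_integral (linepath b a4) f + contour_integral (linepath a4 a) f))"
    unfolding rp by (simp add: int sub)
  also have "cmod \<dots> \<le> B * cmod (a2 - a) + (B * cmod (b - a2) + (B * cmod (a4 - b) + B * cmod (a - a4)))"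
    by (intro norm_triangle_mono bd sub)
  also have "cmod (a2 - a) = Re b - Re a" using assms(4) by (simp add: cmod_eq_Re a2_def)
  also have "cmod (a4 - b) = Re b - Re a" using assms(4) by (simp add: cmod_eq_Re a4_def)
  also have "cmod (b - a2) = Im b - Im a" using assms(5) by (simp add: cmod_eq_Im a2_def)
  also have "cmod (a - a4) = Im b - Im a" using assms(5) by (simp add: cmod_eq_Im a4_def)
  finally show ?thesis by (simp add: algebra_simps)
qed

lemma holomorphic_on_cosh' [holomorphic_intros]:
  "f holomorphic_on A \<Longrightarrow> (\<lambda>z. cosh (f z)) holomorphic_on A"
  unfolding cosh_conv_cos by (intro holomorphic_intros)

lemma holomorphic_on_sinh' [holomorphic_intros]:
  "f holomorphic_on A \<Longrightarrow> (\<lambda>z. sinh (f z)) holomorphic_on A"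
  unfolding sinh_conv_sin by (intro holomorphic_intros)

definition sq_pole :: "int \<Rightarrow> complex" where
  "sq_pole N = (if even N then of_real (tt N) else \<i> * of_real (tt N))"

lemma sin_even_tt: "even N \<Longrightarrow> sin (tt N) = 0" and cos_odd_tt: "odd N \<Longrightarrow> cos (tt N) = 0"
  unfolding tt_def by (rule sin_even_half_pi cos_odd_half_pi, assumption)+

lemma cosh_of_real': "cosh (complex_of_real t) = of_real (cosh t)"
  and sinh_of_real': "sinh (complex_of_real t) = of_real (sinh t)"
  by (simp_all add: cosh_field_def sinh_field_def exp_of_real[symmetric])

lemma cosh_ii_tt: "cosh (\<i> * of_real t) = complex_of_real (cos t)"
  and sinh_ii_tt: "sinh (\<i> * of_real t) = \<i> * complex_of_real (sin t)"
  and sin_ii_tt: "sin (\<i> * of_real t) = \<i> * complex_of_real (sinh t)"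
  by (simp_all add: cosh_conv_cos sinh_conv_sin cos_of_real sin_of_real[symmetric] mult.assoc[symmetric])
     (simp add: complex_eq_iff Re_sin Im_sin sinh_field_def)

text \<open>The function \<open>1 / (cosh z * sin z)\<close> is chosen because its residues on the
  real axis are the terms of the \<open>fd\<close> series at \<open>pi / 2\<close>, and those on the
  imaginary axis are minus the terms of the \<open>fb\<close> series. The vertical edges run midway
  between zeros of \<open>sin\<close>, the horizontal ones midway between zeros of
  \<open>cosh\<close>; on each edge one factor has modulus at least 1 and the other at least
  \<open>sinh (n * pi)\<close>.\<close>

lemma square_contour:
  fixes n :: nat assumes n: "n \<ge> 1"
  defines "a \<equiv> Complex (- ((n + 1/2) * pi)) (- (n * pi))" and "b \<equiv> Complex ((n + 1/2) * pi) (n * pi)"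
  shows "contour_integral (rectpath a b) (\<lambda>z. 1 / (cosh z * sin z)) =
     2 * pi * \<i> * of_real (\<Sum>N\<in>{-2*int n..2*int n}. sD N * cos (of_int N * (pi/2)) - sB N * sin (of_int N * (pi/2)))"
    and "cmod (contour_integral (rectpath a b) (\<lambda>z. 1 / (cosh z * sin z))) \<le> (8 * n + 2) * pi / sinh (n * pi)" (is ?g1)
proof -
  let ?A = "{-2*int n..2*int n}"
  \<comment> \<open>A slightly larger open box. The next zeros, at real distance
    \<open>(n + 1) * pi\<close> and imaginary distance \<open>(n + 1/2) * pi\<close>, still lie
    outside.\<close>
  define S where "S = box (Complex (- ((n + 3/4) * pi)) (- ((n + 1/4) * pi))) (Complex ((n + 3/4) * pi) ((n + 1/4) * pi))"
  define P where "P = sq_pole ` ?A"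
  define h where "h = (\<lambda>z::complex. cosh z * sin z)"
  have np: "n * pi > 0" using n by simp
  have zeros: "z \<in> P" if z: "z \<in> S" "h z = 0" for z
  proof -
    from z(2) have "sin z = 0 \<or> cos (\<i> * z) = 0" by (auto simp: h_def cosh_conv_cos)
    then show ?thesis
    proof
      assume "sin z = 0"
      then obtain k where k: "z = of_real (of_int k * pi)" using sin_eq_0[of z] by (auto simp: complex_eq_iff)
      with z(1) have "of_int k * pi < (n + 3/4) * pi" "- ((n + 3/4) * pi) < of_int k * pi"
        by (auto simp: S_def in_box_complex_iff)
      then have "of_int k * pi < (n + 3/4) * pi" "(- (n + 3/4)) * pi < of_int k * pi"
        by (simp_all only: minus_mult_left)
      then have "real_of_int k < n + 3/4" "- (n + 3/4) < real_of_int k"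
        by (simp_all only: mult_less_cancel_right_pos[OF pi_gt_zero])
      then have "k \<le> int n" "- int n \<le> k" by linarith+
      then have "2 * k \<in> ?A" by auto
      moreover have "z = sq_pole (2 * k)" by (simp add: k sq_pole_def tt_def)
      ultimately show ?thesis unfolding P_def by blast
    next
      assume "cos (\<i> * z) = 0"
      then obtain k where k: "\<i> * z = of_real (of_int k * pi + pi / 2)" using cos_eq_0[of "\<i> * z"] by (auto simp: complex_eq_iff)
      then have z': "z = - \<i> * of_real (of_int k * pi + pi / 2)" by (auto simp: complex_eq_iff)
      with z(1) have "of_int k * pi + pi / 2 < (n + 1/4) * pi" "- ((n + 1/4) * pi) < of_int k * pi + pi / 2"
        by (auto simp: S_def in_box_complex_iff algebra_simps)
      then have "(real_of_int k + 1/2) * pi < (n + 1/4) * pi" "(- (n + 1/4)) * pi < (real_of_int k + 1/2) * pi"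
        unfolding minus_mult_left[symmetric] by (simp_all add: distrib_right)
      then have "real_of_int k + 1/2 < n + 1/4" "- (n + 1/4) < real_of_int k + 1/2"
        by (simp_all only: mult_less_cancel_right_pos[OF pi_gt_zero])
      then have "k < int n" "- int n \<le> k" by linarith+
      then have "- (2 * k + 1) \<in> ?A" by auto
      moreover have "z = sq_pole (- (2 * k + 1))" by (simp add: z' sq_pole_def tt_def algebra_simps)
      ultimately show ?thesis unfolding P_def by blast
    qed
  qed
  have inside: "sq_pole N \<in> box a b" if "N \<in> ?A" for N
  proof -
    have N: "\<bar>real_of_int N\<bar> \<le> 2 * n" using that by auto
    show ?thesis
    proof (cases "even N")
      case True
      have "\<bar>tt N\<bar> \<le> 2 * n * (pi / 2)"
        unfolding abs_mult tt_def using N by (intro mult_mono) auto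
      moreover have "(n + 1/2) * pi = n * pi + pi / 2" by (simp add: distrib_right)
      ultimately have "- ((n + 1/2) * pi) < tt N" "tt N < (n + 1/2) * pi" using pi_gt_zero by linarith+
      then show ?thesis using np True by (simp add: sq_pole_def a_def b_def in_box_complex_iff)
    next
      case False
      then have "N \<noteq> 2 * int n" "N \<noteq> - 2 * int n" by auto
      then have "\<bar>N\<bar> < 2 * int n" using that by auto
      then have "\<bar>real_of_int N\<bar> < 2 * n" by linarith
      then have "\<bar>tt N\<bar> < 2 * n * (pi / 2)"
        by (simp add: tt_def abs_mult)
      then have "- (n * pi) < tt N" "tt N < n * pi" by linarith+
      moreover have "- ((n + 1/2) * pi) < 0" "0 < (n + 1/2) * pi" using np by auto
      ultimately show ?thesis using False by (simp add: sq_pole_def a_def b_def in_box_complex_iff)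
    qed
  qed
  have ab: "cbox a b \<subseteq> S"
  proof
    fix z assume "z \<in> cbox a b"
    moreover have "(n + 1/2) * pi < (n + 3/4) * pi" "n * pi < (n + 1/4) * pi" by simp_all
    ultimately show "z \<in> S" unfolding S_def a_def b_def in_box_complex_iff in_cbox_complex_iff complex.sel
        greaterThanLessThan_iff atLeastAtMost_iff by linarith
  qed
  have le: "Re a \<le> Re b" "Im a \<le> Im b" using np by (auto simp: a_def b_def)
  have img: "path_image (rectpath a b) \<subseteq> S - P"
    using inside ab unfolding path_image_rectpath_cbox_minus_box[OF le] P_def by blast
  have holo: "(\<lambda>z. 1 / h z) holomorphic_on S - P"
    unfolding h_def by (intro holomorphic_intros) (use zeros in \<open>auto simp: h_def\<close>)
  have der: "(h has_field_derivative (sinh z * sin z + cosh z * cos z)) (at z)" for z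
    unfolding h_def by (auto intro!: derivative_eq_intros)
  have res: "residue (\<lambda>z. 1 / h z) (sq_pole N) = of_real (sD N * cos (of_int N * (pi/2)) - sB N * sin (of_int N * (pi/2)))"
    for N
  proof -
    define t where "t = tt N"
    have h0: "h (sq_pole N) = 0"
      by (cases "even N") (simp_all add: h_def sq_pole_def cosh_ii_tt sin_of_real sin_even_tt cos_odd_tt)
    show ?thesis
    proof (cases "even N")
      case True
      then have s0: "sin t = 0" by (simp add: t_def sin_even_tt)
      then have c1: "cos t * cos t = 1" using sin_cos_squared_add[of t] by (simp add: power2_eq_square)
      then have nz: "cos t \<noteq> 0" by auto
      have "residue (\<lambda>z. 1 / h z) (sq_pole N) = 1 / of_real (cosh t * cos t)"
      proof (rule residue_simple_pole_deriv[of "\<lambda>_. 1" UNIV h])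
        show "(h has_field_derivative of_real (cosh t * cos t)) (at (sq_pole N))"
          using der[of "sq_pole N"] True s0 by (simp add: sq_pole_def t_def[symmetric] cosh_of_real' sin_of_real cos_of_real)
      qed (use h0 nz in \<open>auto intro!: holomorphic_intros simp: h_def\<close>)
      also have "1 / (cosh t * cos t) = 1 / cosh t * cos t" using nz c1 by (simp add: field_simps)
      then have "1 / complex_of_real (cosh t * cos t) = of_real (1 / cosh t * cos t)"
        by (metis of_real_1 of_real_divide)
      finally show ?thesis using True by (simp add: sD_def sB_def t_def tt_def)
    next
      case False
      then have c0: "cos t = 0" by (simp add: t_def cos_odd_tt)
      then have s1: "sin t * sin t = 1" using sin_cos_squared_add[of t] by (simp add: power2_eq_square)
      have "N \<noteq> 0" using False by auto
      then have nz: "sin t \<noteq> 0" "sinh t \<noteq> 0" using s1 by (auto simp: t_def tt_simps)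
      have "residue (\<lambda>z. 1 / h z) (sq_pole N) = 1 / of_real (- (sin t * sinh t))"
      proof (rule residue_simple_pole_deriv[of "\<lambda>_. 1" UNIV h])
        show "(h has_field_derivative of_real (- (sin t * sinh t))) (at (sq_pole N))"
        proof -
          have "sinh (sq_pole N) * sin (sq_pole N) + cosh (sq_pole N) * cos (sq_pole N) =
              (\<i> * of_real (sin t)) * (\<i> * of_real (sinh t))"
            using False c0 by (simp add: sq_pole_def t_def[symmetric] cosh_ii_tt sinh_ii_tt sin_ii_tt)
          also have "\<dots> = of_real (- (sin t * sinh t))" by (simp add: complex_eq_iff)
          finally show ?thesis using der[of "sq_pole N"] by simp
        qed
      qed (use h0 nz in \<open>auto intro!: holomorphic_intros simp: h_def\<close>)
      also have "1 / (- (sin t * sinh t)) = - (1 / sinh t * sin t)" using nz s1 by (simp add: field_simps)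
      then have "1 / complex_of_real (- (sin t * sinh t)) = of_real (- (1 / sinh t * sin t))"
        by (metis of_real_1 of_real_divide)
      finally show ?thesis using False by (simp add: sD_def sB_def t_def tt_def)
    qed
  qed
  show "contour_integral (rectpath a b) (\<lambda>z. 1 / (cosh z * sin z)) =
     2 * pi * \<i> * of_real (\<Sum>N\<in>?A. sD N * cos (of_int N * (pi/2)) - sB N * sin (of_int N * (pi/2)))"
  proof -
    have "contour_integral (rectpath a b) (\<lambda>z. 1 / h z) = 2 * pi * \<i> * (\<Sum>p\<in>P. winding_number (rectpath a b) p * residue (\<lambda>z. 1 / h z) p)"
    proof (rule Residue_theorem[where S=S])
      show "open S" "connected S" by (auto simp: S_def intro: convex_connected)
      show "\<forall>z. z \<notin> S \<longrightarrow> winding_number (rectpath a b) z = 0"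
        using ab winding_number_rectpath_outside[OF le] by blast
    qed (use holo img in \<open>auto simp: P_def\<close>)
    also have "(\<Sum>p\<in>P. winding_number (rectpath a b) p * residue (\<lambda>z. 1 / h z) p) =
      (\<Sum>N\<in>?A. residue (\<lambda>z. 1 / h z) (sq_pole N))"
      unfolding P_def
    proof (subst sum.reindex)
      show "inj_on sq_pole ?A"
        by (rule inj_onI) (auto simp: sq_pole_def tt_def complex_eq_iff split: if_splits)
    qed (auto simp: winding_number_rectpath inside)
    finally show ?thesis by (simp add: h_def res[unfolded h_def])
  qed
  show ?g1
  proof -
    have "cmod (contour_integral (rectpath a b) (\<lambda>z. 1 / h z)) \<le> 1 / sinh (n * pi) * (2 * (Re b - Re a) + 2 * (Im b - Im a))"
    proof (rule rectpath_integral_bound[OF _ _ _ le])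
      show "continuous_on (path_image (rectpath a b)) (\<lambda>z. 1 / h z)"
        by (rule holomorphic_on_imp_continuous_on[OF holomorphic_on_subset[OF holo img]])
      show "0 \<le> 1 / sinh (n * pi)" using np by simp
      fix z assume "z \<in> path_image (rectpath a b)"
      then have z: "\<bar>Re z\<bar> = (n + 1/2) * pi \<or> \<bar>Im z\<bar> = n * pi"
      proof -
        have "(n + 1/2) * pi > 0" by (simp add: add_nonneg_pos)
        moreover have "Re z = Re a \<or> Re z = Re b \<or> Im z = Im a \<or> Im z = Im b"
          using \<open>z \<in> _\<close> unfolding path_image_rectpath[OF le] by auto
        ultimately show ?thesis using np unfolding a_def b_def complex.sel by argo
      qed
      have "sinh (n * pi) ^ 2 \<le> cmod (h z) ^ 2"
      proof -
        have hz: "cmod (h z) ^ 2 = (cos (Im z) ^ 2 + sinh (Re z) ^ 2) * (sin (Re z) ^ 2 + sinh (Im z) ^ 2)"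
          by (simp add: h_def norm_mult power_mult_distrib cmod_cosh_sq cmod_sin_sq)
        from z show ?thesis
        proof
          assume "\<bar>Re z\<bar> = (n + 1/2) * pi"
          then have "Re z = (n + 1/2) * pi \<or> Re z = - ((n + 1/2) * pi)" by linarith
          then have *: "sinh (Re z) ^ 2 = sinh ((n + 1/2) * pi) ^ 2" "sin (Re z) ^ 2 = sin ((n + 1/2) * pi) ^ 2"
            by (elim disjE; simp only: sinh_minus sin_minus power2_minus)+
          have "sin ((n + 1/2) * pi) ^ 2 = 1"
            by (simp add: distrib_right sin_add power_mult[symmetric])
          moreover have "sinh (n * pi) ^ 2 \<le> sinh ((n + 1/2) * pi) ^ 2"
            using np by (intro power_mono) auto
          ultimately have "sinh (n * pi) ^ 2 \<le> cos (Im z) ^ 2 + sinh ((n + 1/2) * pi) ^ 2"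
            and "1 \<le> sin ((n + 1/2) * pi) ^ 2 + sinh (Im z) ^ 2"
            using zero_le_power2[of "cos (Im z)"] zero_le_power2[of "sinh (Im z)"] by linarith+
          from mult_mono[OF this] show ?thesis unfolding hz * by simp
        next
          assume "\<bar>Im z\<bar> = n * pi"
          then have "Im z = n * pi \<or> Im z = - (n * pi)" by linarith
          then have *: "sinh (Im z) ^ 2 = sinh (n * pi) ^ 2" "cos (Im z) ^ 2 = cos (n * pi) ^ 2"
            by (elim disjE; simp only: sinh_minus cos_minus power2_minus)+
          have "cos (n * pi) ^ 2 = 1" by (simp add: power_mult[symmetric])
          then have "1 \<le> cos (n * pi) ^ 2 + sinh (Re z) ^ 2"
            and "sinh (n * pi) ^ 2 \<le> sin (Re z) ^ 2 + sinh (n * pi) ^ 2"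
            using zero_le_power2[of "sin (Re z)"] zero_le_power2[of "sinh (Re z)"] by linarith+
          from mult_mono[OF this] show ?thesis unfolding hz * by simp
        qed
      qed
      then have "sinh (n * pi) \<le> cmod (h z)" by (rule power2_le_imp_le) simp
      then show "cmod (1 / h z) \<le> 1 / sinh (n * pi)" using np by (simp add: norm_divide frac_le)
    qed
    also have "2 * (Re b - Re a) + 2 * (Im b - Im a) = (8 * n + 2) * pi"
      by (simp add: a_def b_def algebra_simps)
    finally show ?thesis by (simp add: h_def)
  qed
qed

lemma filterlim_symmetric_intervals:
  "filterlim (\<lambda>n. {- 2 * int n..2 * int n}) (finite_subsets_at_top UNIV) sequentially"
  unfolding filterlim_finite_subsets_at_top
proof (intro allI impI)
  fix X :: "int set" assume X: "finite X \<and> X \<subseteq> UNIV"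
  define M where "M = nat (Max (insert 0 (abs ` X)))"
  have M: "\<bar>x\<bar> \<le> int M" if "x \<in> X" for x
  proof -
    have "\<bar>x\<bar> \<le> Max (insert 0 (abs ` X))" using X that by (intro Max_ge) auto
    then show ?thesis unfolding M_def by linarith
  qed
  have "X \<subseteq> {- 2 * int n..2 * int n}" if "n \<ge> M" for n
  proof
    fix x assume "x \<in> X"
    with M[of x] that show "x \<in> {- 2 * int n..2 * int n}" by auto
  qed
  then show "\<forall>\<^sub>F n in sequentially. finite {- 2 * int n..2 * int n} \<and>
      X \<subseteq> {- 2 * int n..2 * int n} \<and> {- 2 * int n..2 * int n} \<subseteq> UNIV"
    by (auto simp: eventually_sequentially)
qed

text \<open>Both sides are values at the quarter period, proportional to the modulus
  \<open>k\<close> and the complementary modulus \<open>k'\<close> with the same factor. The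
  equality says \<open>k = k'\<close>, the lemniscatic case.\<close>

lemma fb_eq_fd_half_pi: "fb (pi / 2) = fd (pi / 2)"
proof -
  define g where "g = (\<lambda>N. sD N * cos (of_int N * (pi/2)) - sB N * sin (of_int N * (pi/2)))"
  have "(g has_sum (fd (pi / 2) + - fb (pi / 2))) UNIV"
    unfolding g_def fd_def fb_def diff_conv_add_uminus
    by (intro has_sum_add has_sum_uminusI cos_series_has_sum sin_series_has_sum rapid_seqs)
  then have lim: "(\<lambda>n. sum g {- 2 * int n..2 * int n}) \<longlonglongrightarrow> fd (pi / 2) - fb (pi / 2)"
    using filterlim_compose[OF _ filterlim_symmetric_intervals] by (auto simp: has_sum_def)
  have "(\<lambda>n. sum g {- 2 * int n..2 * int n}) \<longlonglongrightarrow> 0"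
  proof (rule tendsto_rabs_zero_cancel, rule tendsto_sandwich[OF _ _ tendsto_const lim_const_over_n[of 10]])
    show "\<forall>\<^sub>F n in sequentially. \<bar>sum g {- 2 * int n..2 * int n}\<bar> \<le> 10 / real n"
      unfolding eventually_sequentially
    proof (intro exI allI impI)
      fix n :: nat assume n: "n \<ge> 1"
      have np: "n * pi \<ge> 2 * n" using pi_ge_two n by (simp add: mult.commute)
      have "2 * pi * \<bar>sum g {- 2 * int n..2 * int n}\<bar> =
         cmod (2 * pi * \<i> * of_real (sum g {- 2 * int n..2 * int n}))"
        by (simp add: norm_mult del: of_real_sum)
      also have "\<dots> \<le> (8 * n + 2) * pi / sinh (n * pi)"
        using square_contour(2)[OF n] unfolding square_contour(1)[OF n] g_def .
      \<comment> \<open>A crude bound is enough: \<open>8 n + 2\<close> is at most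
        \<open>10 n\<close>, and \<open>sinh (n * pi)\<close> is at least \<open>n^2 / 2\<close> by
        the quadratic Taylor bound for the exponential.\<close>
      also have "\<dots> \<le> (10 * n) * pi * (2 / n ^ 2)"
      proof -
        have n1: "real n \<ge> 1" using n by simp
        have "real n ^ 2 / 2 \<le> sinh (n * pi)"
        proof -
          have "1 / sinh (n * pi) \<le> 4 * exp (- (n * pi))"
            using inverse_sinh_bound[of "n * pi"] np n1 by simp
          moreover have "sinh (n * pi) > 0" using n1 by simp
          ultimately have e: "exp (n * pi) \<le> 4 * sinh (n * pi)" by (simp add: exp_minus field_simps)
          have "exp (n * pi) \<ge> 1 + n * pi + (n * pi) ^ 2 / 2"
            by (rule exp_lower_Taylor_quadratic) simp
          moreover have "(n * pi) ^ 2 \<ge> (2 * real n) ^ 2" using np by (intro power_mono) auto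
          ultimately have "exp (n * pi) \<ge> (2 * real n) ^ 2 / 2" using np n1 by linarith
          then show ?thesis using e by (simp add: power_mult_distrib)
        qed
        moreover have "real n ^ 2 / 2 > 0" using n1 by simp
        ultimately have "1 / sinh (n * pi) \<le> 1 / (real n ^ 2 / 2)" by (intro divide_left_mono) auto
        then have "(8 * n + 2) * pi * (1 / sinh (n * pi)) \<le> (10 * n) * pi * (1 / (real n ^ 2 / 2))"
          using n1 by (intro mult_mono) auto
        then show ?thesis by simp
      qed
      also have "\<dots> = 2 * pi * (10 / n)" using n by (simp add: power2_eq_square field_simps)
      finally show "\<bar>sum g {- 2 * int n..2 * int n}\<bar> \<le> 10 / real n"
        by (rule mult_left_le_imp_le) simp
    qed
  qed auto
  with lim have "fd (pi / 2) - fb (pi / 2) = 0" by (rule LIMSEQ_unique)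
  then show ?thesis by simp
qed

section \<open>Inversion of the amplitude; the constants \<open>lam\<close> and \<open>kA\<close> as
  Beta integrals\<close>

lemma kD_kA: "kD - kA = lam ^ 2"
  using fd_sq[of "pi / 2"] by (simp add: lam_def boundary_values)

lemma fab_sq: "fa x ^ 2 + fb x ^ 2 = lam ^ 2"
proof -
  have "((\<lambda>x. fa x ^ 2 + fb x ^ 2) has_real_derivative 0) (at x within UNIV)" for x
    by (auto intro!: derivative_eq_intros Jacobi_derivs)
  then obtain c where "\<And>x. fa x ^ 2 + fb x ^ 2 = c"
    using has_field_derivative_zero_constant[of UNIV "\<lambda>x. fa x ^ 2 + fb x ^ 2"] by auto
  from this[of x] this[of "pi / 2"] show ?thesis
    by (simp add: boundary_values fb_eq_fd_half_pi lam_def)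
qed

text \<open>A zero of \<open>fd\<close> would force \<open>lam = 0\<close> and then
  \<open>fa 0 = 0\<close>. Positivity makes \<open>amp\<close> strictly increasing and fixes the
  sign of the square root in \<open>fd_eq\<close>.\<close>

lemma fd_pos: "fd x > 0"
proof (rule ccontr)
  assume "\<not> fd x > 0"
  moreover have "continuous_on UNIV fd"
    using Jacobi_derivs(3) by (auto intro!: DERIV_continuous_on)
  then have "connected (fd ` UNIV)" by (rule connected_continuous_image) simp
  ultimately obtain y where "fd y = 0"
    using fd_0_pos connectedD_interval[of "range fd" "fd x" "fd 0" 0] by (auto simp: not_less less_imp_le)
  then have "fa y ^ 2 + lam ^ 2 = 0" using fd_sq[of y] kD_kA by simp
  then have "lam = 0" by (simp add: sum_power2_eq_zero_iff)
  then show False using fab_sq[of 0] fa_0_pos by (simp add: boundary_values)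
qed

lemma lam_pos: "lam > 0" unfolding lam_def by (rule fd_pos)

lemma fa_0: "fa 0 = lam"
  using fab_sq[of 0] fa_0_pos lam_pos by (simp add: boundary_values)

text \<open>The vector \<open>(fa, fb)\<close> has length \<open>lam\<close>, and its scalar product
  \<open>h\<close> with the unit vector \<open>(cos amp, sin amp)\<close> is constant and equal to
  \<open>lam\<close>. Hence it is \<open>lam\<close> times that vector.\<close>

lemma fa_eq: "fa x = lam * cos (amp x)" and fb_eq: "fb x = lam * sin (amp x)"
proof -
  define h where "h = (\<lambda>x. fa x * cos (amp x) + fb x * sin (amp x))"
  have "(h has_real_derivative 0) (at x within UNIV)" for x
    unfolding h_def by (auto intro!: derivative_eq_intros Jacobi_derivs amp_deriv simp: algebra_simps)
  then obtain c where c: "\<And>x. h x = c"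
    using has_field_derivative_zero_constant[of UNIV h] by auto
  have h: "h x = lam" using c[of x] c[of 0] by (simp add: h_def amp_0 fa_0)
  have "(fa x - lam * cos (amp x))^2 + (fb x - lam * sin (amp x))^2 =
      (fa x ^ 2 + fb x ^ 2) + lam^2 * (sin (amp x) ^ 2 + cos (amp x) ^ 2) - 2 * lam * h x"
    unfolding h_def by algebra
  also have "\<dots> = 0" unfolding fab_sq h sin_cos_squared_add by algebra
  finally have "fa x - lam * cos (amp x) = 0 \<and> fb x - lam * sin (amp x) = 0"
    by (simp only: sum_power2_eq_zero_iff)
  then show "fa x = lam * cos (amp x)" "fb x = lam * sin (amp x)" by auto
qed

lemma fd_eq: "fd x = lam * sqrt (1 + cos (amp x) ^ 2)"
proof -
  have "fd x ^ 2 = (lam * sqrt (1 + cos (amp x) ^ 2)) ^ 2"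
    using fd_sq[of x] kD_kA by (simp add: fa_eq power_mult_distrib algebra_simps)
  then show ?thesis using fd_pos[of x] lam_pos by (simp add: power2_eq_iff_nonneg)
qed

lemma amp_strict_mono: "x < y \<Longrightarrow> amp x < amp y"
  by (rule DERIV_pos_imp_increasing) (use amp_deriv fd_pos in auto)

lemma amp_bounds: "0 < x \<Longrightarrow> x < pi / 2 \<Longrightarrow> 0 < amp x \<and> amp x < pi / 2"
  using amp_strict_mono[of 0 x] amp_strict_mono[of x "pi / 2"] by (simp add: amp_0 amp_half_pi)

lemma amp_image: "amp ` {0<..<pi/2} = {0<..<pi/2}"
proof
  show "{0<..<pi/2} \<subseteq> amp ` {0<..<pi/2}"
  proof
    fix y :: real assume y: "y \<in> {0<..<pi/2}"
    have cont: "\<forall>x. 0 \<le> x \<and> x \<le> pi / 2 \<longrightarrow> isCont amp x"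
      using amp_deriv DERIV_isCont by blast
    obtain x where x: "0 \<le> x" "x \<le> pi / 2" "amp x = y"
      using IVT[of amp 0 y "pi / 2"] y cont by (auto simp: amp_0 amp_half_pi)
    then have "x \<noteq> 0" "x \<noteq> pi / 2" using y amp_0 amp_half_pi by (metis greaterThanLessThan_iff less_irrefl)+
    then show "y \<in> amp ` {0<..<pi/2}" using x by force
  qed
qed (use amp_bounds in auto)

lemma cos4_image: "(\<lambda>x. cos (amp x) ^ 4) ` {0<..<pi/2} = {0<..<1}"
proof -
  have "(\<lambda>y. cos y ^ 4) ` {0<..<pi/2} = {0<..<1::real}"
  proof safe
    fix y :: real assume y: "y \<in> {0<..<pi/2}"
    have "cos y > 0" using y by (intro cos_gt_zero) auto
    moreover have "cos y < 1" using y cos_monotone_0_pi[of 0 y] by auto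
    ultimately show "cos y ^ 4 \<in> {0<..<1}" by (auto intro: power_less_one_iff[THEN iffD2] simp: power_less_one_iff)
  next
    fix t :: real assume t: "t \<in> {0<..<1}"
    define s where "s = root 4 t"
    have s: "0 < s" "s < 1" "s ^ 4 = t" using t by (auto simp: s_def)
    have "arccos s \<in> {0<..<pi/2}" using s arccos_lt_bounded[of s] arccos_less_arccos[of 0 s] by auto
    moreover have "cos (arccos s) ^ 4 = t" using s by simp
    ultimately show "t \<in> (\<lambda>y. cos y ^ 4) ` {0<..<pi/2}" by (metis imageI)
  qed
  then have "(\<lambda>y. cos y ^ 4) ` amp ` {0<..<pi/2} = {0<..<1}" unfolding amp_image .
  then show ?thesis by (simp add: image_image)
qed

lemma cos_amp_bounds: assumes "x \<in> {0<..<pi/2}"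
  shows "0 < cos (amp x)" "0 < sin (amp x)"
  using amp_bounds[of x] assms by (auto intro!: cos_gt_zero sin_gt_zero)

lemma inj_cos4_amp: "inj_on (\<lambda>x. cos (amp x) ^ 4) {0<..<pi/2}"
proof (rule inj_onI)
  fix x y assume x: "x \<in> {0<..<pi/2}" and y: "y \<in> {0<..<pi/2}" and "cos (amp x) ^ 4 = cos (amp y) ^ 4"
  then have "cos (amp x) = cos (amp y)"
    using power_eq_iff_eq_base[of 4 "cos (amp x)" "cos (amp y)"] cos_amp_bounds by (simp add: less_imp_le)
  then have "amp x = amp y"
    using amp_bounds[of x] amp_bounds[of y] x y cos_inj_pi[of "amp x" "amp y"] by auto
  then show "x = y" using amp_strict_mono[of x y] amp_strict_mono[of y x] by linarith
qed

text \<open>Substitution \<open>t = cos (amp x) ^ 4\<close>. The fourth power is dictated by the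
  modulus: the weight \<open>(1 - t) powr (- 1/2)\<close> then cancels against
  \<open>sin (amp x) * fd x\<close>, and only a power of the cosine remains.\<close>

lemma Beta_amp:
  assumes a: "a > 0" and f: "\<And>x. x \<in> {0<..<pi/2} \<Longrightarrow>
     4 * cos (amp x) ^ 3 * sin (amp x) * fd x * ((cos (amp x) ^ 4) powr (a - 1) * (1 - cos (amp x) ^ 4) powr (- 1/2)) = f x"
  shows "integral {0<..<pi/2} f = Beta a (1/2)"
proof -
  define g where "g = (\<lambda>t::real. t powr (a - 1) * (1 - t) powr (1/2 - 1))"
  have "(g has_integral Beta a (1/2)) {0..1}"
    unfolding g_def by (rule has_integral_Beta_real) (use a in auto)
  then have g: "(g has_integral Beta a (1/2)) {0<..<1}"
    by (simp add: has_integral_Icc_iff_Ioo)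
  then have "g absolutely_integrable_on {0<..<1}"
    by (intro nonnegative_absolutely_integrable_1) (auto simp: g_def)
  moreover have "integral {0<..<1} g = Beta a (1/2)" using g by (rule integral_unique)
  ultimately have "(\<lambda>x. \<bar>- (4 * cos (amp x) ^ 3 * sin (amp x) * fd x)\<bar> * g (cos (amp x) ^ 4)) absolutely_integrable_on {0<..<pi/2} \<and>
      integral {0<..<pi/2} (\<lambda>x. \<bar>- (4 * cos (amp x) ^ 3 * sin (amp x) * fd x)\<bar> * g (cos (amp x) ^ 4)) = Beta a (1/2)"
  proof (subst has_absolute_integral_change_of_variables_1'[OF _ _ inj_cos4_amp])
    show "((\<lambda>x. cos (amp x) ^ 4) has_real_derivative - (4 * cos (amp x) ^ 3 * sin (amp x) * fd x))
        (at x within {0<..<pi/2})" for x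
      by (rule DERIV_subset[of _ _ _ UNIV]) (auto intro!: derivative_eq_intros amp_deriv)
  qed (simp_all add: cos4_image)
  then have "Beta a (1/2) = integral {0<..<pi/2} (\<lambda>x. \<bar>- (4 * cos (amp x) ^ 3 * sin (amp x) * fd x)\<bar> * g (cos (amp x) ^ 4))"
    by simp
  also have "\<dots> = integral {0<..<pi/2} f"
  proof (rule integral_cong)
    fix x assume x: "x \<in> {0<..<pi/2}"
    show "\<bar>- (4 * cos (amp x) ^ 3 * sin (amp x) * fd x)\<bar> * g (cos (amp x) ^ 4) = f x"
      using f[OF x] cos_amp_bounds[OF x] fd_pos[of x] by (simp add: g_def abs_mult)
  qed
  finally show ?thesis by simp
qed

text \<open>With \<open>c\<close> and \<open>s\<close> the cosine and sine of the amplitude,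
  \<open>s^2 * (1 + c^2) = 1 - c^4\<close>; so \<open>s * fd x\<close> is \<open>lam\<close> times
  the square root of \<open>1 - c^4\<close>.\<close>

lemma amp_weight:
  assumes x: "x \<in> {0<..<pi/2}"
  shows "sin (amp x) * fd x * (1 - cos (amp x) ^ 4) powr (- 1/2) = lam"
proof -
  define c s where "c = cos (amp x)" and "s = sin (amp x)"
  have cs: "c > 0" "s > 0" "s ^ 2 = 1 - c ^ 2" using cos_amp_bounds[OF x] by (auto simp: c_def s_def sin_squared_eq)
  have "1 - c ^ 4 = s ^ 2 * (1 + c ^ 2)" unfolding cs(3) by (simp add: algebra_simps power_add[symmetric] flip: power_mult)
  moreover have "(s ^ 2 * (1 + c ^ 2)) powr (- 1/2) = 1 / (s * sqrt (1 + c ^ 2))"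
    using cs(1,2) powr_half_sqrt[of "s ^ 2 * (1 + c ^ 2)"]
    by (simp add: powr_minus_divide real_sqrt_mult)
  ultimately have "(1 - c ^ 4) powr (- 1/2) = 1 / (s * sqrt (1 + c ^ 2))" by simp
  moreover have "sqrt (1 + c ^ 2) > 0" by (simp add: add_pos_nonneg)
  ultimately show ?thesis unfolding fd_eq c_def[symmetric] s_def[symmetric] using cs by simp
qed

text \<open>For the exponent \<open>1/4\<close> all powers of the cosine cancel and the integrand is
  the constant \<open>4 * lam\<close>.\<close>

lemma lam_Beta: "2 * pi * lam = Beta (1/4) (1/2)"
proof -
  have "integral {0<..<pi/2} (\<lambda>x. 4 * lam) = Beta (1/4) (1/2)"
  proof (rule Beta_amp)
    fix x assume x: "x \<in> {0<..<pi/2}"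
    define c where "c = cos (amp x)"
    have c: "c > 0" using cos_amp_bounds[OF x] by (simp add: c_def)
    have "(c ^ 4) powr (1/4 - 1) = 1 / c ^ 3"
      using c by (simp add: powr_powr powr_minus_divide flip: powr_numeral)
    then have eq: "c ^ 3 * (c ^ 4) powr (1/4 - 1) = 1" using c by simp
    have "4 * c ^ 3 * sin (amp x) * fd x * ((c ^ 4) powr (1/4 - 1) * (1 - c ^ 4) powr (- 1/2))
       = 4 * 1 * (sin (amp x) * fd x * (1 - c ^ 4) powr (- 1/2))"
    proof -
      have "4 * c ^ 3 * sin (amp x) * fd x * (P * Q) = 4 * (c ^ 3 * P) * (sin (amp x) * fd x * Q)" for P Q :: real
        by (simp only: mult_ac)
      then show ?thesis using eq by metis
    qed
    then show "4 * cos (amp x) ^ 3 * sin (amp x) * fd x * ((cos (amp x) ^ 4) powr (1/4 - 1) * (1 - cos (amp x) ^ 4) powr (- 1/2)) = 4 * lam"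
      unfolding c_def amp_weight[OF x] by simp
  qed simp
  moreover have "((\<lambda>x. 4 * lam) has_integral (pi / 2 - 0) *\<^sub>R (4 * lam)) {0..pi/2}"
    by (rule has_integral_const_real[THEN has_integral_eq_rhs]) simp
  then have "((\<lambda>x. 4 * lam) has_integral 2 * pi * lam) {0<..<pi/2}"
    by (simp add: has_integral_Icc_iff_Ioo mult_ac)
  ultimately show ?thesis using integral_unique by metis
qed

text \<open>For the exponent \<open>3/4\<close> the integrand is \<open>4 / lam * fa^2\<close>, with
  primitive \<open>4 / lam * (kA * x + fz x)\<close>. As \<open>fz\<close> vanishes at 0 and at
  \<open>pi / 2\<close>, only \<open>kA\<close> remains.\<close>

lemma kA_Beta: "2 * pi * kA = lam * Beta (3/4) (1/2)"
proof -
  define F where "F = (\<lambda>x. 4 / lam * (kA * x + fz x))"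
  have "((\<lambda>x. 4 * lam * cos (amp x) ^ 2) has_integral (F (pi / 2) - F 0)) {0..pi/2}"
  proof (rule fundamental_theorem_of_calculus)
    fix x
    have "4 * lam * cos (amp x) ^ 2 = 4 / lam * (kA + (fa x ^ 2 - kA))"
      using lam_pos by (simp add: fa_eq power2_eq_square)
    moreover have "(F has_real_derivative 4 / lam * (kA + (fa x ^ 2 - kA))) (at x)"
      unfolding F_def by (intro DERIV_cmult DERIV_add DERIV_cmult_Id Jacobi_derivs)
    ultimately show "(F has_vector_derivative 4 * lam * cos (amp x) ^ 2) (at x within {0..pi/2})"
      unfolding has_real_derivative_iff_has_vector_derivative[symmetric]
      by (metis has_field_derivative_at_within)
  qed simp
  moreover have "F (pi / 2) - F 0 = 2 * pi * kA / lam" by (simp add: F_def boundary_values)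
  ultimately have i1: "integral {0<..<pi/2} (\<lambda>x. 4 * lam * cos (amp x) ^ 2) = 2 * pi * kA / lam"
    by (metis has_integral_Icc_iff_Ioo integral_unique)
  have i2: "integral {0<..<pi/2} (\<lambda>x. 4 * lam * cos (amp x) ^ 2) = Beta (3/4) (1/2)"
  proof (rule Beta_amp)
    fix x assume x: "x \<in> {0<..<pi/2}"
    define c where "c = cos (amp x)"
    have c: "c > 0" using cos_amp_bounds[OF x] by (simp add: c_def)
    have "(c ^ 4) powr (3/4 - 1) = 1 / c"
      using c by (simp add: powr_powr powr_minus_divide flip: powr_numeral)
    then have eq: "c ^ 3 * (c ^ 4) powr (3/4 - 1) = c ^ 2" using c by (simp add: power2_eq_square power3_eq_cube)
    have "4 * c ^ 3 * sin (amp x) * fd x * ((c ^ 4) powr (3/4 - 1) * (1 - c ^ 4) powr (- 1/2))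
       = 4 * c ^ 2 * (sin (amp x) * fd x * (1 - c ^ 4) powr (- 1/2))"
    proof -
      have "4 * c ^ 3 * sin (amp x) * fd x * (P * Q) = 4 * (c ^ 3 * P) * (sin (amp x) * fd x * Q)" for P Q :: real
        by (simp only: mult_ac)
      then show ?thesis using eq by metis
    qed
    then show "4 * cos (amp x) ^ 3 * sin (amp x) * fd x * ((cos (amp x) ^ 4) powr (3/4 - 1) * (1 - cos (amp x) ^ 4) powr (- 1/2)) = 4 * lam * cos (amp x) ^ 2"
      unfolding c_def amp_weight[OF x] by simp
  qed simp
  show ?thesis unfolding i2[symmetric] i1 using lam_pos by simp
qed

lemma lam_Gamma: "lam = Gamma (1/4) ^ 2 / (2 * sqrt 2 * pi * sqrt pi)"
proof -
  have "Beta (1/4) (1/2) = Gamma (1/4) * sqrt pi / Gamma (3/4 :: real)"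
    by (simp add: Beta_def Gamma_one_half_real)
  also have "\<dots> = Gamma (1/4) * sqrt pi * Gamma (1/4) / (Gamma (1/4) * Gamma (3/4 :: real))"
    by simp
  also have "\<dots> = Gamma (1/4) ^ 2 * sqrt pi / (pi * sqrt 2)"
    unfolding Gamma_quarter by (simp add: power2_eq_square)
  finally have "2 * pi * lam = Gamma (1/4) ^ 2 * sqrt pi / (pi * sqrt 2)" using lam_Beta by simp
  then have "lam = Gamma (1/4) ^ 2 / (2 * sqrt 2 * pi) * (sqrt pi / pi)" by (simp add: field_simps)
  also have "sqrt pi / pi = 1 / sqrt pi" by (simp add: field_simps)
  finally show ?thesis by (simp add: mult.assoc)
qed

text \<open>Multiplying the two Beta evaluations cancels \<open>lam\<close> and all values of Gamma
  at quarters. This is Legendre's relation in the lemniscatic case, and the source of the extra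
  powers of \<open>1 / pi\<close>.\<close>

lemma kA_eq: "kA = 1 / pi"
proof -
  have "4 * pi ^ 2 * kA = Beta (1/4) (1/2) * Beta (3/4) (1/2)"
  proof -
    have "Beta (1/4) (1/2) * Beta (3/4) (1/2) = 2 * pi * (lam * Beta (3/4) (1/2))"
      unfolding lam_Beta[symmetric] by (simp only: mult_ac)
    then show ?thesis unfolding kA_Beta[symmetric] by (simp add: power2_eq_square)
  qed
  also have "\<dots> = (Gamma (1/4) * sqrt pi / Gamma (3/4)) * (Gamma (3/4) * sqrt pi / Gamma (1/4 + 1 :: real))"
    by (simp add: Beta_def Gamma_one_half_real)
  also have "Gamma (1/4 + 1 :: real) = 1/4 * Gamma (1/4)"
    by (rule Gamma_plus1) auto
  also have "(Gamma (1/4) * sqrt pi / Gamma (3/4)) * (Gamma (3/4) * sqrt pi / (1/4 * Gamma (1/4))) = 4 * pi"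
  proof -
    have "Gamma (1/4 :: real) \<noteq> 0" "Gamma (3/4 :: real) \<noteq> 0"
      using Gamma_real_pos[of "1/4"] Gamma_real_pos[of "3/4"] by linarith+
    then show ?thesis by (simp add: field_simps)
  qed
  finally show ?thesis by (simp add: power2_eq_square field_simps)
qed

section \<open>Residues of the integrand\<close>

lemma residue_simple_pole_quotient:
  assumes f: "f holomorphic_on s" and g: "g holomorphic_on s" and s: "open s" "z \<in> s"
    and g': "(g has_field_derivative g') (at z)" "g z = 0" "g' \<noteq> 0"
  shows "residue (\<lambda>w. f w / g w) z = f z / g'"
proof -
  have "((\<lambda>w. (g w - g z) / (w - z)) \<longlongrightarrow> g') (at z)"
    using g'(1) by (simp add: has_field_derivative_iff)
  then have "eventually (\<lambda>w. (g w - g z) / (w - z) \<noteq> 0) (at z)"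
    using g'(3) by (rule tendsto_imp_eventually_ne)
  then have "eventually (\<lambda>w. g w \<noteq> 0) (at z)"
    by (rule eventually_mono) (use g'(2) in auto)
  then obtain d where d: "d > 0" "\<And>w. dist w z < d \<Longrightarrow> w \<noteq> z \<Longrightarrow> g w \<noteq> 0"
    unfolding eventually_at by auto
  obtain e where e: "e > 0" "ball z e \<subseteq> s" using s open_contains_ball by blast
  define b where "b = ball z (min d e)"
  have b: "open b" "z \<in> b" "connected b" "b \<subseteq> s" using d(1) e by (auto simp: b_def)
  have gb: "g w \<noteq> 0" if "w \<in> b - {z}" for w using d(2)[of w] that by (auto simp: b_def dist_commute)
  have hol: "f holomorphic_on b" "g holomorphic_on b" using f g b(4) holomorphic_on_subset by blast+
  \<comment> \<open>Adding \<open>c\<close> to \<open>f\<close> covers the case \<open>f z = 0\<close>, which \<open>residue_simple_pole_deriv\<close> excludes.\<close>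
  define c where "c = complex_of_real (1 + cmod (f z))"
  have c: "c \<noteq> 0" "f z + c \<noteq> 0"
  proof -
    have "cmod c = 1 + cmod (f z)" unfolding c_def norm_of_real by simp
    then have "cmod c > 0" using norm_ge_zero[of "f z"] by linarith
    then show "c \<noteq> 0" by auto
    show "f z + c \<noteq> 0"
    proof
      assume "f z + c = 0"
      then have "f z = - c" by (simp add: eq_neg_iff_add_eq_0)
      then have "cmod (f z) = cmod c" by simp
      with \<open>cmod c = _\<close> show False by simp
    qed
  qed
  have q: "(\<lambda>w. k w / g w) holomorphic_on b - {z}" if "k holomorphic_on b" for k
    by (intro holomorphic_intros holomorphic_on_subset[OF that] holomorphic_on_subset[OF hol(2)] gb) auto
  have "residue (\<lambda>w. f w / g w) z = residue (\<lambda>w. (f w + c) / g w - c / g w) z"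
    by (rule residue_cong) (auto simp: diff_divide_distrib[symmetric])
  also have "\<dots> = residue (\<lambda>w. (f w + c) / g w) z - residue (\<lambda>w. c / g w) z"
    by (rule residue_diff[OF b(1,2)]) (intro q holomorphic_intros hol)+
  also have "residue (\<lambda>w. (f w + c) / g w) z = (f z + c) / g'"
    by (rule residue_simple_pole_deriv[where s=b])
      (use hol(2) b g' c(2) in \<open>auto intro!: holomorphic_intros hol(1)\<close>)
  also have "residue (\<lambda>w. c / g w) z = c / g'"
    by (rule residue_simple_pole_deriv[where s=b])
      (use hol(2) b g' c(1) in \<open>auto intro!: holomorphic_intros\<close>)
  finally show ?thesis by (simp add: diff_divide_distrib[symmetric])
qed

text \<open>A single-valued primitive off \<open>z\<close> makes the integral around a small circle
  vanish, whatever the order of the pole.\<close>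

lemma residue_derivative:
  assumes s: "open s" "z \<in> s" and F: "\<And>w. w \<in> s - {z} \<Longrightarrow> (F has_field_derivative F' w) (at w)"
  shows "F' holomorphic_on s - {z}" "residue F' z = 0"
proof -
  have os: "open (s - {z})" using s by auto
  have hF: "F holomorphic_on s - {z}" using F by (auto simp: holomorphic_on_open[OF os])
  show hol: "F' holomorphic_on s - {z}"
    using holomorphic_deriv[OF hF os] by (rule holomorphic_transform) (use F DERIV_imp_deriv in blast)
  obtain r where r: "r > 0" "cball z r \<subseteq> s" using s open_contains_cball by blast
  have "(F' has_contour_integral 2 * pi * \<i> * residue F' z) (circlepath z r)"
    by (rule base_residue[OF s r(1) hol r(2)])
  moreover have "(F' has_contour_integral 0) (circlepath z r)"
  proof (rule Cauchy_theorem_primitive[where S="s - {z}"])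
    show "(F has_field_derivative F' w) (at w within s - {z})" if "w \<in> s - {z}" for w
      using F[OF that] has_field_derivative_at_within by blast
    show "path_image (circlepath z r) \<subseteq> s - {z}"
      using r by (auto simp: path_image_circlepath_minus sphere_def dist_norm path_image_circlepath)
  qed auto
  ultimately have "2 * pi * \<i> * residue F' z = 0" by (rule has_contour_integral_unique)
  then show "residue F' z = 0" by simp
qed

definition mixed_fun :: "nat \<Rightarrow> complex \<Rightarrow> complex" where
  "mixed_fun p z = z ^ p / ((cosh (2 * z) - cos (2 * z)) * (cosh z - cos z))"

text \<open>The rotation \<open>z \<mapsto> \<rho> z\<close> below puts the poles of \<^const>\<open>mixed_fun\<close> on the two coordinate axes, since
  \<open>cosh z - cos z = 2 \<i> sinh (\<rho> z) sin (\<rho> z)\<close>.\<close>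

definition rho :: complex where "rho = (1 - \<i>) / 2"

lemma rho_mult: "rho * (1 + \<i>) = 1" "(1 + \<i>) * rho = 1" and rho_nonzero: "rho \<noteq> 0"
  by (simp_all add: rho_def complex_eq_iff)

lemma cosh_minus_cos: "cosh ((1 + \<i>) * v) - cos ((1 + \<i>) * v) = 2 * \<i> * sinh v * sin v"
proof -
  have c: "cosh (\<i> * v) = cos v" "sinh (\<i> * v) = \<i> * sin v" "cos (\<i> * v) = cosh v" "sin (\<i> * v) = \<i> * sinh v"
    by (simp_all add: cosh_conv_cos sinh_conv_sin mult.assoc[symmetric])
  have "(1 + \<i>) * v = v + \<i> * v" by (simp add: algebra_simps)
  then show ?thesis by (simp only: cosh_add cos_add c) (simp add: algebra_simps)
qed

lemma cosh_minus_cos_rho: "cosh z - cos z = 2 * \<i> * sinh (rho * z) * sin (rho * z)"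
  using cosh_minus_cos[of "rho * z"] by (simp add: rho_mult mult.assoc[symmetric])

lemma mixed_fun_rho: "mixed_fun p z = - (z ^ p / (4 * (sinh (rho * z) * sinh (2 * (rho * z)) * sin (rho * z) * sin (2 * (rho * z)))))"
proof -
  have "rho * (2 * z) = 2 * (rho * z)" by simp
  then have "(cosh (2 * z) - cos (2 * z)) * (cosh z - cos z) =
      - (4 * (sinh (rho * z) * sinh (2 * (rho * z)) * sin (rho * z) * sin (2 * (rho * z))))"
    unfolding cosh_minus_cos_rho[of z] cosh_minus_cos_rho[of "2 * z"] by (simp add: algebra_simps)
  then show ?thesis unfolding mixed_fun_def by simp
qed

text \<open>This is \<open>v^p / (sinh v * sinh (2 v))\<close> in the split form whose terms are the
  hyperbolic sequences; \<open>gder\<close> is its derivative in the same form. The type is left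
  open because residues need complex arguments and the sequences real ones.\<close>

definition gfun :: "nat \<Rightarrow> 'a::{real_normed_field,banach} \<Rightarrow> 'a" where
  "gfun p v = v ^ p / 2 * (cosh v / sinh v ^ 2 - 1 / cosh v)"

definition gder :: "nat \<Rightarrow> 'a::{real_normed_field,banach} \<Rightarrow> 'a" where
  "gder p v = of_nat p * v ^ (p - 1) / 2 * (cosh v / sinh v ^ 2 - 1 / cosh v) +
      v ^ p / 2 * (- (1 / sinh v + 2 / sinh v ^ 3) + sinh v / cosh v ^ 2)"

lemma gfun_deriv:
  fixes v :: complex
  assumes "sinh v \<noteq> 0" "cosh v \<noteq> 0"
  shows "(gfun p has_field_derivative gder p v) (at v)"
proof -
  have "((\<lambda>v. cosh v / sinh v ^ 2 - 1 / cosh v) has_field_derivative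
      (- (1 / sinh v + 2 / sinh v ^ 3) + sinh v / cosh v ^ 2)) (at v)"
  proof -
    have "((\<lambda>v. cosh v / sinh v ^ 2 - 1 / cosh v) has_field_derivative
      ((sinh v * sinh v ^ 2 - cosh v * (2 * sinh v * cosh v)) / (sinh v ^ 2 * sinh v ^ 2) + sinh v / (cosh v * cosh v))) (at v)"
      using assms by (auto intro!: derivative_eq_intros)
    moreover have "(sinh v * sinh v ^ 2 - cosh v * (2 * sinh v * cosh v)) / (sinh v ^ 2 * sinh v ^ 2) =
        - (1 / sinh v + 2 / sinh v ^ 3)"
    proof -
      have eq: "sinh v * sinh v ^ 2 - cosh v * (2 * sinh v * cosh v) = - sinh v * (sinh v ^ 2 + 2)"
        using cosh_square_eq[of v] by algebra
      show ?thesis unfolding eq using assms by (simp add: field_simps power2_eq_square power3_eq_cube)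
    qed
    ultimately show ?thesis by (simp add: power2_eq_square)
  qed
  moreover have "((\<lambda>v. v ^ p / 2) has_field_derivative of_nat p * v ^ (p - 1) / 2) (at v)"
    by (auto intro!: derivative_eq_intros)
  ultimately show ?thesis
    unfolding gfun_def[abs_def] gder_def using DERIV_mult by (fastforce simp: algebra_simps)
qed

text \<open>The double poles are moved into a derivative, which has no residues.\<close>

lemma mixed_fun_decomp:
  assumes "sinh (rho * z) \<noteq> 0" "cosh (rho * z) \<noteq> 0" "sin (rho * z) \<noteq> 0" "cos (rho * z) \<noteq> 0"
  defines "v \<equiv> rho * z"
  shows "mixed_fun p z = - ((1 + \<i>) ^ p) / 8 *
     ((gder p v * cos v + gfun p v * sin v) / (sin v * cos v) - (gder p v / sin v - gfun p v * cos v / sin v ^ 2))"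
proof -
  let ?E = "((gder p v * cos v + gfun p v * sin v) / (sin v * cos v) - (gder p v / sin v - gfun p v * cos v / sin v ^ 2))"
  note nz = assms(1-4)[folded v_def]
  have z: "z = (1 + \<i>) * v" by (simp add: v_def rho_mult mult.assoc[symmetric])
  have g: "gfun p v = v ^ p / (2 * (sinh v ^ 2 * cosh v))"
  proof -
    have "cosh v / sinh v ^ 2 - 1 / cosh v = (cosh v ^ 2 - sinh v ^ 2) / (sinh v ^ 2 * cosh v)"
      using nz by (simp add: field_simps power2_eq_square)
    also have "cosh v ^ 2 - sinh v ^ 2 = 1" by (simp add: cosh_square_eq)
    finally show ?thesis by (simp add: gfun_def)
  qed
  \<comment> \<open>The subtracted bracket is the derivative of \<open>gfun / sin\<close>. What
    remains is the numerator factor 1 written as \<open>sin^2 + cos^2\<close>.\<close>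
  have "?E =
      gfun p v * (sin v ^ 2 + cos v ^ 2) / (sin v ^ 2 * cos v)"
  proof -
    have "(d * B + g * A) / (A * B) - (d / A - g * B / A ^ 2) = g * (A ^ 2 + B ^ 2) / (A ^ 2 * B)"
      if "A \<noteq> 0" "B \<noteq> 0" for A B d g :: complex
      using that by (simp add: field_simps power2_eq_square)
    from this[OF nz(3,4)] show ?thesis .
  qed
  also have "\<dots> = v ^ p / (2 * (sinh v ^ 2 * cosh v * sin v ^ 2 * cos v))"
    by (simp add: g)
  finally have "- ((1 + \<i>) ^ p) / 8 *
     ?E =
     - ((1 + \<i>) ^ p) / 8 * (v ^ p / (2 * (sinh v ^ 2 * cosh v * sin v ^ 2 * cos v)))" by simp
  also have "\<dots> = mixed_fun p z"
  proof -
    have zp: "z ^ p = (1 + \<i>) ^ p * v ^ p" by (subst z) (rule power_mult_distrib)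
    show ?thesis unfolding mixed_fun_rho v_def[symmetric] sinh_double sin_double zp
      by (simp add: power2_eq_square mult_ac)
  qed
  finally show ?thesis by simp
qed

definition mixed_pole :: "int \<Rightarrow> complex" where "mixed_pole N = (1 + \<i>) * of_real (tt N)"

lemma rho_mixed_pole: "rho * mixed_pole N = of_real (tt N)"
  by (simp add: mixed_pole_def rho_mult mult.assoc[symmetric])

lemma tt_diff: "tt (M - N) = tt M - tt N"
  unfolding tt_def of_int_diff by (rule left_diff_distrib)

lemma sin_double_zero:
  assumes "sin (2 * v) = 0" obtains N where "v = complex_of_real (tt N)"
proof -
  obtain N :: int where "2 * v = of_real (of_int N * pi)" using assms sin_eq_0[of "2 * v"] by auto
  moreover have "v = (2 * v) / 2" by simp
  ultimately have "v = of_real (of_int N * pi) / 2" by simp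
  then show ?thesis using that[of N] by (simp add: tt_def)
qed

lemma sinh_double_zero:
  assumes "sinh (2 * v) = 0" obtains N where "v = \<i> * complex_of_real (tt N)"
proof -
  have "sin (2 * (\<i> * v)) = 0" using assms by (simp add: sinh_conv_sin mult.left_commute)
  then obtain N where N: "\<i> * v = of_real (tt N)" by (rule sin_double_zero)
  then have "v = - \<i> * of_real (tt N)" by (simp add: complex_eq_iff)
  then show ?thesis using that[of "- N"] by (simp add: tt_simps)
qed

text \<open>The numerator \<open>gder * cos + gfun * sin\<close> divided by
  \<open>cos^2 - sin^2\<close> at \<open>tt N\<close>: for even \<open>N\<close> the sine vanishes
  and the divisor is 1, for odd \<open>N\<close> the cosine vanishes and the divisor is -1.\<close>

definition res_term :: "nat \<Rightarrow> int \<Rightarrow> real" where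
  "res_term p N = (if even N then gder p (tt N) * cos (tt N) else - (gfun p (tt N) * sin (tt N)))"

lemma gfun_of_real: "gfun p (complex_of_real t) = of_real (gfun p t)"
  and gder_of_real: "gder p (complex_of_real t) = of_real (gder p t)"
  by (simp_all add: gfun_def gder_def cosh_of_real' sinh_of_real')

text \<open>By \<open>mixed_fun_decomp\<close> only the quotient with the simple zero of
  \<open>sin * cos\<close> has a residue. The chain rule gives a factor
  \<open>1 / rho = 1 + \<i>\<close>, which raises the exponent \<open>p\<close> to
  \<open>p + 1\<close>.\<close>

lemma residue_mixed_fun:
  assumes N: "N > 0"
  shows "residue (mixed_fun p) (mixed_pole N) = - ((1 + \<i>) ^ (p + 1)) / 8 * of_real (res_term p N)"
proof -
  define z0 where "z0 = mixed_pole N"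
  define t where "t = tt N"
  have t: "t > 0" using N by (simp add: t_def tt_def)
  have vz0: "rho * z0 = of_real t" by (simp add: z0_def t_def rho_mixed_pole)
  define U where "U = {z. sinh (2 * (rho * z)) \<noteq> 0}"
  have "open U" unfolding U_def sinh_conv_sin
    by (intro open_Collect_neq continuous_intros)
  have U: "sinh (rho * z) \<noteq> 0" "cosh (rho * z) \<noteq> 0" if "z \<in> U" for z
    using that by (auto simp: U_def sinh_double)
  have "z0 \<in> U" using t sinh_of_real'[of "2 * t"] by (simp add: U_def vz0)
  \<comment> \<open>Radius 1 isolates the pole: the real parts of two distinct poles on the diagonal
    differ by at least \<open>pi / 2\<close>.\<close>
  define s where "s = U \<inter> ball z0 1"
  have s: "open s" "z0 \<in> s" using \<open>open U\<close> \<open>z0 \<in> U\<close> by (auto simp: s_def)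
  have sne: "sin (rho * z) \<noteq> 0" "cos (rho * z) \<noteq> 0" if "z \<in> s - {z0}" for z
  proof -
    have "sin (2 * (rho * z)) \<noteq> 0"
    proof
      assume "sin (2 * (rho * z)) = 0"
      then obtain M where M: "rho * z = of_real (tt M)" by (rule sin_double_zero)
      have "z = (1 + \<i>) * (rho * z)" by (simp add: rho_mult mult.assoc[symmetric])
      then have z: "z = (1 + \<i>) * of_real (tt M)" by (simp add: M)
      then have "M \<noteq> N" using that by (auto simp: z0_def mixed_pole_def)
      then have "\<bar>real_of_int (M - N)\<bar> \<ge> 1" by linarith
      moreover have "\<bar>tt (M - N)\<bar> \<ge> \<bar>real_of_int (M - N)\<bar>" by (rule abs_tt_ge)
      moreover have "z - z0 = (1 + \<i>) * of_real (tt (M - N))"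
        by (simp add: z z0_def mixed_pole_def tt_diff right_diff_distrib)
      then have "Re (z - z0) = tt (M - N)" by simp
      then have "cmod (z - z0) \<ge> \<bar>tt (M - N)\<bar>" by (metis abs_Re_le_cmod)
      ultimately have "cmod (z - z0) \<ge> 1" by linarith
      then show False using that by (simp add: s_def dist_norm norm_minus_commute)
    qed
    then show "sin (rho * z) \<noteq> 0" "cos (rho * z) \<noteq> 0" by (auto simp: sin_double)
  qed
  define num where "num = (\<lambda>z. gder p (rho * z) * cos (rho * z) + gfun p (rho * z) * sin (rho * z))"
  define den where "den = (\<lambda>z. sin (rho * z) * cos (rho * z))"
  define dG where "dG = (\<lambda>z. gder p (rho * z) / sin (rho * z) - gfun p (rho * z) * cos (rho * z) / sin (rho * z) ^ 2)"
  define kap where "kap = - ((1 + \<i>) ^ p) / 8"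
  have num: "num holomorphic_on s"
    unfolding num_def gder_def gfun_def by (intro holomorphic_intros) (use U in \<open>auto simp: s_def\<close>)
  have den: "den holomorphic_on s" unfolding den_def by (intro holomorphic_intros)
  have quot: "(\<lambda>z. num z / den z) holomorphic_on s - {z0}"
    by (intro holomorphic_intros holomorphic_on_subset[OF num] holomorphic_on_subset[OF den])
       (use sne in \<open>auto simp: den_def\<close>)
  have der: "((\<lambda>z. (1 + \<i>) * (gfun p (rho * z) / sin (rho * z))) has_field_derivative dG w) (at w)"
    if w: "w \<in> s - {z0}" for w
  proof -
    let ?q = "(gder p (rho * w) * sin (rho * w) - gfun p (rho * w) * cos (rho * w)) / (sin (rho * w) * sin (rho * w))"
    have nz: "sinh (rho * w) \<noteq> 0" "cosh (rho * w) \<noteq> 0" "sin (rho * w) \<noteq> 0"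
      using w U sne by (auto simp: s_def)
    have "((\<lambda>v. gfun p v / sin v) has_field_derivative
        ?q) (at (rho * w))"
      by (rule DERIV_divide[OF gfun_deriv[OF nz(1,2)] DERIV_sin nz(3)])
    moreover have "((*) rho has_field_derivative rho) (at w)"
      by (auto intro!: derivative_eq_intros)
    ultimately have "((\<lambda>z. gfun p (rho * z) / sin (rho * z)) has_field_derivative
        ?q * rho) (at w)"
      by (rule DERIV_chain2)
    then have "((\<lambda>z. (1 + \<i>) * (gfun p (rho * z) / sin (rho * z))) has_field_derivative (1 + \<i>) *
        (?q * rho)) (at w)"
      by (rule DERIV_cmult)
    moreover have "(1 + \<i>) *
        (?q * rho) =
        ((1 + \<i>) * rho) * dG w"
      unfolding dG_def using nz by (simp add: diff_divide_distrib power2_eq_square)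
    ultimately show ?thesis by (simp add: rho_mult)
  qed
  note rd = residue_derivative[OF s der]
  have "residue (mixed_fun p) z0 = residue (\<lambda>z. kap * (num z / den z - dG z)) z0"
  proof (rule residue_cong)
    have "eventually (\<lambda>z. z \<in> s - {z0}) (at z0)"
      using s by (auto simp: eventually_at_topological)
    then show "\<forall>\<^sub>F z in at z0. mixed_fun p z = kap * (num z / den z - dG z)"
    proof (rule eventually_mono)
      fix z assume z: "z \<in> s - {z0}"
      then have "z \<in> U" by (auto simp: s_def)
      show "mixed_fun p z = kap * (num z / den z - dG z)"
        unfolding kap_def num_def den_def dG_def
        by (rule mixed_fun_decomp) (use U[OF \<open>z \<in> U\<close>] sne[OF z] in auto)
    qed
  qed simp
  also have "\<dots> = kap * (residue (\<lambda>z. num z / den z) z0 - residue dG z0)"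
  proof -
    have "(\<lambda>z. num z / den z - dG z) holomorphic_on s - {z0}"
      by (rule holomorphic_on_diff[OF quot rd(1)])
    then have "residue (\<lambda>z. kap * (num z / den z - dG z)) z0 = kap * residue (\<lambda>z. num z / den z - dG z) z0"
      by (rule residue_lmul[OF s])
    moreover have "residue (\<lambda>z. num z / den z - dG z) z0 = residue (\<lambda>z. num z / den z) z0 - residue dG z0"
      by (rule residue_diff[OF s quot rd(1)])
    ultimately show ?thesis by simp
  qed
  also have "residue dG z0 = 0" by (rule rd(2))
  also have "residue (\<lambda>z. num z / den z) z0 = num z0 / (rho * of_real (cos t ^ 2 - sin t ^ 2))"
  proof (rule residue_simple_pole_quotient[OF num den s])
    show "(den has_field_derivative rho * of_real (cos t ^ 2 - sin t ^ 2)) (at z0)"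
      unfolding den_def by (auto intro!: derivative_eq_intros simp: vz0 sin_of_real cos_of_real power2_eq_square algebra_simps)
    show "den z0 = 0" unfolding den_def vz0
      using sin_even_tt[of N] cos_odd_tt[of N] by (cases "even N") (simp_all add: sin_of_real cos_of_real t_def)
    have "cos t ^ 2 - sin t ^ 2 \<noteq> 0"
      using sin_even_tt[of N] cos_odd_tt[of N] sin_cos_squared_add[of t] by (cases "even N") (auto simp: t_def)
    then show "rho * of_real (cos t ^ 2 - sin t ^ 2) \<noteq> 0" by (simp add: rho_nonzero del: of_real_diff)
  qed
  also have "num z0 = of_real (gder p t * cos t + gfun p t * sin t)"
    by (simp add: num_def vz0 gfun_of_real gder_of_real sin_of_real cos_of_real)
  also have "of_real (gder p t * cos t + gfun p t * sin t) / (rho * of_real (cos t ^ 2 - sin t ^ 2)) =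
      (1 + \<i>) * complex_of_real (res_term p N)"
  proof -
    have "1 / rho = 1 + \<i>" using rho_nonzero rho_mult by (simp add: divide_eq_eq)
    moreover have "(gder p t * cos t + gfun p t * sin t) / (cos t ^ 2 - sin t ^ 2) = res_term p N"
      using sin_even_tt[of N] cos_odd_tt[of N] sin_cos_squared_add[of t]
      by (cases "even N") (auto simp: t_def res_term_def)
    then have "complex_of_real (gder p t * cos t + gfun p t * sin t) / of_real (cos t ^ 2 - sin t ^ 2) =
        of_real (res_term p N)" by (metis of_real_divide)
    ultimately show ?thesis by (metis (no_types, lifting) divide_divide_eq_left mult.commute mult_1 times_divide_eq_left)
  qed
  finally show ?thesis by (simp add: z0_def kap_def mult_ac)
qed

section \<open>The integral as a sum of residues\<close>

text \<open>The zeros lie on the two diagonals. On \<open>Re z = - Im z\<close> the lower bounds -1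
  leave only the origin; on \<open>Re z = Im z\<close> they exclude the negative indices.\<close>

lemma mixed_fun_zeros:
  assumes "(cosh (2 * z) - cos (2 * z)) * (cosh z - cos z) = 0" and z: "Re z > -1" "Im z > -1"
  shows "z = 0 \<or> (\<exists>N>0. z = mixed_pole N)"
proof -
  have "sinh (2 * (rho * z)) = 0 \<or> sin (2 * (rho * z)) = 0"
  proof -
    have two: "rho * (2 * z) = 2 * (rho * z)" by simp
    show ?thesis using assms(1) unfolding cosh_minus_cos_rho[of z] cosh_minus_cos_rho[of "2 * z"] two
      by (auto simp: sinh_double sin_double)
  qed
  then show ?thesis
  proof
    assume "sinh (2 * (rho * z)) = 0"
    then obtain N where "rho * z = \<i> * of_real (tt N)" by (rule sinh_double_zero)
    then have "(1 + \<i>) * (rho * z) = (1 + \<i>) * (\<i> * of_real (tt N))" by simp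
    then have zN: "z = (1 + \<i>) * (\<i> * of_real (tt N))" by (simp add: rho_mult mult.assoc[symmetric])
    then have "Re z = - tt N" "Im z = tt N" by simp_all
    with z have "\<bar>tt N\<bar> < 1" by linarith
    then have "\<bar>real_of_int N\<bar> < 1" using abs_tt_ge[of N] by linarith
    then have "N = 0" by linarith
    then show ?thesis using zN by (simp add: tt_simps)
  next
    assume "sin (2 * (rho * z)) = 0"
    then obtain N where "rho * z = of_real (tt N)" by (rule sin_double_zero)
    then have "(1 + \<i>) * (rho * z) = (1 + \<i>) * of_real (tt N)" by simp
    then have zN: "z = mixed_pole N" by (simp add: rho_mult mult.assoc[symmetric] mixed_pole_def)
    then have "Re z = tt N" by (simp add: mixed_pole_def)
    with z have "tt N > -1" by simp
    have "N \<ge> 0"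
    proof (rule ccontr)
      assume "\<not> N \<ge> 0"
      then have "real_of_int N \<le> -1" "\<bar>tt N\<bar> = - tt N" by (auto simp: tt_def mult_less_0_iff abs_if)
      with abs_tt_ge[of N] \<open>tt N > -1\<close> show False by linarith
    qed
    then consider "N = 0" | "N > 0" by linarith
    then show ?thesis
    proof cases
      case 1
      then show ?thesis using zN by (simp add: mixed_pole_def tt_simps)
    qed (use zN in blast)
  qed
qed

lemma tendsto_sin_over: "((\<lambda>z. sin (c * z) / z) \<longlongrightarrow> c) (at (0::complex))"
proof -
  have "((\<lambda>z. sin (c * z)) has_field_derivative c) (at 0)"
    by (auto intro!: derivative_eq_intros)
  then show ?thesis by (simp add: has_field_derivative_iff)
qed

lemma tendsto_sinh_over: "((\<lambda>z. sinh (c * z) / z) \<longlongrightarrow> c) (at (0::complex))"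
proof -
  have "((\<lambda>z. sinh (c * z)) has_field_derivative c) (at 0)"
    by (auto intro!: derivative_eq_intros)
  then show ?thesis by (simp add: has_field_derivative_iff)
qed

text \<open>Four factors vanish simply at the origin, and \<open>p >= 5\<close> overcomes them. The
  limit agrees with the value 0 that division by zero assigns there, so the singularity is removable
  without changing the function.\<close>

lemma mixed_fun_tendsto_0:
  assumes "p \<ge> 5" shows "(mixed_fun p \<longlongrightarrow> 0) (at 0)"
proof -
  let ?F = "\<lambda>z. - (z ^ (p - 4) / (4 * ((sinh (rho * z) / z) * (sinh (2 * rho * z) / z) * (sin (rho * z) / z) * (sin (2 * rho * z) / z))))"
  have l1: "((\<lambda>z. ?F z)
     \<longlongrightarrow> - (0 ^ (p - 4) / (4 * (rho * (2 * rho) * rho * (2 * rho))))) (at 0)"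
    by (intro tendsto_intros tendsto_sin_over tendsto_sinh_over) (simp add: rho_nonzero)
  have l2: "- (0 ^ (p - 4) / (4 * (rho * (2 * rho) * rho * (2 * rho)))) = (0 :: complex)"
    using assms by simp
  have l3: "eventually (\<lambda>z. ?F z
     = mixed_fun p z) (at 0)"
    unfolding eventually_at_filter
  proof (rule always_eventually, intro allI impI)
    fix z :: complex assume z: "z \<noteq> 0"
    have "z ^ p = z ^ (p - 4) * (z * z * z * z)"
      using assms by (simp add: power_add[symmetric] power4_eq_xxxx[symmetric] mult.assoc[symmetric])
    then show "?F z
     = mixed_fun p z" using z unfolding mixed_fun_rho by (simp add: mult_ac)
  qed
  show ?thesis by (rule Lim_transform_eventually[OF l1[unfolded l2] l3])
qed

lemma mixed_fun_0: "mixed_fun p 0 = 0" by (simp add: mixed_fun_def)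

lemma abs_sin_add_le: "\<bar>sin (a + b)\<bar> \<le> \<bar>sin a\<bar> + \<bar>sin (b::real)\<bar>"
  and abs_cos_add_le: "\<bar>cos (a + b)\<bar> \<le> \<bar>cos a\<bar> + \<bar>sin (b::real)\<bar>"
proof -
  have "\<bar>sin a * cos b\<bar> \<le> \<bar>sin a\<bar>" "\<bar>cos a * sin b\<bar> \<le> \<bar>sin b\<bar>" "\<bar>cos a * cos b\<bar> \<le> \<bar>cos a\<bar>" "\<bar>sin a * sin b\<bar> \<le> \<bar>sin b\<bar>"
    by (auto simp: abs_mult mult_left_le mult_left_le_one_le)
  then show "\<bar>sin (a + b)\<bar> \<le> \<bar>sin a\<bar> + \<bar>sin b\<bar>" "\<bar>cos (a + b)\<bar> \<le> \<bar>cos a\<bar> + \<bar>sin b\<bar>"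
    unfolding sin_add cos_add by linarith+
qed

lemma abs_sin_le_sinh: "\<bar>sin x\<bar> \<le> \<bar>sinh (x::real)\<bar>"
proof -
  have "\<bar>sin x\<bar> \<le> \<bar>x\<bar>" by (rule abs_sin_x_le_abs_x)
  also have "\<bar>x\<bar> \<le> sinh \<bar>x\<bar>"
  proof -
    have "(\<lambda>x. sinh x - x) 0 \<le> (\<lambda>x. sinh x - x) \<bar>x\<bar>"
      by (rule DERIV_nonneg_imp_nondecreasing[of 0 "\<bar>x\<bar>" "\<lambda>x. sinh x - x"])
         (auto intro!: exI derivative_eq_intros cosh_real_ge_1)
    then show ?thesis by simp
  qed
  finally show ?thesis by simp
qed

text \<open>On the two far edges \<open>a = Re (rho * z)\<close> and
  \<open>b = \<bar>Im (rho * z)\<bar>\<close> satisfy \<open>a + b = R\<close> and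
  \<open>a >= R / 2\<close>. The latter makes both \<open>sinh\<close> factors large. For the
  others, \<open>\<bar>sin R\<bar> <= \<bar>sin a\<bar> + \<bar>sinh b\<bar>\<close>, where both
  summands are at most \<open>cmod (sin (rho * z))\<close>; since \<open>R\<close> is an odd
  multiple of \<open>pi / 4\<close>, the left side is \<open>sqrt 2 / 2\<close>. The same works for
  \<open>cos\<close>, which gives the lower bounds \<open>1 / 4\<close>.\<close>

lemma mixed_fun_edge_bound:
  fixes n :: nat
  defines "R \<equiv> n * pi + pi / 4"
  assumes z: "Re z = R \<or> Im z = R" "0 \<le> Re z" "Re z \<le> R" "0 \<le> Im z" "Im z \<le> R"
  shows "cmod (mixed_fun p z) \<le> 8 * (2 * R) ^ p / sinh (R / 2) ^ 2"
proof -
  let ?c = "cos (rho * z)"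
  let ?s = "sin (rho * z)"
  let ?d = "(sinh (rho * z) * sinh (2 * (rho * z)) * ?s * sin (2 * (rho * z)))"
  have R: "R > 0" by (simp add: R_def add_nonneg_pos)
  define a b where "a = (Re z + Im z) / 2" and "b = \<bar>(Im z - Re z) / 2\<bar>"
  have Re: "Re (rho * z) = a" and Im: "Im (rho * z) = (Im z - Re z) / 2"
    by (simp_all add: rho_def a_def field_simps)
  have ab: "a + b = R" "a \<ge> R / 2" using z by (auto simp: a_def b_def abs_if field_simps)
  have b2: "sinh (Im (rho * z)) ^ 2 = sinh b ^ 2"
    unfolding Im b_def by (auto simp: abs_if)
  have half: "\<bar>x\<bar> \<le> cmod w" if "cmod w ^ 2 = x ^ 2 + y ^ 2" for x y :: real and w
    using that abs_le_square_iff[of x "cmod w"] by simp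
  have sr: "\<bar>sin R\<bar> = sqrt 2 / 2" "\<bar>cos R\<bar> = sqrt 2 / 2"
    by (simp_all add: R_def sin_add cos_add sin_45 cos_45 abs_mult power_abs)
  have s1: "1 \<le> sqrt 2" by simp
  have "\<bar>sin R\<bar> \<le> \<bar>sin a\<bar> + \<bar>sinh b\<bar>"
    using abs_sin_add_le[of a b] abs_sin_le_sinh[of b] ab by simp
  moreover have "\<bar>sin a\<bar> \<le> cmod (?s)" "\<bar>sinh b\<bar> \<le> cmod (?s)"
    using half[of "?s" "sin a" "sinh b"] half[of "?s" "sinh b" "sin a"]
    cmod_sin_sq[of "rho * z"] unfolding Re b2 by (auto simp: add.commute)
  ultimately have sin: "cmod (?s) \<ge> 1 / 4" using sr s1 by linarith
  have "\<bar>cos R\<bar> \<le> \<bar>cos a\<bar> + \<bar>sinh b\<bar>"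
    using abs_cos_add_le[of a b] abs_sin_le_sinh[of b] ab by simp
  moreover have "\<bar>cos a\<bar> \<le> cmod (?c)" "\<bar>sinh b\<bar> \<le> cmod (?c)"
    using half[of "?c" "cos a" "sinh b"] half[of "?c" "sinh b" "cos a"]
    cmod_cos_sq[of "rho * z"] unfolding Re b2 by (auto simp: add.commute)
  ultimately have cos: "cmod (?c) \<ge> 1 / 4" using sr s1 by linarith
  have sinh: "cmod (sinh w) \<ge> sinh (R / 2)" if "Re w \<ge> R / 2" for w
  proof -
    have "sinh (R / 2) \<le> sinh (Re w)" using that by simp
    also have "\<dots> \<le> \<bar>sinh (Re w)\<bar>" by simp
    also have "\<dots> \<le> cmod (sinh w)"
      using half[of "sinh w" "sinh (Re w)" "sin (Im w)"] cmod_sinh_sq[of w] by simp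
    finally show ?thesis .
  qed
  have sh: "sinh (R / 2) > 0" using R by simp
  have "sinh (R / 2) * sinh (R / 2) * (1/4) * (2 * (1/4) * (1/4)) \<le>
      cmod (sinh (rho * z)) * cmod (sinh (2 * (rho * z))) * cmod (?s) * (2 * cmod (?s) * cmod (?c))"
    using sin cos sinh[of "rho * z"] sinh[of "2 * (rho * z)"] ab R sh Re by (intro mult_mono mult_nonneg_nonneg) auto
  also have "\<dots> = cmod ?d"
    by (simp add: sin_double norm_mult)
  finally have den: "sinh (R / 2) ^ 2 / 32 \<le> cmod ?d"
    by (simp add: power2_eq_square)
  have "cmod z \<le> 2 * R" using cmod_le[of z] z by simp
  then have "cmod z ^ p \<le> (2 * R) ^ p" by (intro power_mono) auto
  then have "cmod z ^ p / (4 * cmod ?d)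
     \<le> (2 * R) ^ p / (4 * (sinh (R / 2) ^ 2 / 32))"
    using den sh R by (intro frac_le) auto
  moreover have "cmod (mixed_fun p z) = cmod z ^ p / (4 * cmod ?d)"
    unfolding mixed_fun_rho by (simp add: norm_divide norm_mult norm_power)
  ultimately show ?thesis by (simp add: mult.commute)
qed

lemma mixed_contour:
  fixes n :: nat
  defines "R \<equiv> n * pi + pi / 4"
  assumes p: "p \<ge> 5"
  shows "contour_integral (rectpath 0 (Complex R R)) (mixed_fun p) =
     2 * pi * \<i> * (- ((1 + \<i>) ^ (p + 1)) / 8 * of_real (\<Sum>N=1..2 * int n. res_term p N))"
    and "continuous_on (path_image (rectpath 0 (Complex R R))) (mixed_fun p)"
proof -
  let ?r = "rectpath 0 (Complex R R)"
  have R: "R > 0" by (simp add: R_def add_nonneg_pos)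
  \<comment> \<open>The box reaches below the axes, so that the corner 0 of the contour is interior,
    and beyond \<open>R\<close> only by \<open>pi / 8\<close>, short of the next pole, whose real
    part is \<open>n * pi + pi / 2\<close>.\<close>
  define S where "S = box (Complex (-1) (-1)) (Complex (R + pi / 8) (R + pi / 8))"
  define P where "P = mixed_pole ` {1..2 * int n}"
  have inside: "mixed_pole N \<in> box 0 (Complex R R)" if "N \<in> {1..2 * int n}" for N
  proof -
    have "tt N > 0" using that by (simp add: tt_def)
    moreover have "real_of_int N \<le> real_of_int (2 * int n)" using that unfolding of_int_le_iff by auto
    then have "tt N \<le> 2 * n * (pi / 2)" unfolding tt_def by (intro mult_right_mono) auto
    then have "tt N \<le> n * pi" by simp
    then have "tt N < R" unfolding R_def using pi_gt_zero by linarith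
    ultimately show ?thesis by (simp add: in_box_complex_iff mixed_pole_def)
  qed
  have zeros: "z = 0 \<or> z \<in> P"
    if z: "z \<in> S" and zero: "(cosh (2 * z) - cos (2 * z)) * (cosh z - cos z) = 0" for z
  proof -
    have "Re z > -1" "Im z > -1" "Re z < R + pi / 8" using z by (auto simp: S_def in_box_complex_iff)
    from mixed_fun_zeros[OF zero this(1,2)] show ?thesis
    proof
      assume "\<exists>N>0. z = mixed_pole N"
      then obtain N where N: "N > 0" "z = mixed_pole N" by auto
      then have "Re z = tt N" by (simp add: mixed_pole_def)
      with \<open>Re z < _\<close> have "of_int N * (pi / 2) < (2 * n + 3 / 4) * (pi / 2)"
        by (simp add: R_def tt_def distrib_right)
      then have "real_of_int N < 2 * n + 3 / 4" using mult_less_cancel_right_pos[of "pi / 2"] pi_gt_zero by simp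
      then have "N \<le> 2 * int n" by linarith
      then show ?thesis using N by (auto simp: P_def)
    qed simp
  qed
  have R8: "R < R + pi / 8" "0 < R + pi / 8" using R pi_gt_zero by linarith+
  have S: "open S" "connected S" by (auto simp: S_def intro: convex_connected)
  have "finite P" by (simp add: P_def)
  have P0: "0 \<notin> P"
  proof
    assume "0 \<in> P"
    then obtain N where "N \<in> {1..2 * int n}" "mixed_pole N = 0" by (auto simp: P_def)
    then show False using inside[of N] by (simp add: in_box_complex_iff)
  qed
  have holo: "mixed_fun p holomorphic_on S - P"
  proof (rule no_isolated_singularity'[where K="{0}"])
    show "(mixed_fun p \<longlongrightarrow> mixed_fun p z) (at z within S - P)" if "z \<in> {0}" for z
      using mixed_fun_tendsto_0[OF p] that by (auto simp: mixed_fun_0 intro: tendsto_within_subset)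
    show "mixed_fun p holomorphic_on S - P - {0}"
      unfolding mixed_fun_def[abs_def] by (intro holomorphic_intros) (use zeros in auto)
    show "open (S - P)" using S(1) \<open>finite P\<close> by (simp add: finite_imp_closed open_Diff)
  qed auto
  have le: "Re 0 \<le> Re (Complex R R)" "Im 0 \<le> Im (Complex R R)" using R by auto
  have cb: "cbox 0 (Complex R R) \<subseteq> S"
  proof
    fix z assume "z \<in> cbox 0 (Complex R R)"
    then show "z \<in> S" using R8 unfolding S_def in_box_complex_iff in_cbox_complex_iff complex.sel
        greaterThanLessThan_iff atLeastAtMost_iff zero_complex.sel by linarith
  qed
  have img: "path_image (?r) \<subseteq> S - P"
    using inside cb unfolding path_image_rectpath_cbox_minus_box[OF le] P_def by blast
  show "continuous_on (path_image (?r)) (mixed_fun p)"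
    by (rule holomorphic_on_imp_continuous_on[OF holomorphic_on_subset[OF holo img]])
  have "contour_integral (?r) (mixed_fun p) =
     2 * pi * \<i> * (\<Sum>z\<in>P. winding_number (?r) z * residue (mixed_fun p) z)"
  proof (rule Residue_theorem[OF S(1,2) \<open>finite P\<close> holo _ _ img])
    show "\<forall>z. z \<notin> S \<longrightarrow> winding_number (?r) z = 0"
      using cb winding_number_rectpath_outside[OF le] by blast
  qed auto
  also have "(\<Sum>z\<in>P. winding_number (?r) z * residue (mixed_fun p) z) =
     (\<Sum>N=1..2 * int n. residue (mixed_fun p) (mixed_pole N))"
    unfolding P_def
  proof (subst sum.reindex)
    show "inj_on mixed_pole {1..2 * int n}"
      by (rule inj_onI) (auto simp: mixed_pole_def tt_def complex_eq_iff)
  qed (auto simp: winding_number_rectpath inside)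
  also have "\<dots> = (\<Sum>N=1..2 * int n. - ((1 + \<i>) ^ (p + 1)) / 8 * of_real (res_term p N))"
    by (rule sum.cong) (auto simp: residue_mixed_fun)
  finally show "contour_integral (?r) (mixed_fun p) =
     2 * pi * \<i> * (- ((1 + \<i>) ^ (p + 1)) / 8 * of_real (\<Sum>N=1..2 * int n. res_term p N))"
    by (simp only: sum_distrib_left of_real_sum)
qed

definition mixed_real :: "nat \<Rightarrow> real \<Rightarrow> real" where
  "mixed_real p x = x ^ p / ((cosh (2 * x) - cos (2 * x)) * (cosh x - cos x))"

lemma mixed_fun_of_real: "mixed_fun p (of_real x) = of_real (mixed_real p x)"
proof -
  have "2 * complex_of_real x = of_real (2 * x)" by simp
  then show ?thesis unfolding mixed_fun_def mixed_real_def cosh_of_real' cos_of_real by (simp only: cosh_of_real' cos_of_real) simp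
qed

lemma mixed_fun_imaginary: "mixed_fun p (\<i> * of_real x) = \<i> ^ p * of_real (mixed_real p x)"
proof -
  have "2 * (\<i> * complex_of_real x) = \<i> * of_real (2 * x)" by simp
  moreover have "cos (\<i> * complex_of_real y) = of_real (cosh y)" for y
    using cosh_of_real'[of y] by (simp add: cosh_conv_cos)
  ultimately have "mixed_fun p (\<i> * of_real x) = (\<i> * of_real x) ^ p / ((of_real (cos (2 * x)) - of_real (cosh (2 * x))) * (of_real (cos x) - of_real (cosh x)))"
    unfolding mixed_fun_def by (simp only: cosh_ii_tt)
  also have "\<dots> = \<i> ^ p * of_real (x ^ p / ((cos (2 * x) - cosh (2 * x)) * (cos x - cosh x)))"
    by (simp add: power_mult_distrib)
  also have "(cos (2 * x) - cosh (2 * x)) * (cos x - cosh x) = (cosh (2 * x) - cos (2 * x)) * (cosh x - cos x)"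
    by (simp add: algebra_simps)
  finally show ?thesis by (simp add: mixed_real_def)
qed

lemma mixed_contour_edges:
  fixes n :: nat
  defines "R \<equiv> n * pi + pi / 4"
  assumes p: "p \<ge> 5" "p mod 4 = 1"
  shows "(mixed_real p has_integral integral {0..R} (mixed_real p)) {0..R}"
    and "cmod (contour_integral (rectpath 0 (Complex R R)) (mixed_fun p) - 2 * of_real (integral {0..R} (mixed_real p)))
      \<le> 16 * R * (2 * R) ^ p / sinh (R / 2) ^ 2"
proof -
  let ?f = "mixed_fun p"
  let ?I = "integral {0..R} (mixed_real p)"
  let ?r = "rectpath 0 (Complex R R)"
  have R: "R > 0" by (simp add: R_def add_nonneg_pos)
  define a2 b a4 where "a2 = Complex R 0" and "b = Complex R R" and "a4 = Complex 0 R"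
  have rp: "?r = linepath 0 a2 +++ linepath a2 b +++ linepath b a4 +++ linepath a4 0"
    by (simp add: rectpath_def Let_def a2_def a4_def b_def)
  have im: "path_image (?r) = closed_segment 0 a2 \<union> closed_segment a2 b \<union> closed_segment b a4 \<union> closed_segment a4 0"
    unfolding rp by (simp add: path_image_join Un_assoc)
  note cont = mixed_contour(2)[OF p(1), of n, folded R_def]
  have int: "?f contour_integrable_on linepath u v" if "closed_segment u v \<subseteq> path_image (?r)" for u v
    by (rule contour_integrable_continuous_linepath) (rule continuous_on_subset[OF cont that])
  have sub: "closed_segment 0 a2 \<subseteq> path_image (?r)" "closed_segment a2 b \<subseteq> path_image (?r)"
    "closed_segment b a4 \<subseteq> path_image (?r)" "closed_segment a4 0 \<subseteq> path_image (?r)"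
    unfolding im by auto
  have cont_real: "continuous_on {0..R} (mixed_real p)"
  proof -
    have "of_real ` {0..R} \<subseteq> closed_segment 0 a2"
      using R by (auto simp: a2_def closed_segment_def complex_eq_iff intro!: exI[of _ "_ / R"])
    then have "continuous_on (of_real ` {0..R}) (?f)" using cont sub(1) by (blast intro: continuous_on_subset)
    then have "continuous_on {0..R} (\<lambda>x. ?f (of_real x))"
      by (rule continuous_on_compose2) (auto intro: continuous_on_of_real continuous_on_id)
    then have "continuous_on {0..R} (\<lambda>x. Re (?f (of_real x)))"
      by (rule continuous_on_Re)
    then show ?thesis by (simp add: mixed_fun_of_real)
  qed
  then show hi: "(mixed_real p has_integral ?I) {0..R}"
    by (intro integrable_integral integrable_continuous_real)
  have hic: "((\<lambda>x. complex_of_real (mixed_real p x)) has_integral of_real (?I)) {0..R}"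
    using hi by (rule has_integral_of_real)
  have bottom: "contour_integral (linepath 0 a2) (?f) = of_real (?I)"
    using R hic by (subst contour_integral_linepath_Reals_eq)
      (auto simp: a2_def mixed_fun_of_real complex_is_Real_iff intro: integral_unique)
  have "contour_integral (linepath 0 a4) (?f) = \<i> * integral {0..R} (\<lambda>x. ?f (Complex 0 x))"
    by (rule contour_integral_linepath_same_Re) (use R in \<open>auto simp: a4_def\<close>)
  also have "(\<lambda>x. ?f (Complex 0 x)) = (\<lambda>x. \<i> ^ p * of_real (mixed_real p x))"
  proof
    fix x
    have "Complex 0 x = \<i> * of_real x" by (simp add: complex_eq_iff)
    then show "?f (Complex 0 x) = \<i> ^ p * of_real (mixed_real p x)" by (simp only: mixed_fun_imaginary)
  qed
  also have "integral {0..R} (\<lambda>x. \<i> ^ p * of_real (mixed_real p x)) = \<i> ^ p * of_real (?I)"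
    using hic by (intro integral_unique has_integral_mult_right)
  also have "\<i> ^ p = \<i>"
  proof -
    have "p = 4 * (p div 4) + 1" using p(2) mult_div_mod_eq[of 4 p] by simp
    then have "\<i> ^ p = (\<i> ^ 4) ^ (p div 4) * \<i>" by (metis power_add power_mult power_one_right)
    then show ?thesis by simp
  qed
  also have "\<i> * (\<i> * complex_of_real (?I)) = - of_real (?I)"
    by (simp add: mult.assoc[symmetric])
  finally have l1: "contour_integral (linepath 0 a4) (?f) = - of_real (?I)" .
  have l2: "contour_integral (linepath a4 0) (?f) = - contour_integral (linepath 0 a4) (?f)"
    by (rule contour_integral_reverse_linepath) (rule continuous_on_subset[OF cont sub(4)])
  have left: "contour_integral (linepath a4 0) (?f) = of_real (?I)"
    unfolding l2 l1 by (rule minus_minus)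
  define B where "B = 8 * (2 * R) ^ p / sinh (R / 2) ^ 2"
  have B: "B \<ge> 0" using R by (simp add: B_def)
  have seg: "closed_segment a2 b = {z. Re z = R \<and> 0 \<le> Im z \<and> Im z \<le> R}"
    "closed_segment b a4 = {z. Im z = R \<and> 0 \<le> Re z \<and> Re z \<le> R}"
    using R by (auto simp: a2_def b_def a4_def closed_segment_same_Re closed_segment_same_Im closed_segment_eq_real_ivl)
  have "cmod (contour_integral (linepath a2 b) (?f)) \<le> B * cmod (b - a2)"
    by (rule contour_integral_bound_linepath[OF int[OF sub(2)] B])
       (use mixed_fun_edge_bound[of _ n p] R in \<open>auto simp: B_def R_def seg\<close>)
  moreover have "cmod (contour_integral (linepath b a4) (?f)) \<le> B * cmod (a4 - b)"
    by (rule contour_integral_bound_linepath[OF int[OF sub(3)] B])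
       (use mixed_fun_edge_bound[of _ n p] R in \<open>auto simp: B_def R_def seg\<close>)
  moreover have "cmod (b - a2) = R" "cmod (a4 - b) = R" using R by (simp_all add: b_def a2_def a4_def cmod_def)
  moreover have "contour_integral (?r) (?f) - 2 * of_real (?I) =
      contour_integral (linepath a2 b) (?f) + contour_integral (linepath b a4) (?f)"
    unfolding rp by (simp add: int sub bottom left)
  ultimately have "cmod (contour_integral (?r) (?f) - 2 * of_real (?I)) \<le> B * R + B * R"
    by (metis norm_triangle_mono)
  then show "cmod (contour_integral (?r) (?f) - 2 * of_real (?I))
      \<le> 16 * R * (2 * R) ^ p / sinh (R / 2) ^ 2" by (simp add: B_def mult_ac)
qed

section \<open>Power series with rational lemniscatic coefficients\<close>

text \<open>The weight \<open>w\<close> records homogeneity in \<open>l\<close>; for \<open>M = 4\<close> the residue \<open>r\<close> records the behaviour under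
  \<open>X \<mapsto> \<i> X\<close>.\<close>

definition graded_upto :: "complex \<Rightarrow> nat \<Rightarrow> nat \<Rightarrow> nat \<Rightarrow> nat \<Rightarrow> complex fps \<Rightarrow> bool" where
  "graded_upto l M w r n f \<longleftrightarrow> (\<forall>k\<le>n. (\<exists>q\<in>\<rat>. fps_nth f k = q * l ^ (w + k)) \<and>
     (k mod M \<noteq> r mod M \<longrightarrow> fps_nth f k = 0))"

definition graded :: "complex \<Rightarrow> nat \<Rightarrow> nat \<Rightarrow> nat \<Rightarrow> complex fps \<Rightarrow> bool" where
  "graded l M w r f \<longleftrightarrow> (\<forall>n. graded_upto l M w r n f)"

lemma gradedD: "graded l M w r f \<Longrightarrow> \<exists>q\<in>\<rat>. fps_nth f k = q * l ^ (w + k)"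
  and gradedD_zero: "graded l M w r f \<Longrightarrow> k mod M \<noteq> r mod M \<Longrightarrow> fps_nth f k = 0"
  unfolding graded_def graded_upto_def by blast+

lemma gradedI:
  "(\<And>k. \<exists>q\<in>\<rat>. fps_nth f k = q * l ^ (w + k)) \<Longrightarrow>
   (\<And>k. k mod M \<noteq> r mod M \<Longrightarrow> fps_nth f k = 0) \<Longrightarrow> graded l M w r f"
  unfolding graded_def graded_upto_def by blast

lemma graded_upto_mono: "graded_upto l M w r n f \<Longrightarrow> m \<le> n \<Longrightarrow> graded_upto l M w r m f"
  unfolding graded_upto_def by auto

lemma graded_upto_mult:
  assumes f: "graded_upto l M w r n f" and g: "graded_upto l M w' r' n g"
  shows "graded_upto l M (w + w') (r + r') n (f * g)"
  unfolding graded_upto_def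
proof (intro allI impI conjI)
  fix k assume k: "k \<le> n"
  from f k have "\<forall>i\<in>{0..k}. \<exists>q\<in>\<rat>. fps_nth f i = q * l ^ (w + i)"
    unfolding graded_upto_def by auto
  then obtain p where p: "\<And>i. i \<in> {0..k} \<Longrightarrow> p i \<in> \<rat> \<and> fps_nth f i = p i * l ^ (w + i)" by metis
  from g k have "\<forall>i\<in>{0..k}. \<exists>q\<in>\<rat>. fps_nth g i = q * l ^ (w' + i)"
    unfolding graded_upto_def by auto
  then obtain q where q: "\<And>i. i \<in> {0..k} \<Longrightarrow> q i \<in> \<rat> \<and> fps_nth g i = q i * l ^ (w' + i)" by metis
  have "fps_nth (f * g) k = (\<Sum>i=0..k. p i * q (k - i) * l ^ (w + w' + k))"
    unfolding fps_mult_nth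
  proof (rule sum.cong)
    fix i assume i: "i \<in> {0..k}"
    then have "k - i \<in> {0..k}" by auto
    from p[OF i] q[OF this] have "fps_nth f i * fps_nth g (k - i) =
      (p i * l ^ (w + i)) * (q (k - i) * l ^ (w' + (k - i)))" by simp
    also have "\<dots> = p i * q (k - i) * l ^ ((w + i) + (w' + (k - i)))"
      by (simp add: power_add mult_ac)
    also have "(w + i) + (w' + (k - i)) = w + w' + k" using i by auto
    finally show "fps_nth f i * fps_nth g (k - i) = p i * q (k - i) * l ^ (w + w' + k)" .
  qed simp
  also have "\<dots> = (\<Sum>i=0..k. p i * q (k - i)) * l ^ (w + w' + k)"
    by (simp add: sum_distrib_right)
  moreover have "(\<Sum>i=0..k. p i * q (k - i)) \<in> \<rat>"
  proof (rule Rats_sum, rule Rats_mult)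
    fix i assume "i \<in> {0..k}"
    then show "p i \<in> \<rat>" "q (k - i) \<in> \<rat>" using p[of i] q[of "k - i"] by auto
  qed
  ultimately show "\<exists>q\<in>\<rat>. fps_nth (f * g) k = q * l ^ (w + w' + k)" by auto
  assume ne: "k mod M \<noteq> (r + r') mod M"
  show "fps_nth (f * g) k = 0"
    unfolding fps_mult_nth
  proof (rule sum.neutral, intro ballI)
    fix i assume i: "i \<in> {0..k}"
    have "i mod M \<noteq> r mod M \<or> (k - i) mod M \<noteq> r' mod M"
    proof (rule ccontr)
      assume "\<not> ?thesis"
      then have "(i + (k - i)) mod M = (r + r') mod M" by (metis mod_add_eq)
      with ne i show False by simp
    qed
    then show "fps_nth f i * fps_nth g (k - i) = 0"
      using f g k i unfolding graded_upto_def by auto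
  qed
qed

lemma graded_mult:
  "graded l M w r f \<Longrightarrow> graded l M w' r' g \<Longrightarrow> graded l M (w + w') (r + r') (f * g)"
  unfolding graded_def using graded_upto_mult by blast

lemma graded_mult':
  "graded l M w r f \<Longrightarrow> graded l M w' r' g \<Longrightarrow> w'' = w + w' \<Longrightarrow> r'' = r + r' \<Longrightarrow>
   graded l M w'' r'' (f * g)"
  using graded_mult by blast

lemma graded_deriv:
  assumes "graded l M w (Suc r) f" shows "graded l M (Suc w) r (fps_deriv f)"
proof (rule gradedI)
  fix k
  obtain q where q: "q \<in> \<rat>" "fps_nth f (Suc k) = q * l ^ (w + Suc k)"
    using gradedD[OF assms, of "Suc k"] by auto
  show "\<exists>q\<in>\<rat>. fps_nth (fps_deriv f) k = q * l ^ (Suc w + k)"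
    by (rule bexI[of _ "of_nat (Suc k) * q"]) (use q in \<open>simp_all add: Rats_mult\<close>)
  assume "k mod M \<noteq> r mod M"
  then have "Suc k mod M \<noteq> Suc r mod M"
    by (auto simp: nat_mod_eq_iff)
  then show "fps_nth (fps_deriv f) k = 0" using gradedD_zero[OF assms] by simp
qed

lemma graded_antideriv:
  assumes "graded l M (Suc w) r (fps_deriv f)" "fps_nth f 0 = 0" shows "graded l M w (Suc r) f"
proof (rule gradedI)
  fix k
  show "\<exists>q\<in>\<rat>. fps_nth f k = q * l ^ (w + k)"
  proof (cases k)
    case (Suc j)
    obtain q where q: "q \<in> \<rat>" "fps_nth (fps_deriv f) j = q * l ^ (Suc w + j)"
      using gradedD[OF assms(1), of j] by auto
    show ?thesis
      by (rule bexI[of _ "q / of_nat (Suc j)"])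
        (use q Suc in \<open>simp_all add: Rats_divide field_simps del: of_nat_Suc\<close>)
  qed (use assms in auto)
  assume ne: "k mod M \<noteq> Suc r mod M"
  show "fps_nth f k = 0"
  proof (cases k)
    case (Suc j)
    with ne have "j mod M \<noteq> r mod M" by (metis mod_Suc_eq)
    from gradedD_zero[OF assms(1) this] show ?thesis using Suc by (simp del: of_nat_Suc)
  qed (use assms in auto)
qed

text \<open>With \<open>M = 1\<close> the residue condition is void and only the weight
  remains.\<close>

lemma graded_ungrade: "graded l M w r f \<Longrightarrow> graded l 1 w 0 f"
  unfolding graded_def graded_upto_def by auto

text \<open>The relations at the quarter period, stripped of their analytic origin; \<open>e\<close>
  stands for \<open>kA\<close>. That \<open>B\<close> and \<open>D\<close> start with the same
  \<open>l\<close> up to \<open>\<i>\<close> is the lemniscatic condition.\<close>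

locale lemniscatic_series =
  fixes A B D Z :: "complex fps" and l e kD :: complex
  assumes DD: "D * D = fps_deriv Z + fps_const kD"
    and AA: "A * A = fps_deriv Z + fps_const e"
    and derivs: "fps_deriv B = A * D" "fps_deriv D = B * A" "fps_deriv A = B * D"
    and init: "fps_nth A 0 = 0" "fps_nth B 0 = \<i> * l" "fps_nth D 0 = l" "fps_nth Z 0 = 0"
begin

text \<open>These are \<open>l sl (l X)\<close>, \<open>l sqrt (1 + sl\<^sup>2 (l X))\<close> and the integral of \<open>l\<^sup>2 sl\<^sup>2 (l X)\<close>, where \<open>sl\<close> is the
  lemniscate sine.\<close>

definition "al = fps_const (- \<i>) * A"
definition "be = fps_const (- \<i>) * B"
definition "ze = - Z - fps_const e * fps_X"

lemma neg_ii: "fps_const (- \<i>) * F * (fps_const (- \<i>) * G) = - (F * G)"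
proof -
  have "fps_const (- \<i>) * F * (fps_const (- \<i>) * G) = (fps_const (- \<i>) * fps_const (- \<i>)) * (F * G)"
    by (simp only: mult_ac)
  also have "fps_const (- \<i>) * fps_const (- \<i>) = - (1 :: complex fps)"
  proof -
    have "fps_const (- \<i>) * fps_const (- \<i>) = fps_const (- 1)" by simp
    then show ?thesis by (simp only: fps_const_neg[symmetric] fps_const_1_eq_1)
  qed
  finally show ?thesis by simp
qed

lemma al_be_derivs: "fps_deriv al = be * D" "fps_deriv be = al * D" "fps_deriv D = - (al * be)"
proof -
  show "fps_deriv al = be * D" "fps_deriv be = al * D"
    by (simp_all add: al_def be_def derivs mult_ac)
  show "fps_deriv D = - (al * be)" unfolding al_def be_def neg_ii derivs by simp
qed

lemma al_be_init: "fps_nth al 0 = 0" "fps_nth be 0 = l"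
  by (simp_all add: al_def be_def init)

lemma kD_eq: "kD = l ^ 2 + e"
proof -
  have "fps_nth (D * D) 0 - fps_nth (A * A) 0 = kD - e" unfolding DD AA by simp
  then show ?thesis by (simp add: init power2_eq_square algebra_simps)
qed

lemma al2: "al * al = - fps_deriv Z - fps_const e"
  unfolding al_def neg_ii AA by simp

lemma DD_eq: "D * D = fps_const (l ^ 2) - al * al"
  unfolding DD al2 kD_eq by (simp flip: fps_const_add)

lemma be2: "be * be = fps_const (l ^ 2) + al * al"
proof -
  have "fps_deriv (be * be - al * al) = 0" by (simp add: al_be_derivs mult_ac)
  then have "be * be - al * al = fps_const (fps_nth (be * be - al * al) 0)"
    using fps_deriv_eq_0_iff by blast
  then show ?thesis by (simp add: al_be_init power2_eq_square algebra_simps)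
qed

lemma ze_deriv: "fps_deriv ze = al * al" by (simp add: ze_def al2)

lemma al_deriv2: "fps_deriv (fps_deriv al) = fps_const (- 2) * (al * (al * al))"
proof -
  have "fps_deriv (fps_deriv al) = al * (D * D) - al * (be * be)"
    by (simp add: al_be_derivs algebra_simps)
  also have "\<dots> = fps_const (- 2) * (al * (al * al))"
    unfolding DD_eq be2 by (simp add: algebra_simps numeral_fps_const flip: fps_const_neg)
  finally show ?thesis .
qed

text \<open>The equation \<open>al'' = - 2 al^3\<close> determines coefficient \<open>n + 2\<close>
  from those up to \<open>n\<close>, so the induction carries the truncated grading. The cube has
  weight 3 and residue 3; passing from \<open>n\<close> to \<open>n + 2\<close> turns residue 3 into
  1 modulo 4.\<close>

lemma al_graded_upto: "graded_upto l 4 1 1 (Suc n) al"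
proof (induction n)
  case 0
  have "fps_nth (fps_deriv al) 0 = fps_nth (be * D) 0" by (simp only: al_be_derivs)
  then have "fps_nth al 1 = l * l" by (simp add: al_be_init init)
  then have "\<exists>q\<in>\<rat>. fps_nth al 1 = q * l ^ (1 + 1)" by (intro bexI[of _ 1]) (auto simp: power2_eq_square)
  moreover have "\<exists>q\<in>\<rat>. fps_nth al 0 = q * l ^ (1 + 0)" by (intro bexI[of _ 0]) (auto simp: al_be_init)
  moreover have "k \<le> Suc 0 \<Longrightarrow> k = 0 \<or> k = 1" for k by auto
  ultimately show ?case unfolding graded_upto_def by (metis al_be_init(1) One_nat_def)
next
  case (Suc n)
  have g3: "graded_upto l 4 3 3 (Suc n) (al * (al * al))"
    using graded_upto_mult[OF Suc.IH graded_upto_mult[OF Suc.IH Suc.IH]] by (simp add: eval_nat_numeral)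
  obtain q where q: "q \<in> \<rat>" "fps_nth (al * (al * al)) n = q * l ^ (3 + n)"
    and z: "n mod 4 \<noteq> 3 mod 4 \<Longrightarrow> fps_nth (al * (al * al)) n = 0"
    using g3 unfolding graded_upto_def by (metis le_SucI order_refl)
  have "fps_nth (fps_deriv (fps_deriv al)) n = - 2 * fps_nth (al * (al * al)) n"
    unfolding al_deriv2 fps_mult_left_const_nth ..
  then have eq: "of_nat (Suc n) * (of_nat (Suc (Suc n)) * fps_nth al (Suc (Suc n))) =
      - 2 * fps_nth (al * (al * al)) n" by (simp only: fps_deriv_nth Suc_eq_plus1 add.assoc)
  then have eq': "fps_nth al (Suc (Suc n)) =
      - 2 / (of_nat (Suc n) * of_nat (Suc (Suc n))) * fps_nth (al * (al * al)) n"
  proof -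
    have "of_nat (Suc n) * of_nat (Suc (Suc n)) \<noteq> (0 :: complex)" by (simp del: of_nat_Suc)
    moreover have "fps_nth al (Suc (Suc n)) * (of_nat (Suc n) * of_nat (Suc (Suc n))) =
        - 2 * fps_nth (al * (al * al)) n" unfolding eq[symmetric] by (simp only: mult_ac)
    ultimately show ?thesis by (metis nonzero_eq_divide_eq times_divide_eq_left)
  qed
  have new: "(\<exists>q\<in>\<rat>. fps_nth al (Suc (Suc n)) = q * l ^ (1 + Suc (Suc n))) \<and>
      (Suc (Suc n) mod 4 \<noteq> 1 mod 4 \<longrightarrow> fps_nth al (Suc (Suc n)) = 0)"
  proof (intro conjI impI)
    show "\<exists>q\<in>\<rat>. fps_nth al (Suc (Suc n)) = q * l ^ (1 + Suc (Suc n))"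
      by (rule bexI[of _ "- 2 / (of_nat (Suc n) * of_nat (Suc (Suc n))) * q"])
         (use q in \<open>auto simp: eq' eval_nat_numeral intro!: Rats_mult Rats_divide simp del: of_nat_Suc\<close>)
    assume "Suc (Suc n) mod 4 \<noteq> 1 mod 4"
    then have "n mod 4 \<noteq> 3 mod 4" by presburger
    with z show "fps_nth al (Suc (Suc n)) = 0" by (simp add: eq')
  qed
  show ?case unfolding graded_upto_def
  proof (intro allI impI)
    fix k assume "k \<le> Suc (Suc n)"
    then consider "k \<le> Suc n" | "k = Suc (Suc n)" by linarith
    then show "(\<exists>q\<in>\<rat>. fps_nth al k = q * l ^ (1 + k)) \<and> (k mod 4 \<noteq> 1 mod 4 \<longrightarrow> fps_nth al k = 0)"
      using Suc.IH new unfolding graded_upto_def by cases blast+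
  qed
qed

lemma al_graded: "graded l 4 1 1 al"
  unfolding graded_def using al_graded_upto graded_upto_mono by (meson le_SucI order_refl)

text \<open>Only the weight is recorded: the rotation of \<open>X\<close> by \<open>\<i>\<close>
  exchanges \<open>be\<close> and \<open>D\<close>, so neither is graded modulo 4 by itself. Their
  product is, being the derivative of \<open>al\<close>.\<close>

lemma be_D_graded_upto: "graded_upto l 1 1 0 n be \<and> graded_upto l 1 1 0 n D"
proof (induction n)
  case 0
  show ?case unfolding graded_upto_def by (auto simp: al_be_init init intro: bexI[of _ 1])
next
  case (Suc n)
  have al: "graded_upto l 1 1 0 n al"
    using graded_ungrade[OF al_graded] unfolding graded_def by blast
  have *: "(\<exists>q\<in>\<rat>. fps_nth f (Suc n) = q * l ^ (1 + Suc n))"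
    if g: "graded_upto l 1 1 0 n g" and d: "fps_deriv f = fps_const s * (al * g)" and s: "s \<in> \<rat>" for f g s
  proof -
    obtain q where q: "q \<in> \<rat>" "fps_nth (al * g) n = q * l ^ (2 + n)"
      using graded_upto_mult[OF al g, unfolded graded_upto_def, rule_format, of n] by auto
    have "fps_nth (fps_deriv f) n = s * fps_nth (al * g) n" unfolding d by simp
    then have "of_nat (Suc n) * fps_nth f (Suc n) = s * q * l ^ (1 + Suc n)"
      unfolding q by (simp del: of_nat_Suc)
    then have "fps_nth f (Suc n) = s * q / of_nat (Suc n) * l ^ (1 + Suc n)"
      using of_nat_neq_0[of n, where 'a=complex] by (simp add: nonzero_eq_divide_eq mult_ac del: of_nat_Suc)
    then show ?thesis using q s by (intro bexI[of _ "s * q / of_nat (Suc n)"]) (auto intro!: Rats_mult Rats_divide simp del: of_nat_Suc)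
  qed
  have "\<exists>q\<in>\<rat>. fps_nth be (Suc n) = q * l ^ (1 + Suc n)"
    by (rule *[of D _ 1]) (use Suc.IH al_be_derivs in simp_all)
  moreover have "\<exists>q\<in>\<rat>. fps_nth D (Suc n) = q * l ^ (1 + Suc n)"
    by (rule *[of be _ "-1"]) (use Suc.IH al_be_derivs in \<open>simp_all flip: fps_const_neg\<close>)
  ultimately show ?case using Suc.IH unfolding graded_upto_def by (auto simp: le_Suc_eq)
qed

lemma be_graded: "graded l 1 1 0 be" and D_graded: "graded l 1 1 0 D"
  unfolding graded_def using be_D_graded_upto by auto

lemma ze_graded: "graded l 4 1 3 ze"
proof -
  have "graded l 4 (Suc 1) (1 + 1) (fps_deriv ze)"
    unfolding ze_deriv by (rule graded_mult'[OF al_graded al_graded]) simp_all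
  then have "graded l 4 1 (Suc (1 + 1)) ze"
    by (rule graded_antideriv) (simp add: ze_def init)
  then show ?thesis by (simp add: eval_nat_numeral)
qed

lemma D_coeff: "\<exists>q\<in>\<rat>. fps_nth D k = q * l ^ (Suc k)" (is ?g1)
  and A_coeff: "\<exists>q\<in>\<rat>. fps_nth A k = \<i> * (q * l ^ (Suc k))" (is ?g2)
proof -
  show ?g1 using gradedD[OF D_graded, of k] by simp
  have "fps_nth A k = \<i> * fps_nth al k" by (simp add: al_def)
  then show ?g2 using gradedD[OF al_graded, of k] by simp
qed

text \<open>Write \<open>Z = - ze - e * X\<close>. The part with \<open>ze\<close> has the weight of
  the derivative; the linear part lowers the degree by one and yields the monomial with
  \<open>e\<close>.\<close>

lemma ZF_coeff:
  assumes F: "graded l 1 1 0 F" and k: "k > 0"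
  shows "\<exists>q\<in>\<rat>. \<exists>r\<in>\<rat>. fps_nth (fps_deriv F - Z * F) k = q * l ^ (k + 2) + r * e * l ^ k"
proof -
  obtain j where j: "k = Suc j" using k by (cases k) auto
  have "graded l 1 (Suc 1) 0 (fps_deriv F)" using F by (intro graded_deriv) (auto simp: graded_def graded_upto_def)
  from gradedD[OF this, of k] obtain q1 where q1: "q1 \<in> \<rat>" "fps_nth (fps_deriv F) k = q1 * l ^ (k + 2)"
    by (auto simp: add.commute)
  from gradedD[OF graded_mult[OF graded_ungrade[OF ze_graded] F], of k]
  obtain q2 where q2: "q2 \<in> \<rat>" "fps_nth (ze * F) k = q2 * l ^ (k + 2)" by (auto simp: add.commute)
  from gradedD[OF F, of j] obtain r where r: "r \<in> \<rat>" "fps_nth F j = r * l ^ k" by (auto simp: j)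
  have "fps_deriv F - Z * F = fps_deriv F + ze * F + fps_const e * (fps_X * F)"
    unfolding ze_def by (simp add: algebra_simps)
  then have "fps_nth (fps_deriv F - Z * F) k = (q1 + q2) * l ^ (k + 2) + r * e * l ^ k"
  proof -
    assume eq: "fps_deriv F - Z * F = fps_deriv F + ze * F + fps_const e * (fps_X * F)"
    have "fps_nth (fps_deriv F - Z * F) k =
        fps_nth (fps_deriv F) k + fps_nth (ze * F) k + e * fps_nth F j"
      unfolding eq by (simp add: j)
    then show ?thesis unfolding q1 q2 r by (simp add: algebra_simps)
  qed
  then show ?thesis using q1(1) q2(1) r(1) Rats_add by blast
qed

lemma D1_coeff:
  "k > 0 \<Longrightarrow> \<exists>q\<in>\<rat>. \<exists>r\<in>\<rat>. fps_nth (fps_deriv D - Z * D) k = q * l ^ (k + 2) + r * e * l ^ k"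
  by (rule ZF_coeff[OF D_graded])

lemma B1_coeff:
  assumes "k > 0"
  shows "\<exists>q\<in>\<rat>. \<exists>r\<in>\<rat>. fps_nth (fps_deriv B - Z * B) k = \<i> * (q * l ^ (k + 2) + r * e * l ^ k)"
proof -
  have "fps_deriv be - Z * be = fps_const (- \<i>) * (fps_deriv B - Z * B)"
    unfolding be_def by (simp add: right_diff_distrib mult.left_commute)
  then have "fps_nth (fps_deriv B - Z * B) k = \<i> * fps_nth (fps_deriv be - Z * be) k" by simp
  then show ?thesis using ZF_coeff[OF be_graded assms] by auto
qed

text \<open>After \<open>Z = - ze - e * X\<close>, the squares of \<open>al\<close> and
  \<open>ze\<close> have residue 2 modulo 4 and vanish in degree \<open>k\<close>. The terms of
  degree 0 and 2 are too low because \<open>k >= 4\<close>. Only the mixed term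
  \<open>e * X * ze\<close> survives.\<close>

lemma Z1_coeff:
  assumes "k mod 4 = 0" "k > 0"
  shows "\<exists>q\<in>\<rat>. fps_nth (fps_const (1/2) * (fps_deriv Z - Z * Z) + fps_const c) k = q * e * l ^ k"
proof -
  have "k \<ge> 4" using assms by presburger
  define j where "j = k - 3"
  with \<open>k \<ge> 4\<close> have j: "k = Suc (Suc (Suc j))" by simp
  have "graded l 4 (1 + 1) (1 + 1) (al * al)" by (intro graded_mult al_graded)
  from gradedD_zero[OF this, of k] assms have 1: "fps_nth (al * al) k = 0" by simp
  have "graded l 4 (1 + 1) (3 + 3) (ze * ze)" by (intro graded_mult ze_graded)
  from gradedD_zero[OF this, of k] assms have 2: "fps_nth (ze * ze) k = 0" by simp
  from gradedD[OF ze_graded, of "k - 1"] assms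
  obtain q where q: "q \<in> \<rat>" "fps_nth ze (k - 1) = q * l ^ k" by auto
  have "fps_const (1/2) * (fps_deriv Z - Z * Z) + fps_const c = fps_const (1/2) *
     (- (al * al) - fps_const e - fps_const (e^2) * fps_X ^ 2 - fps_const (2 * e) * (fps_X * ze) - ze * ze) + fps_const c"
  proof -
    have "fps_const (e ^ 2) = fps_const e * fps_const e" "fps_const (2 * e) = 2 * fps_const e"
      by (simp_all add: power2_eq_square numeral_fps_const)
    then have "fps_deriv Z - Z * Z = - (al * al) - fps_const e - fps_const (e^2) * fps_X ^ 2
        - fps_const (2 * e) * (fps_X * ze) - ze * ze"
      unfolding al2 ze_def by algebra
    then show ?thesis by simp
  qed
  also have "fps_nth \<dots> k = 1 / 2 * (- fps_nth (al * al) k - 2 * e * fps_nth ze (k - 1) - fps_nth (ze * ze) k)"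
    using j by (simp add: mult.assoc)
  also have "\<dots> = - (q * e * l ^ k)"
    using 1 2 q by simp
  finally show ?thesis using q by (intro bexI[of _ "-q"]) auto
qed

text \<open>Every term linear in \<open>e\<close> misses the degrees divisible by 4, and the term
  cubic in \<open>e\<close> has degree 2. What is left is free of \<open>e\<close>, of weight 4, or
  quadratic in \<open>e\<close>.\<close>

lemma Z2_coeff:
  fixes D1 D2 Z1 c
  assumes D1: "D1 = fps_deriv D - Z * D" and D2: "D2 = fps_deriv D1 - fps_const kD * D - Z * D1"
    and Z1: "Z1 = fps_const (1/2) * (fps_deriv Z - Z * Z) + fps_const c"
    and k: "k mod 4 = 0" "k > 0"
  shows "\<exists>q\<in>\<rat>. \<exists>r\<in>\<rat>. fps_nth (D * D2 + fps_const (2 * kD) * Z1 + fps_const d) k =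
     q * l ^ (k + 4) + r * e ^ 2 * l ^ k"
proof -
  have "k \<ge> 4" using k by presburger
  define j where "j = k - 3"
  with \<open>k \<ge> 4\<close> have j: "k = Suc (Suc (Suc j))" by simp
  define L E where "L = fps_const (l ^ 2)" and "E = fps_const e"
  have K: "fps_const kD = L + E" by (simp add: kD_eq L_def E_def)
  have Z': "fps_deriv Z = - (al * al) - E" by (simp add: al2 E_def)
  have D2': "D * D = L - al * al" and be2': "be * be = L + al * al" by (simp_all add: DD_eq be2 L_def)
  have d2: "fps_deriv (fps_deriv D) = - (be * D * be + al * (al * D))"
    unfolding al_be_derivs(3) by (simp add: al_be_derivs mult_ac)
  have dD1: "fps_deriv D1 = - (be * D * be + al * (al * D)) - fps_deriv Z * D - Z * fps_deriv D"
    unfolding D1 by (simp add: d2)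
  have D1': "D1 = - (al * be) - Z * D" unfolding D1 by (simp add: al_be_derivs)
  have two_kD: "fps_const (2 * kD) * Z1 = (L + E) * (fps_deriv Z - Z * Z) + fps_const (2 * kD * c)"
  proof -
    have "fps_const (2 * kD) * Z1 = fps_const kD * (fps_deriv Z - Z * Z) + fps_const (2 * kD * c)"
      unfolding Z1 by (simp add: distrib_left mult.assoc[symmetric])
    then show ?thesis by (simp add: K)
  qed
  \<comment> \<open>All derivatives, and the squares of \<open>D\<close> and \<open>be\<close>, are
    eliminated; \<open>D\<close> remains only in the product \<open>be * D\<close>, which is graded
    modulo 4.\<close>
  have "D * D2 + (L + E) * (fps_deriv Z - Z * Z) =
      (al * al) * (al * al) - E * (al * al) + 2 * (Z * (al * (be * D))) - Z * Z * (al * al + E)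
      - (2 * L * L + L * E + E * E)"
    unfolding D2 K dD1 unfolding D1' Z' al_be_derivs(3) using D2' be2' by algebra
  moreover have "Z = - (E * fps_X) - ze" by (simp add: ze_def E_def)
  \<comment> \<open>Substituting \<open>Z = - ze - e * X\<close> sorts the expression by powers of
    \<open>e\<close>, with every factor graded.\<close>
  ultimately have main: "D * D2 + (L + E) * (fps_deriv Z - Z * Z) =
      (al * al) * (al * al) - E * (al * al) - 2 * E * (fps_X * (al * (be * D))) - 2 * (ze * (al * (be * D)))
      - E * E * (fps_X ^ 2 * (al * al)) - 2 * E * (fps_X * (ze * (al * al))) - (ze * ze) * (al * al)
      - E * E * E * fps_X ^ 2 - 2 * E * E * (fps_X * ze) - E * (ze * ze)
      - (2 * L * L + L * E + E * E)"
    by algebra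
  have "graded l 4 (Suc 1) 0 (fps_deriv al)" using al_graded by (intro graded_deriv) simp
  then have bD: "graded l 4 2 0 (be * D)" by (simp add: al_be_derivs numeral_eq_Suc)
  have aa: "graded l 4 2 2 (al * al)" by (rule graded_mult'[OF al_graded al_graded]) simp_all
  have abD: "graded l 4 3 1 (al * (be * D))" by (rule graded_mult'[OF al_graded bD]) simp_all
  have zabD: "graded l 4 4 4 (ze * (al * (be * D)))" by (rule graded_mult'[OF ze_graded abD]) simp_all
  have zaa: "graded l 4 3 5 (ze * (al * al))" by (rule graded_mult'[OF ze_graded aa]) simp_all
  have zz: "graded l 4 2 6 (ze * ze)" by (rule graded_mult'[OF ze_graded ze_graded]) simp_all
  have zzaa: "graded l 4 4 8 ((ze * ze) * (al * al))" by (rule graded_mult'[OF zz aa]) simp_all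
  have aaaa: "graded l 4 4 4 ((al * al) * (al * al))" by (rule graded_mult'[OF aa aa]) simp_all
  obtain q1 where q1: "q1 \<in> \<rat>" "fps_nth ((al * al) * (al * al)) k = q1 * l ^ (k + 4)"
    using gradedD[OF aaaa, of k] by (auto simp: add.commute)
  obtain q2 where q2: "q2 \<in> \<rat>" "fps_nth (ze * (al * (be * D))) k = q2 * l ^ (k + 4)"
    using gradedD[OF zabD, of k] by (auto simp: add.commute)
  obtain q3 where q3: "q3 \<in> \<rat>" "fps_nth ((ze * ze) * (al * al)) k = q3 * l ^ (k + 4)"
    using gradedD[OF zzaa, of k] by (auto simp: add.commute)
  obtain r1 where r1: "r1 \<in> \<rat>" "fps_nth (al * al) (k - 2) = r1 * l ^ k"
  proof -
    have "2 + (k - 2) = k" using \<open>k \<ge> 4\<close> by simp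
    then show ?thesis using gradedD[OF aa, of "k - 2"] that by metis
  qed
  obtain r2 where r2: "r2 \<in> \<rat>" "fps_nth ze (k - 1) = r2 * l ^ k"
  proof -
    have "1 + (k - 1) = k" using \<open>k \<ge> 4\<close> by simp
    then show ?thesis using gradedD[OF ze_graded, of "k - 1"] that by metis
  qed
  have z1: "fps_nth (al * al) k = 0" using gradedD_zero[OF aa, of k] k by simp
  have z2: "fps_nth (ze * ze) k = 0" using gradedD_zero[OF zz, of k] k by simp
  have "(k - 1) mod 4 = 3"
  proof -
    have "k = 4 * (k div 4)" using k(1) by auto
    then have "k - 1 = 3 + 4 * (k div 4 - 1)" using \<open>k \<ge> 4\<close> by linarith
    then have "(k - 1) mod 4 = (3 + 4 * (k div 4 - 1)) mod 4" by (rule arg_cong)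
    also have "\<dots> = 3 mod 4" by (rule mod_mult_self2)
    finally show ?thesis by simp
  qed
  then have z3: "fps_nth (al * (be * D)) (k - 1) = 0" and z4: "fps_nth (ze * (al * al)) (k - 1) = 0"
    using gradedD_zero[OF abD, of "k - 1"] gradedD_zero[OF zaa, of "k - 1"] by simp_all
  have X1: "fps_nth (fps_X * F) k = fps_nth F (k - 1)" for F :: "complex fps" using j by simp
  have X2: "fps_nth (fps_X ^ 2 * F) k = fps_nth F (k - 2)" for F :: "complex fps"
    using j by (simp add: fps_X_power_mult_nth)
  have X3: "fps_nth (fps_X ^ 2) k = (0::complex)" using j by simp
  have c: "fps_nth (E * F) k = e * fps_nth F k" "fps_nth (2 * F) k = 2 * fps_nth F k"
    "fps_nth (2 * E * F) k = 2 * e * fps_nth F k" "fps_nth (E * E * F) k = e * e * fps_nth F k"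
    "fps_nth (E * E * E * F) k = e * e * e * fps_nth F k" "fps_nth (2 * E * E * F) k = 2 * e * e * fps_nth F k" for F
    by (simp_all add: E_def numeral_fps_const)
  have c3: "fps_nth (2 * L * L + L * E + E * E) k = 0" using j by (simp add: L_def E_def numeral_fps_const)
  have "fps_nth (D * D2 + (L + E) * (fps_deriv Z - Z * Z)) k =
     q1 * l ^ (k + 4) - 2 * (q2 * l ^ (k + 4)) - e * (e * (r1 * l ^ k)) - q3 * l ^ (k + 4) - 2 * (e * (e * (r2 * l ^ k)))"
    unfolding main fps_sub_nth c3 c X1 X2 X3 q1(2) q2(2) q3(2) r1(2) r2(2) z1 z2 z3 z4 by simp
  then have "fps_nth (D * D2 + fps_const (2 * kD) * Z1 + fps_const d) k =
      (q1 - 2 * q2 - q3) * l ^ (k + 4) + (- r1 - 2 * r2) * e ^ 2 * l ^ k"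
  proof -
    assume eq: "fps_nth (D * D2 + (L + E) * (fps_deriv Z - Z * Z)) k =
     q1 * l ^ (k + 4) - 2 * (q2 * l ^ (k + 4)) - e * (e * (r1 * l ^ k)) - q3 * l ^ (k + 4) - 2 * (e * (e * (r2 * l ^ k)))"
    have "fps_nth (D * D2 + fps_const (2 * kD) * Z1 + fps_const d) k =
        fps_nth (D * D2 + (L + E) * (fps_deriv Z - Z * Z)) k"
      unfolding two_kD using j by simp
    then show ?thesis unfolding eq by (simp add: algebra_simps power2_eq_square)
  qed
  moreover have "q1 - 2 * q2 - q3 \<in> \<rat>" "- r1 - 2 * r2 \<in> \<rat>"
    using q1 q2 q3 r1 r2 by (auto intro!: Rats_diff Rats_mult)
  ultimately show ?thesis by blast
qed

end

section \<open>Passage to the limit: the integral as a combination of moments\<close>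

lemma mixed_contour_limit:
  assumes p: "p \<ge> 5" "p mod 4 = 1"
    and S: "(\<lambda>n. \<Sum>N=1..2 * int n. res_term p N) \<longlonglongrightarrow> S"
    and c: "(1 + \<i>) ^ (p + 1) = - \<i> * of_real c"
  shows "(\<lambda>n. integral {0..real n * pi + pi / 4} (mixed_real p)) \<longlonglongrightarrow> - pi * c * S / 8"
proof -
  define R where "R = (\<lambda>n::nat. real n * pi + pi / 4)"
  define J where "J = (\<lambda>n. integral {0..R n} (mixed_real p))"
  define T where "T = (\<lambda>n::nat. \<Sum>N=1..2 * int n. res_term p N)"
  have bound: "\<bar>- pi * c * T n / 4 - 2 * J n\<bar> \<le> 16 * R n * (2 * R n) ^ p / sinh (R n / 2) ^ 2" for n
  proof -
    \<comment> \<open>Since \<open>(1 + \<i>) ^ (p + 1)\<close> is purely imaginary, the residue sum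
      is real, as twice a real integral must be.\<close>
    have "2 * pi * \<i> * (- ((1 + \<i>) ^ (p + 1)) / 8 * of_real (T n)) = of_real (- pi * c * T n / 4)"
      unfolding c by (simp add: complex_eq_iff)
    then have "contour_integral (rectpath 0 (Complex (R n) (R n))) (mixed_fun p) = of_real (- pi * c * T n / 4)"
      using mixed_contour(1)[OF p(1), of n] by (simp only: R_def T_def)
    then have eq: "contour_integral (rectpath 0 (Complex (R n) (R n))) (mixed_fun p) - 2 * of_real (J n) =
        of_real (- pi * c * T n / 4 - 2 * J n)" by simp
    have "cmod (contour_integral (rectpath 0 (Complex (R n) (R n))) (mixed_fun p) - 2 * of_real (J n))
       \<le> 16 * R n * (2 * R n) ^ p / sinh (R n / 2) ^ 2"
      unfolding J_def R_def by (rule mixed_contour_edges(2)[OF p])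
    then show ?thesis unfolding eq norm_of_real .
  qed
  have Rlim: "filterlim R at_top sequentially"
  proof (rule filterlim_at_top_mono[OF filterlim_real_sequentially])
    show "\<forall>\<^sub>F n in sequentially. real n \<le> R n"
    proof (rule always_eventually, rule allI)
      fix n
      have "real n * 1 \<le> real n * pi" using pi_ge_two by (intro mult_left_mono) auto
      then show "real n \<le> R n" unfolding R_def using pi_gt_zero by linarith
    qed
  qed
  have "(\<lambda>n. - pi * c * T n / 4 - 2 * J n) \<longlonglongrightarrow> 0"
  proof (rule tendsto_rabs_zero_cancel, rule tendsto_sandwich[OF _ _ tendsto_const])
    \<comment> \<open>The constant is 16 from the edge bound times 16 from bounding
      \<open>1 / sinh (R / 2) ^ 2\<close> by \<open>16 * exp (- R)\<close>.\<close>
    have "((\<lambda>x. 256 * 2 ^ p * (x ^ Suc p / exp x)) \<longlongrightarrow> 256 * 2 ^ p * 0) (at_top :: real filter)"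
      by (intro tendsto_mult_left tendsto_power_div_exp_0)
    from filterlim_compose[OF this Rlim]
    show "(\<lambda>n. 256 * 2 ^ p * (R n ^ Suc p / exp (R n))) \<longlonglongrightarrow> 0" by simp
    show "\<forall>\<^sub>F n in sequentially. \<bar>- pi * c * T n / 4 - 2 * J n\<bar> \<le> 256 * 2 ^ p * (R n ^ Suc p / exp (R n))"
      using filterlim_at_top[THEN iffD1, OF Rlim, rule_format, of 2]
    proof (rule eventually_mono)
      fix n assume R2: "2 \<le> R n"
      have "1 / sinh (R n / 2) \<le> 4 * exp (- (R n / 2))"
        using inverse_sinh_bound[of "R n / 2"] R2 by simp
      moreover have "sinh (R n / 2) > 0" using R2 by simp
      ultimately have "(1 / sinh (R n / 2)) ^ 2 \<le> (4 * exp (- (R n / 2))) ^ 2" by (intro power_mono) auto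
      also have "\<dots> = 16 / exp (R n)"
        by (simp add: power_mult_distrib exp_minus power2_eq_square field_simps flip: exp_add)
      finally have "16 * R n * (2 * R n) ^ p * (1 / sinh (R n / 2)) ^ 2 \<le> 16 * R n * (2 * R n) ^ p * (16 / exp (R n))"
        using R2 by (intro mult_left_mono) auto
      then show "\<bar>- pi * c * T n / 4 - 2 * J n\<bar> \<le> 256 * 2 ^ p * (R n ^ Suc p / exp (R n))"
      proof -
        have "16 * R n * (2 * R n) ^ p / sinh (R n / 2) ^ 2 = 16 * R n * (2 * R n) ^ p * (1 / sinh (R n / 2)) ^ 2"
          by (simp add: power_one_over)
        moreover have "16 * R n * (2 * R n) ^ p * (16 / exp (R n)) = 256 * 2 ^ p * (R n ^ Suc p / exp (R n))"
          by (simp add: power_mult_distrib)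
        moreover assume "16 * R n * (2 * R n) ^ p * (1 / sinh (R n / 2)) ^ 2 \<le> 16 * R n * (2 * R n) ^ p * (16 / exp (R n))"
        ultimately show ?thesis using bound[of n] by linarith
      qed
    qed
  qed auto
  from tendsto_diff[OF tendsto_mult_left[OF S[folded T_def], of "- pi * c / 4"] this]
  have "(\<lambda>n. 2 * J n) \<longlonglongrightarrow> - pi * c * S / 4" by (simp add: algebra_simps)
  from tendsto_mult_left[OF this, of "1/2"] show ?thesis by (simp add: J_def R_def)
qed

lemma mixed_real_nonneg: "x \<ge> 0 \<Longrightarrow> mixed_real p x \<ge> 0"
proof -
  have "cosh y - cos y \<ge> 0" for y :: real using cosh_real_ge_1[of y] cos_le_one[of y] by linarith
  then show "x \<ge> 0 \<Longrightarrow> mixed_real p x \<ge> 0" unfolding mixed_real_def by simp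
qed

lemma mixed_real_has_integral:
  assumes p: "p \<ge> 5" "p mod 4 = 1"
    and lim: "(\<lambda>n. integral {0..real n * pi + pi / 4} (mixed_real p)) \<longlonglongrightarrow> I"
  shows "(mixed_real p has_integral I) {0<..}"
proof -
  define R where "R = (\<lambda>n::nat. real n * pi + pi / 4)"
  have R: "real n \<le> R n" "R n \<le> R (Suc n)" for n
  proof -
    have "real n * 1 \<le> real n * pi" using pi_ge_two by (intro mult_left_mono) auto
    then show "real n \<le> R n" unfolding R_def using pi_gt_zero by linarith
    show "R n \<le> R (Suc n)" by (simp add: R_def distrib_right)
  qed
  have "(mixed_real p has_integral I) {0..}"
  proof (rule has_integral_monotone_convergence_increasing)
    show "((\<lambda>x. if x \<in> {0..R k} then mixed_real p x else 0) has_integral integral {0..R k} (mixed_real p)) {0..}" for k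
      by (subst has_integral_restrict) (use mixed_contour_edges(1)[OF p, of k] in \<open>auto simp: R_def\<close>)
    show "(if x \<in> {0..R k} then mixed_real p x else 0) \<le> (if x \<in> {0..R (Suc k)} then mixed_real p x else 0)"
      if "x \<in> {0..}" for k x using R(2)[of k] mixed_real_nonneg[of x p] that by auto
    show "(\<lambda>k. if x \<in> {0..R k} then mixed_real p x else 0) \<longlonglongrightarrow> mixed_real p x" if x: "x \<in> {0..}" for x
    proof (rule tendsto_eventually)
      obtain k0 :: nat where k0: "x \<le> real k0" using real_arch_simple by blast
      have "x \<le> R k" if "k \<ge> k0" for k using R(1)[of k] that k0 by linarith
      then show "\<forall>\<^sub>F k in sequentially. (if x \<in> {0..R k} then mixed_real p x else 0) = mixed_real p x"
        using x unfolding eventually_sequentially by auto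
    qed
    show "(\<lambda>k. integral {0..R k} (mixed_real p)) \<longlonglongrightarrow> I" using lim by (simp add: R_def)
  qed
  moreover have "mixed_real p 0 = 0" by (simp add: mixed_real_def)
  ultimately have "((\<lambda>x. if x \<in> {0<..} then mixed_real p x else 0) has_integral I) {0..}"
    by (subst has_integral_cong[of _ _ "mixed_real p"]) auto
  then show ?thesis by (subst (asm) has_integral_restrict) auto
qed

lemma moment_cos_has_sum: "rapid a \<Longrightarrow> ((\<lambda>N. a N * of_int N ^ k * cos (tt N)) has_sum Re (moment (pi / 2) a k)) UNIV"
  and moment_sin_has_sum: "rapid a \<Longrightarrow> ((\<lambda>N. a N * of_int N ^ k * sin (tt N)) has_sum Im (moment (pi / 2) a k)) UNIV"
  using has_sum_Re[OF moment_has_sum[of a "pi / 2" k]] has_sum_Im[OF moment_has_sum[of a "pi / 2" k]]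
  by (simp_all add: mterm_def tt_def del: of_real_mult of_real_power times_divide_eq_right)

text \<open>The sum of \<open>res_term\<close> over all integers with \<open>gder\<close> and
  \<open>gfun\<close> expanded. The parity supports of the sequences replace the case distinction:
  \<open>sZ1\<close>, \<open>sD\<close>, \<open>sD1\<close>, \<open>sZ2\<close> for even indices,
  \<open>sB1\<close> and \<open>sA\<close> for odd ones.\<close>

definition res_total :: "nat \<Rightarrow> real" where
  "res_total p = real p * (pi / 2) ^ (p - 1) / 2 * (Re (moment (pi / 2) sZ1 (p - 1)) - Re (moment (pi / 2) sD (p - 1)))
     + (pi / 2) ^ p / 2 * (Re (moment (pi / 2) sD1 p) - Re (moment (pi / 2) sZ2 p))
     - (pi / 2) ^ p / 2 * (Im (moment (pi / 2) sB1 p) - Im (moment (pi / 2) sA p))"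

lemma res_term_sum_limit:
  assumes p: "p \<ge> 2" "odd p"
  shows "(\<lambda>n. \<Sum>N=1..2 * int n. res_term p N) \<longlonglongrightarrow> res_total p / 2"
proof -
  define y where "y = pi / 2"
  define tot where "tot = (\<lambda>N. real p * y ^ (p - 1) / 2 * (sZ1 N * of_int N ^ (p - 1) * cos (tt N) + - (sD N * of_int N ^ (p - 1) * cos (tt N)))
     + y ^ p / 2 * (sD1 N * of_int N ^ p * cos (tt N) + - (sZ2 N * of_int N ^ p * cos (tt N)))
     + (- (y ^ p / 2)) * (sB1 N * of_int N ^ p * sin (tt N) + - (sA N * of_int N ^ p * sin (tt N))))"
  have "(tot has_sum (real p * y ^ (p - 1) / 2 * (Re (moment (pi / 2) sZ1 (p - 1)) + - Re (moment (pi / 2) sD (p - 1)))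
     + y ^ p / 2 * (Re (moment (pi / 2) sD1 p) + - Re (moment (pi / 2) sZ2 p))
     + (- (y ^ p / 2)) * (Im (moment (pi / 2) sB1 p) + - Im (moment (pi / 2) sA p)))) UNIV"
    unfolding tot_def
    by (intro has_sum_add has_sum_cmult_right has_sum_uminusI moment_cos_has_sum moment_sin_has_sum rapid_seqs)
  then have "(tot has_sum res_total p) UNIV"
    by (simp add: res_total_def y_def)
  then have lim: "(\<lambda>n. sum tot {- 2 * int n..2 * int n}) \<longlonglongrightarrow> res_total p"
    using filterlim_compose[OF _ filterlim_symmetric_intervals] by (auto simp: has_sum_def)
  have even: "tot (- N) = tot N" for N
  proof -
    have "sZ1 (- N) = sZ1 N" "sD (- N) = sD N" "sD1 (- N) = - sD1 N" "sB1 (- N) = sB1 N" "sA (- N) = sA N"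
      by (simp_all add: sZ1_def sD_def sD1_def sB1_def sA_def tt_simps)
    moreover have "sZ2 (- N) = - sZ2 N" by (simp add: sZ2_def tt_simps)
    ultimately show ?thesis unfolding tot_def using p by (simp add: tt_simps)
  qed
  \<comment> \<open>Here \<open>p >= 2\<close> matters: \<open>sD 0 = 1\<close>, and only the factor
    \<open>N ^ (p - 1)\<close> removes the index 0.\<close>
  have zero: "tot 0 = 0" using p by (simp add: tot_def zero_power)
  have tot_eq: "tot N = res_term p N" for N
  proof -
    have pw: "tt N ^ k = y ^ k * of_int N ^ k" for k
      unfolding tt_def y_def power_mult_distrib by (rule mult.commute)
    show ?thesis unfolding tot_def res_term_def gder_def gfun_def pw
      by (cases "even N") (simp_all add: sZ1_def sD_def sD1_def sZ2_def sB1_def sA_def algebra_simps add_divide_distrib diff_divide_distrib)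
  qed
  have "sum tot {- 2 * int n..2 * int n} = 2 * (\<Sum>N=1..2 * int n. res_term p N)" for n
  proof -
    have split: "{- 2 * int n..2 * int n} = uminus ` {1..2 * int n} \<union> insert 0 {1..2 * int n}"
      by (auto simp: image_iff intro: exI[of _ "- _"])
    have "sum tot {- 2 * int n..2 * int n} = sum tot (uminus ` {1..2 * int n}) + sum tot (insert 0 {1..2 * int n})"
      unfolding split by (rule sum.union_disjoint) auto
    also have "sum tot (uminus ` {1..2 * int n}) = sum tot {1..2 * int n}"
      by (subst sum.reindex) (auto simp: even)
    finally show ?thesis by (simp add: zero[unfolded tot_eq] tot_eq)
  qed
  with lim have "(\<lambda>n. 2 * (\<Sum>N=1..2 * int n. res_term p N)) \<longlonglongrightarrow> res_total p" by simp
  from tendsto_mult_left[OF this, of "1/2"] show ?thesis by simp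
qed

lemma one_plus_ii_power: "m \<ge> 1 \<Longrightarrow> (1 + \<i>) ^ (4 * m - 2) = - \<i> * of_real ((- 4) ^ m / 2)"
proof (induction m rule: dec_induct)
  case base
  show ?case by (simp add: power2_eq_square complex_eq_iff)
next
  case (step m)
  have eq: "4 * Suc m - 2 = (4 * m - 2) + 4" using step by simp
  have four: "(1 + \<i>) ^ 4 = - 4" by (simp add: power4_eq_xxxx complex_eq_iff)
  show ?case unfolding eq power_add step.IH four by simp
qed

lemma mixed_integral_value:
  assumes "m \<ge> 2"
  shows "(mixed_real (4 * m - 3) has_integral - pi * (- 4) ^ m / 32 * res_total (4 * m - 3)) {0<..}"
proof -
  define p where "p = 4 * m - 3"
  have p: "p \<ge> 5" "p mod 4 = 1" "p \<ge> 2" "odd p" "p + 1 = 4 * m - 2"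
  proof -
    obtain k where k: "m = 2 + k" using assms le_Suc_ex by blast
    then have "p = 1 + 4 * (1 + k)" by (simp add: p_def)
    then show "p \<ge> 5" "p mod 4 = 1" "p \<ge> 2" "odd p" by (simp_all only: mod_mult_self2) simp_all
    show "p + 1 = 4 * m - 2" using assms by (simp add: p_def)
  qed
  have "(1 + \<i>) ^ (p + 1) = - \<i> * of_real ((- 4) ^ m / 2)"
    unfolding p(5) using assms by (intro one_plus_ii_power) auto
  from mixed_real_has_integral[OF p(1,2) mixed_contour_limit[OF p(1,2) res_term_sum_limit[OF p(3,4)] this]]
  show ?thesis by (simp add: p_def mult_ac)
qed

section \<open>Moments at the quarter period as rational combinations of powers of
  \<open>lam\<close> and \<open>1 / pi\<close>\<close>

interpretation lemniscatic: lemniscatic_series "mgf (pi / 2) sA" "mgf (pi / 2) sB" "mgf (pi / 2) sD" "mgf (pi / 2) sZ"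
  "of_real lam" "of_real kA" "of_real kD"
proof
  show "fps_nth (mgf (pi / 2) sA) 0 = 0" "fps_nth (mgf (pi / 2) sB) 0 = \<i> * of_real lam"
    "fps_nth (mgf (pi / 2) sD) 0 = of_real lam" "fps_nth (mgf (pi / 2) sZ) 0 = 0"
    by (simp_all add: mgf_nth_0 moments_0 boundary_values fb_eq_fd_half_pi lam_def)
qed (rule mgf_relations)+

lemma Rats_complexE:
  assumes "q \<in> (\<rat> :: complex set)" obtains r :: rat where "q = of_real (of_rat r)"
proof -
  from assms obtain r where "q = of_rat r" by (auto simp: Rats_def)
  moreover have "complex_of_rat r = of_real (of_rat r)" by (cases r) (simp add: of_rat_rat)
  ultimately show ?thesis using that[of r] by simp
qed

lemma of_rat_fact: "of_rat (fact k) = (fact k :: real)"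
  by (metis of_nat_fact of_rat_of_nat_eq)

lemma moment_eq_coeff: "moment x a k = fact k * fps_nth (mgf x a) k"
  by (simp add: mgf_def)

lemma moment_sD: "\<exists>r. Re (moment (pi / 2) sD k) = of_rat r * lam ^ Suc k"
proof -
  obtain q where "q \<in> \<rat>" "fps_nth (mgf (pi / 2) sD) k = q * of_real lam ^ Suc k" using lemniscatic.D_coeff by blast
  then obtain r where "moment (pi / 2) sD k = of_real (fact k * of_rat r * lam ^ Suc k)"
    by (auto simp: moment_eq_coeff elim!: Rats_complexE)
  then show ?thesis by (intro exI[of _ "fact k * r"]) (simp add: of_rat_mult of_rat_fact)
qed

lemma moment_sA: "\<exists>r. Im (moment (pi / 2) sA k) = of_rat r * lam ^ Suc k"
proof -
  obtain q where "q \<in> \<rat>" "fps_nth (mgf (pi / 2) sA) k = \<i> * (q * of_real lam ^ Suc k)" using lemniscatic.A_coeff by blast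
  then obtain r where "moment (pi / 2) sA k = \<i> * of_real (fact k * of_rat r * lam ^ Suc k)"
    by (auto simp: moment_eq_coeff elim!: Rats_complexE)
  then show ?thesis by (intro exI[of _ "fact k * r"]) (simp add: of_rat_mult of_rat_fact)
qed

lemma moment_sD1:
  assumes "k > 0" shows "\<exists>r s. Re (moment (pi / 2) sD1 k) = of_rat r * lam ^ (k + 2) + of_rat s * lam ^ k / pi"
proof -
  obtain q q' where "q \<in> \<rat>" "q' \<in> \<rat>" "fps_nth (mgf (pi / 2) sD1) k = q * of_real lam ^ (k + 2) + q' * of_real kA * of_real lam ^ k"
    using lemniscatic.D1_coeff[OF assms] unfolding mgf_relations(6) by blast
  then obtain r s where "moment (pi / 2) sD1 k = of_real (fact k * (of_rat r * lam ^ (k + 2) + of_rat s * kA * lam ^ k))"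
    by (auto simp: moment_eq_coeff elim!: Rats_complexE)
  then have "Re (moment (pi / 2) sD1 k) = of_rat (fact k * r) * lam ^ (k + 2) + of_rat (fact k * s) * lam ^ k / pi"
    by (simp add: of_rat_mult of_rat_fact kA_eq algebra_simps)
  then show ?thesis by blast
qed

lemma moment_sB1:
  assumes "k > 0" shows "\<exists>r s. Im (moment (pi / 2) sB1 k) = of_rat r * lam ^ (k + 2) + of_rat s * lam ^ k / pi"
proof -
  obtain q q' where "q \<in> \<rat>" "q' \<in> \<rat>" "fps_nth (mgf (pi / 2) sB1) k = \<i> * (q * of_real lam ^ (k + 2) + q' * of_real kA * of_real lam ^ k)"
    using lemniscatic.B1_coeff[OF assms] unfolding mgf_relations(7) by blast
  then obtain r s where "moment (pi / 2) sB1 k = \<i> * of_real (fact k * (of_rat r * lam ^ (k + 2) + of_rat s * kA * lam ^ k))"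
    by (auto simp: moment_eq_coeff algebra_simps elim!: Rats_complexE)
  then have "Im (moment (pi / 2) sB1 k) = of_rat (fact k * r) * lam ^ (k + 2) + of_rat (fact k * s) * lam ^ k / pi"
    by (simp add: of_rat_mult of_rat_fact kA_eq algebra_simps)
  then show ?thesis by blast
qed

lemma moment_sZ1:
  assumes "k mod 4 = 0" "k > 0" shows "\<exists>r. Re (moment (pi / 2) sZ1 k) = of_rat r * lam ^ k / pi"
proof -
  obtain q where "q \<in> \<rat>" "fps_nth (mgf (pi / 2) sZ1) k = q * of_real kA * of_real lam ^ k"
    using lemniscatic.Z1_coeff[OF assms] mgf_relations(8)[of "pi / 2"] by metis
  then obtain r where "moment (pi / 2) sZ1 k = of_real (fact k * of_rat r * kA * lam ^ k)"
    by (auto simp: moment_eq_coeff elim!: Rats_complexE)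
  then show ?thesis by (intro exI[of _ "fact k * r"]) (simp add: of_rat_mult of_rat_fact kA_eq)
qed

lemma moment_sZ2:
  assumes "k mod 4 = 0" "k > 0"
  shows "\<exists>r s. Re (moment (pi / 2) sZ2 (Suc k)) = of_rat r * lam ^ (k + 4) + of_rat s * lam ^ k / pi ^ 2"
proof -
  obtain c where c: "mgf (pi / 2) sZ1 = fps_const (1/2) * (fps_deriv (mgf (pi / 2) sZ) - mgf (pi / 2) sZ * mgf (pi / 2) sZ) + fps_const c"
    using mgf_relations(8) by blast
  obtain d where d: "fps_deriv (mgf (pi / 2) sZ2) = mgf (pi / 2) sD * mgf (pi / 2) sD2 + fps_const (2 * of_real kD) * mgf (pi / 2) sZ1 + fps_const d"
    using mgf_relations(10) by blast
  obtain q q' where q: "q \<in> \<rat>" "q' \<in> \<rat>" "fps_nth (fps_deriv (mgf (pi / 2) sZ2)) k = q * of_real lam ^ (k + 4) + q' * of_real kA ^ 2 * of_real lam ^ k"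
    unfolding d using lemniscatic.Z2_coeff[OF mgf_relations(6,9) c assms] by blast
  have "moment (pi / 2) sZ2 (Suc k) = fact k * fps_nth (fps_deriv (mgf (pi / 2) sZ2)) k"
    by (simp add: moment_eq_coeff mult_ac)
  also have "\<dots> = fact k * (q * of_real lam ^ (k + 4) + q' * of_real kA ^ 2 * of_real lam ^ k)" by (simp only: q)
  finally obtain r s where "moment (pi / 2) sZ2 (Suc k) = of_real (fact k * (of_rat r * lam ^ (k + 4) + of_rat s * kA ^ 2 * lam ^ k))"
    using q(1,2) by (auto elim!: Rats_complexE)
  then have "Re (moment (pi / 2) sZ2 (Suc k)) = of_rat (fact k * r) * lam ^ (k + 4) + of_rat (fact k * s) * lam ^ k / pi ^ 2"
    by (simp add: of_rat_mult of_rat_fact kA_eq power_one_over algebra_simps)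
  then show ?thesis by blast
qed

text \<open>With \<open>k = 4 * m - 4\<close>, the moments of order \<open>k\<close> carry
  \<open>pi ^ (k + 1)\<close> and those of order \<open>k + 1\<close> carry
  \<open>pi ^ (k + 2)\<close>. Together with the monomials of the six moments this produces just
  five products of powers of \<open>pi\<close> and \<open>lam\<close>.\<close>

lemma res_total_value:
  assumes "m \<ge> 2"
  defines "P \<equiv> pi * lam"
  shows "\<exists>c1 c2 c3 c4 c5 :: rat. - pi * (- 4) ^ m / 32 * res_total (4 * m - 3) =
     of_rat c1 * P ^ (4 * m - 4) + of_rat c2 * P ^ (4 * m - 3) + of_rat c3 * P ^ (4 * m - 2)
     + of_rat c4 * (P ^ (4 * m - 1) / pi) + of_rat c5 * (P ^ (4 * m) / pi ^ 2)"
proof -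
  define k where "k = 4 * m - 4"
  have k: "k mod 4 = 0" "k > 0"
    and e: "4 * m - 3 = Suc k" "4 * m - 2 = k + 2" "4 * m - 1 = k + 3" "4 * m = k + 4" "4 * m - 4 = k"
    using assms(1) by (auto simp: k_def)
  obtain r1 where r1: "Re (moment (pi / 2) sZ1 k) = of_rat r1 * lam ^ k / pi" using moment_sZ1[OF k] by blast
  obtain r2 where r2: "Re (moment (pi / 2) sD k) = of_rat r2 * lam ^ Suc k" using moment_sD by blast
  obtain r3 s3 where r3: "Re (moment (pi / 2) sD1 (Suc k)) = of_rat r3 * lam ^ (Suc k + 2) + of_rat s3 * lam ^ Suc k / pi"
    using moment_sD1[of "Suc k"] by auto
  obtain r4 s4 where r4: "Re (moment (pi / 2) sZ2 (Suc k)) = of_rat r4 * lam ^ (k + 4) + of_rat s4 * lam ^ k / pi ^ 2"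
    using moment_sZ2[OF k] by blast
  obtain r5 s5 where r5: "Im (moment (pi / 2) sB1 (Suc k)) = of_rat r5 * lam ^ (Suc k + 2) + of_rat s5 * lam ^ Suc k / pi"
    using moment_sB1[of "Suc k"] by auto
  obtain r6 where r6: "Im (moment (pi / 2) sA (Suc k)) = of_rat r6 * lam ^ Suc (Suc k)" using moment_sA by blast
  define x where "x = lam ^ k"
  define q where "q = pi ^ k"
  \<comment> \<open>Collects \<open>(- 4) ^ m / 32\<close>, the factor \<open>1 / 2\<close> in
    \<open>res_total\<close> and the \<open>1 / 2 ^ k\<close> from
    \<open>(pi / 2) ^ k\<close>.\<close>
  define w :: rat where "w = (- 4) ^ m / (64 * 2 ^ k)"
  have w: "of_rat w = (- 4) ^ m / (64 * 2 ^ k :: real)"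
    by (simp add: w_def of_rat_divide of_rat_mult of_rat_power of_rat_minus)
  have "- pi * (- 4) ^ m / 32 * res_total (Suc k) =
     of_rat w * - pi * (of_nat (Suc k) * q * (of_rat r1 * x / pi - of_rat r2 * (lam * x))
     + pi / 2 * q * (of_rat r3 * (lam ^ 3 * x) + of_rat s3 * (lam * x) / pi - (of_rat r4 * (lam ^ 4 * x) + of_rat s4 * x / pi ^ 2))
     - pi / 2 * q * (of_rat r5 * (lam ^ 3 * x) + of_rat s5 * (lam * x) / pi - of_rat r6 * (lam ^ 2 * x)))"
    unfolding res_total_def w diff_Suc_1 r1 r2 r3 r4 r5 r6
    by (simp add: power_divide power_add x_def[symmetric] q_def[symmetric] eval_nat_numeral field_simps)
  also have "\<dots> = of_rat (w * (- of_nat (Suc k) * r1 + s4 / 2)) * (q * x)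
     + of_rat (w * (of_nat (Suc k) * r2 - s3 / 2 + s5 / 2)) * (pi * lam * (q * x))
     + of_rat (w * (- r6 / 2)) * (pi ^ 2 * lam ^ 2 * (q * x))
     + of_rat (w * (- r3 / 2 + r5 / 2)) * (pi ^ 2 * lam ^ 3 * (q * x))
     + of_rat (w * r4 / 2) * (pi ^ 2 * lam ^ 4 * (q * x))"
    by (simp add: of_rat_mult of_rat_add of_rat_diff of_rat_minus of_rat_divide eval_nat_numeral field_simps)
  finally have main: "- pi * (- 4) ^ m / 32 * res_total (Suc k) = \<dots>" .
  have "P ^ k = q * x" by (simp add: P_def q_def x_def power_mult_distrib)
  then have "P ^ k = q * x" "P ^ Suc k = pi * lam * (q * x)" "P ^ (k + 2) = pi ^ 2 * lam ^ 2 * (q * x)"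
    "P ^ (k + 3) / pi = pi ^ 2 * lam ^ 3 * (q * x)" "P ^ (k + 4) / pi ^ 2 = pi ^ 2 * lam ^ 4 * (q * x)"
    by (simp_all add: power_add P_def power_mult_distrib) (simp_all add: eval_nat_numeral)
  note pw = this
  show ?thesis unfolding e(1,2,3,5) unfolding e(4) main pw by blast
qed

text \<open>From \<open>P = G^2 / (2 * sqrt 2 * sqrt pi)\<close> one gets
  \<open>P^2 = G^4 / (8 * pi)\<close>. Even powers are therefore free of radicals, and odd powers
  contribute the \<open>sqrt 2\<close> and the half-integral power of \<open>pi\<close>.\<close>

lemma lemniscate_powers:
  fixes m :: nat
  assumes "m \<ge> 2" and G: "G = Gamma (1/4)"
  defines "P \<equiv> pi * lam"
  shows "P ^ (4 * m - 4) = of_rat (1 / 8 ^ (2 * m - 2)) * (G ^ (8*m - 8) / pi ^ (2*m - 2))" (is ?g1)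
    "P ^ (4 * m - 3) = of_rat (1 / (2 * 8 ^ (2 * m - 2))) * (G ^ (8*m - 6) / (sqrt 2 * pi powr (2 * real m - 3/2)))" (is ?g2)
    "P ^ (4 * m - 2) = of_rat (1 / 8 ^ (2 * m - 1)) * (G ^ (8*m - 4) / pi ^ (2*m - 1))" (is ?g3)
    "P ^ (4 * m - 1) / pi = of_rat (1 / (2 * 8 ^ (2 * m - 1))) * (G ^ (8*m - 2) / (sqrt 2 * pi powr (2 * real m + 1/2)))" (is ?g4)
    "P ^ (4 * m) / pi ^ 2 = of_rat (1 / 8 ^ (2 * m)) * (G ^ (8*m) / pi ^ (2*m + 2))" (is ?g5)
proof -
  have P: "P = G ^ 2 / (2 * sqrt 2 * sqrt pi)"
    unfolding P_def lam_Gamma G by simp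
  have P2: "P ^ (2 * j) = G ^ (4 * j) / (8 ^ j * pi ^ j)" for j
  proof -
    have "P ^ 2 = G ^ 4 / (8 * pi)" unfolding P by (simp add: power_divide power_mult_distrib flip: power_mult)
    then have "P ^ (2 * j) = (G ^ 4 / (8 * pi)) ^ j" by (simp add: power_mult)
    then show ?thesis by (simp add: power_divide power_mult_distrib power_mult)
  qed
  have P2': "P ^ Suc (2 * j) = G ^ (4 * j + 2) / (2 * 8 ^ j * (sqrt 2 * (pi ^ j * sqrt pi)))" for j
    unfolding power_Suc P2 by (simp add: P power_add power2_eq_square mult_ac)
  have rt: "of_rat (1 / 8 ^ j) = (1 / 8 ^ j :: real)" "of_rat (1 / (2 * 8 ^ j)) = (1 / (2 * 8 ^ j) :: real)" for j
    by (simp_all add: of_rat_divide of_rat_power of_rat_mult)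
  have e: "4 * m - 4 = 2 * (2 * m - 2)" "4 * m - 3 = Suc (2 * (2 * m - 2))" "4 * m - 2 = 2 * (2 * m - 1)"
    "4 * m - 1 = Suc (2 * (2 * m - 1))" "4 * m = 2 * (2 * m)"
    "8 * m - 8 = 4 * (2 * m - 2)" "8 * m - 6 = 4 * (2 * m - 2) + 2" "8 * m - 4 = 4 * (2 * m - 1)"
    "8 * m - 2 = 4 * (2 * m - 1) + 2" "8 * m = 4 * (2 * m)"
    using assms(1) by auto
  have pw1: "pi powr (2 * real m - 3/2) = pi ^ (2 * m - 2) * sqrt pi"
  proof -
    have "2 * real m - 3/2 = real (2 * m - 2) + 1/2" using assms(1) by (simp add: of_nat_diff)
    then have "pi powr (2 * real m - 3/2) = pi powr real (2 * m - 2) * pi powr (1/2)" by (simp only: powr_add)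
    then show ?thesis by (simp only: powr_realpow[OF pi_gt_zero] powr_half_sqrt[OF pi_ge_zero])
  qed
  have pw2: "pi powr (2 * real m + 1/2) = pi * (pi ^ (2 * m - 1) * sqrt pi)"
  proof -
    have "2 * real m + 1/2 = real (Suc (2 * m - 1)) + 1/2" using assms(1) by (simp add: of_nat_diff)
    then have "pi powr (2 * real m + 1/2) = pi powr real (Suc (2 * m - 1)) * pi powr (1/2)" by (simp only: powr_add)
    then show ?thesis by (simp only: powr_realpow[OF pi_gt_zero] powr_half_sqrt[OF pi_ge_zero] power_Suc mult.assoc)
  qed
  show ?g1
    unfolding e(1) e(6) P2 rt by simp
  show ?g2
    unfolding e(2) e(7) P2' rt pw1 by simp
  show ?g3
    unfolding e(3) e(8) P2 rt by simp
  show ?g4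
    unfolding e(4) e(9) P2' rt pw2 by simp
  show ?g5
    unfolding e(5) e(10) P2 rt by (simp add: power_add power2_eq_square)
qed

theorem theorem5p1:
  fixes m :: nat and G :: real
  assumes "m \<ge> 2"
    and "G = Gamma (1/4)"
  shows "\<exists>q1 q2 q3 q4 q5 :: rat.
    ((\<lambda>x::real. x ^ (4*m - 3) / ((cosh (2*x) - cos (2*x)) * (cosh x - cos x)))
       has_integral
      (of_rat q1 * (G ^ (8*m - 8) / pi ^ (2*m - 2))
     + of_rat q2 * (G ^ (8*m - 6) / (sqrt 2 * pi powr (2 * real m - 3/2)))
     + of_rat q3 * (G ^ (8*m - 4) / pi ^ (2*m - 1))
     + of_rat q4 * (G ^ (8*m - 2) / (sqrt 2 * pi powr (2 * real m + 1/2)))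
     + of_rat q5 * (G ^ (8*m) / pi ^ (2*m + 2)))) {0<..}"
proof -
  obtain c1 c2 c3 c4 c5 :: rat where c: "- pi * (- 4) ^ m / 32 * res_total (4 * m - 3) =
     of_rat c1 * (pi * lam) ^ (4 * m - 4) + of_rat c2 * (pi * lam) ^ (4 * m - 3) + of_rat c3 * (pi * lam) ^ (4 * m - 2)
     + of_rat c4 * ((pi * lam) ^ (4 * m - 1) / pi) + of_rat c5 * ((pi * lam) ^ (4 * m) / pi ^ 2)"
    using res_total_value[OF assms(1)] by blast
  have "((\<lambda>x::real. x ^ (4*m - 3) / ((cosh (2*x) - cos (2*x)) * (cosh x - cos x))) has_integral
      (- pi * (- 4) ^ m / 32 * res_total (4 * m - 3))) {0<..}"
    using mixed_integral_value[OF assms(1)] unfolding mixed_real_def[abs_def] .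
  then show ?thesis
    unfolding c lemniscate_powers[OF assms] mult.assoc[symmetric] of_rat_mult[symmetric] by blast
qed

end
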